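(* Fix $m\in\mathbb{C}$ and let $K\subset\mathbb{C}\setminus E$ be bounded away from $E$, i.e., $\mathrm{dist}(K,E)>0$. Then $$u_n(ny;m)=\mathrm{i}\,p(y)+\mathcal{O}(n^{-1}),\quad n\to+\infty,\quad y\in K,$$ where the error estimate is uniform for $y\in K$.
   Context: For $n\in\mathbb{Z}$ and $m\in\mathbb{C}$, $u_n(x;m)$ denotes the unique rational solution $u(x)$ of the Painlev\'e-III equation $$u''=\frac{(u')^2}{u}-\frac{u'}{x}+\frac{4\Theta_0u^2+4(1-\Theta_\infty)}{x}+4u^3-\frac4u,\qquad \Theta_0=n+m,\quad \Theta_\infty=m-n+1,$$ that tends to $1$ as $x\to\infty$. $p(y):=\frac{\mathrm{i}}{2y}-\mathrm{i}\sqrt{\frac{1}{4y^2}+1}$, where the square root equals $1$ at $y=\infty$ and is analytic except on the segment $I$ of the imaginary axis joining $y=\pm\frac12\mathrm{i}$ (a branch cut). $p$ is analytic and non-vanishing on $\mathbb{C}\setminus I$, and $p(y)\to-\mathrm{i}$ as $y\to\infty$. $V(\lambda;y):=-\log(\lambda)-\mathrm{i}y(\lambda-\lambda^{-1})$; its real part is single-valued for $\lambda\in\mathbb{C}\setminus\{0\}$. The set of $y\in\mathbb{C}\setminus I$ where $\mathrm{Re}(V(p(y);y))=0$ is the union of four analytic arcs: the two rays of the imaginary axis joining $\pm\frac12\mathrm{i}$ to $\pm\mathrm{i}\infty$, an arc in the right half-plane joining $\frac12\mathrm{i}$ to $-\frac12\mathrm{i}$, and the reflection of the latter in the imaginary axis.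 $E$ (the "eye") is the compact simply-connected set containing $y=0$ whose boundary is the union of the latter two arcs. *)

theory Defs
  imports "HOL-Complex_Analysis.Complex_Analysis" "HOL-Computational_Algebra.Computational_Algebra"
begin

text \<open>
  Rational functions are taken in lowest terms, so that the function determines the quotient and
  has no removable singularities; at a pole its value is \<open>0\<close>, by the convention \<open>z / 0 = 0\<close>.
\<close>
definition rational_fun :: "(complex \<Rightarrow> complex) \<Rightarrow> bool" where
  "rational_fun u \<longleftrightarrow>
     (\<exists>P Q :: complex poly. Q \<noteq> 0 \<and> coprime P Q \<and> u = (\<lambda>x. poly P x / poly Q x))"

text \<open>
  The Painlev\'e-III equation with parameters \<open>\<Theta>\<^sub>0\<close> and \<open>\<Theta>\<^sub>\<infinity>\<close>. It is imposed at every point where its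
  terms make sense; for a rational \<open>u\<close>, \<open>u x \<noteq> 0\<close> excludes the poles along with the zeros.
\<close>
definition solves_PIII :: "complex \<Rightarrow> complex \<Rightarrow> (complex \<Rightarrow> complex) \<Rightarrow> bool" where
  "solves_PIII \<Theta>\<^sub>0 \<Theta>\<^sub>i\<^sub>n\<^sub>f u \<longleftrightarrow>
     (\<forall>x. x \<noteq> 0 \<and> u x \<noteq> 0 \<longrightarrow>
        deriv (deriv u) x =
          (deriv u x)\<^sup>2 / u x - deriv u x / x
          + (4 * \<Theta>\<^sub>0 * (u x)\<^sup>2 + 4 * (1 - \<Theta>\<^sub>i\<^sub>n\<^sub>f)) / x + 4 * (u x) ^ 3 - 4 / u x)"

definition u_PIII :: "int \<Rightarrow> complex \<Rightarrow> complex \<Rightarrow> complex" where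
  "u_PIII n m = (THE u. rational_fun u
     \<and> solves_PIII (of_int n + m) (m - of_int n + 1) u
     \<and> (u \<longlongrightarrow> 1) at_infinity)"

definition branch_cut :: "complex set" where
  "branch_cut = closed_segment (- \<i> / 2) (\<i> / 2)"

text \<open>
  The principal square root is the branch intended here: \<open>1 / (4 * y\<^sup>2) + 1\<close> is a nonpositive real
  number only for \<open>y\<close> in the branch cut (see \<open>csqrt_branch_holomorphic\<close>, \<open>csqrt_branch_at_infinity\<close>).
\<close>
definition p_PIII :: "complex \<Rightarrow> complex" where
  "p_PIII y = \<i> / (2 * y) - \<i> * csqrt (1 / (4 * y\<^sup>2) + 1)"

text \<open>
  Only the real part of \<open>V_PIII\<close> is used, and it does not depend on the branch of the logarithm
  (see \<open>Re_V_single_valued\<close>).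
\<close>
definition V_PIII :: "complex \<Rightarrow> complex \<Rightarrow> complex" where
  "V_PIII z y = - Ln z - \<i> * y * (z - inverse z)"

definition V_zero_set :: "complex set" where
  "V_zero_set = {y \<in> - branch_cut. Re (V_PIII (p_PIII y) y) = 0}"

text \<open>
  The arcs in the open right and left half-planes, together with their common endpoints. The
  endpoints belong to the branch cut, hence not to \<open>V_zero_set\<close>.
\<close>
definition eye_boundary :: "complex set" where
  "eye_boundary =
     {y \<in> V_zero_set. Re y > 0} \<union> {y \<in> V_zero_set. Re y < 0} \<union> {\<i> / 2, - \<i> / 2}"

definition eye :: "complex set" where
  "eye = (THE E. compact E \<and> simply_connected E \<and> 0 \<in> E \<and> frontier E = eye_boundary)"

lemma branch_cut_iff: "y \<in> branch_cut \<longleftrightarrow> Re y = 0 \<and> \<bar>Im y\<bar> \<le> 1 / 2"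
proof
  assume "y \<in> branch_cut"
  then obtain t where t: "0 \<le> t" "t \<le> 1" "y = (1 - t) *\<^sub>R (- \<i> / 2) + t *\<^sub>R (\<i> / 2)"
    by (auto simp: branch_cut_def closed_segment_def)
  have "Re y = 0" "Im y = t - 1 / 2"
    unfolding t(3) by (simp_all add: field_simps)
  then show "Re y = 0 \<and> \<bar>Im y\<bar> \<le> 1 / 2"
    using t(1,2) by linarith
next
  assume y: "Re y = 0 \<and> \<bar>Im y\<bar> \<le> 1 / 2"
  have "y = (1 - (Im y + 1/2)) *\<^sub>R (- \<i> / 2) + (Im y + 1/2) *\<^sub>R (\<i> / 2)"
    using y by (auto simp: complex_eq_iff field_simps)
  moreover have "0 \<le> Im y + 1/2" "Im y + 1/2 \<le> 1"
    using y by linarith+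
  ultimately show "y \<in> branch_cut"
    unfolding branch_cut_def closed_segment_def by blast
qed

lemma csqrt_branch_holomorphic:
  "(\<lambda>y. csqrt (1 / (4 * y\<^sup>2) + 1)) holomorphic_on - branch_cut"
proof -
  have "1 / (4 * y\<^sup>2) + 1 \<notin> \<real>\<^sub>\<le>\<^sub>0" if y: "y \<notin> branch_cut" for y
  proof
    assume "1 / (4 * y\<^sup>2) + 1 \<in> \<real>\<^sub>\<le>\<^sub>0"
    then obtain r where r: "r \<le> 0" "1 / (4 * y\<^sup>2) + 1 = complex_of_real r"
      by (auto elim: nonpos_Reals_cases)
    have y0: "y \<noteq> 0"
      using y by (auto simp: branch_cut_iff)
    have r1: "1 / (4 * y\<^sup>2) = complex_of_real (r - 1)"
      using r(2) by (simp add: algebra_simps)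
    have "complex_of_real (r - 1) \<noteq> 0"
      using r(1) by (simp del: of_real_diff)
    then have y2: "y\<^sup>2 = complex_of_real (1 / (4 * (r - 1)))"
      using r1 y0 by (simp add: field_simps)
    define s where "s = 1 / (4 * (r - 1))"
    have s: "s < 0" "- s \<le> 1 / 4"
      using r(1) by (auto simp: s_def field_simps)
    have "y\<^sup>2 = complex_of_real s"
      using y2 by (simp add: s_def)
    then have "Re (y\<^sup>2) = s" "Im (y\<^sup>2) = 0"
      by simp_all
    then have re: "(Re y)\<^sup>2 - (Im y)\<^sup>2 = s" and im: "2 * Re y * Im y = 0"
      by (simp_all only: Re_power2 Im_power2)
    have "Im y \<noteq> 0"
      using re s(1) by (auto simp: not_less dest: sym)
    then have "Re y = 0"
      using im by simp
    moreover have "\<bar>Im y\<bar> \<le> 1 / 2"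
    proof (rule power2_le_imp_le)
      show "\<bar>Im y\<bar>\<^sup>2 \<le> (1 / 2)\<^sup>2"
        using re s(2) \<open>Re y = 0\<close> by (simp add: power2_eq_square)
    qed simp
    ultimately show False
      using y by (simp add: branch_cut_iff)
  qed
  moreover have "0 \<in> branch_cut"
    by (simp add: branch_cut_iff)
  ultimately show ?thesis
    by (intro holomorphic_intros) auto
qed

lemma csqrt_branch_at_infinity:
  "((\<lambda>y. csqrt (1 / (4 * y\<^sup>2) + 1)) \<longlongrightarrow> 1) at_infinity"
proof -
  have "((\<lambda>y::complex. inverse y) \<longlongrightarrow> 0) at_infinity"
    by (rule tendsto_inverse_0)
  then have "((\<lambda>y::complex. (1 / 4) * (inverse y)\<^sup>2 + 1) \<longlongrightarrow> (1 / 4) * 0\<^sup>2 + 1) at_infinity"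
    by (intro tendsto_intros)
  then have "((\<lambda>y::complex. 1 / (4 * y\<^sup>2) + 1) \<longlongrightarrow> 1) at_infinity"
    by (simp add: field_simps)
  moreover have "isCont csqrt 1"
    by (rule continuous_at_csqrt) (simp add: complex_nonpos_Reals_iff)
  ultimately show ?thesis
    using isCont_tendsto_compose[of 1 csqrt] by fastforce
qed

lemma Re_V_single_valued:
  assumes "exp L = z"
  shows "Re (V_PIII z y) = Re (- L - \<i> * y * (z - inverse z))"
proof -
  have "norm z = exp (Re L)" "z \<noteq> 0"
    using assms by auto
  then show ?thesis
    by (simp add: V_PIII_def)
qed

end

theory Submission
  imports Defs "HOL-Real_Asymp.Real_Asymp"
begin

text \<open>
  After the substitution \<open>x = n * y\<close> the Painleve-III equation for \<open>log u\<close> is singularly perturbed: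
  divided by \<open>n\<^sup>2\<close>, it becomes an algebraic equation in the limit of large \<open>n\<close>, and \<open>\<i> * p_PIII y\<close> is the
  root of that equation which tends to \<open>1\<close> at infinity. So let
  \<open>u (n * y) = \<i> * p_PIII y * exp h\<close>. In terms of the coordinate \<open>Z = phase y\<close>, which is
  \<open>- 2 * V_PIII (p_PIII y) y\<close> up to an imaginary constant, the linear part of the equation for \<open>h\<close> becomes
  \<open>h'' = n\<^sup>2 * h\<close>, and the remaining terms are, relative to \<open>n\<^sup>2\<close>, quadratic in \<open>h\<close> or of order \<open>1 / n\<close>
  (\<open>rescaled_PIII\<close>, \<open>norm_phase_perturbation\<close>).
  
  The linear equation \<open>h'' = n\<^sup>2 * h + N\<close> factors into \<open>k' - n * k = N\<close> and \<open>h' + n * h = k\<close>. A bounded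
  solution \<open>k\<close> is controlled by \<open>N\<close> on a path from \<open>Z\<close> on which \<open>Re Z\<close> increases to infinity, and \<open>h\<close>
  by \<open>k\<close> on one on which \<open>Re Z\<close> decreases. Hence \<open>h\<close> is of order \<open>sup (norm N) / n\<^sup>2\<close> on every
  region that contains, with each of its points, one ray of either kind (\<open>second_order_bound\<close>).
  
  This is where the eye enters. The phase maps the complement of the eye conformally onto the plane
  without the segment from \<open>- \<i> * pi\<close> to \<open>\<i> * pi\<close> (\<open>phase_image\<close>, \<open>inj_on_phase\<close>): the real part of the
  phase vanishes on the imaginary rays and on the boundary of the eye, and the two boundary arcs become the
  two sides of the segment. A set at positive distance from the eye is mapped into the complement of a
  diamond around the segment. The part of that complement in the upper half-plane is closed under
  upward rays parallel to the edges of the diamond, and likewise below.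
  
  The smallness of \<open>h\<close> that makes the quadratic term harmless comes from infinity, where \<open>u\<close> and
  \<open>\<i> * p_PIII\<close> both tend to \<open>1\<close>. Consider the set of points where \<open>exp h\<close> is not yet known to be close to
  \<open>1\<close>, poles of \<open>u\<close> included. It is compact; if it is not empty, take a point of it with the largest
  imaginary part. The region strictly above that point is free of bad points, so the linear estimate
  applies there and gives an error of order \<open>1 / n\<close>, which by continuity makes the point itself good
  (\<open>uniform_estimate\<close>). The same estimate on the whole region is the theorem.
  
  It remains to identify the objects of the statement. A rational solution for each \<open>n \<ge> 0\<close> is produced
  from \<open>u = 1\<close> by Baecklund transformations (\<open>rational_backlund_step\<close>), and it is the only one, because the
  difference of two solutions satisfies a linear equation close to \<open>d'' = 16 * d\<close> near infinity, to which the same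
  linear estimate applies (\<open>rational_solution_unique\<close>). The eye is the complement of the explicit set
  \<open>eye_exterior\<close>, which is invariant under scaling by factors \<open>t \<ge> 1\<close> (\<open>eye_eq\<close>).
\<close>

section \<open>Linear second-order equations on regions closed under rays\<close>

text \<open>
  Variation of constants from infinity: \<open>exp (- c * s) * f s\<close> tends to \<open>0\<close> because \<open>f\<close> is bounded, and its
  derivative has norm at most \<open>\<rho> * exp (- Re c * s)\<close>.
\<close>
lemma linear_ode_bound_at_0:
  fixes f r :: "real \<Rightarrow> complex"
  assumes der: "\<And>s. 0 \<le> s \<Longrightarrow> (f has_vector_derivative (c * f s + r s)) (at s)"
    and c: "Re c > 0" and r: "\<And>s. 0 \<le> s \<Longrightarrow> norm (r s) \<le> \<rho>"
    and B: "\<And>s. 0 \<le> s \<Longrightarrow> norm (f s) \<le> B"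
  shows "norm (f 0) \<le> \<rho> / Re c"
proof -
  define l where "l = Re c"
  have l: "l > 0" using c by (simp add: l_def)
  define F where "F s = exp (s *\<^sub>R (- c)) * f s" for s
  have F': "(F has_vector_derivative exp (s *\<^sub>R (- c)) * r s) (at s)" if "s \<ge> 0" for s
  proof -
    have "((\<lambda>s. exp (s *\<^sub>R (- c))) has_vector_derivative exp (s *\<^sub>R (-c)) * (- c)) (at s)"
      by (rule exp_scaleR_has_vector_derivative_right)
    from has_vector_derivative_mult[OF this der[OF that]]
    show ?thesis unfolding F_def by (rule has_vector_derivative_eq_rhs) (simp_all add: algebra_simps)
  qed
  have nexp: "norm (exp (s *\<^sub>R (- c))) = exp (- (l * s))" for s
    by (simp add: l_def mult.commute)
  have bd: "norm (F s - F 0) \<le> - (\<rho> / l * exp (- (l * s))) - - (\<rho> / l * exp (- (l * 0)))" if "s > 0" for s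
  proof (rule differentiable_bound_general[of 0 s F "\<lambda>s. - (\<rho> / l * exp (- (l * s)))" "\<lambda>s. exp (s *\<^sub>R (- c)) * r s" "\<lambda>s. \<rho> * exp (- (l * s))"])
    show "continuous_on {0..s} F"
    proof (intro continuous_at_imp_continuous_on ballI)
      fix x assume "x \<in> {0..s}"
      then show "isCont F x" using has_vector_derivative_continuous[OF F'[of x]] by simp
    qed
    show "(F has_vector_derivative exp (x *\<^sub>R (- c)) * r x) (at x)" if "0 < x" for x
      using F' that by simp
    show "((\<lambda>s. - (\<rho> / l * exp (- (l * s)))) has_vector_derivative \<rho> * exp (- (l * x))) (at x)" for x
      unfolding has_real_derivative_iff_has_vector_derivative[symmetric]
      using l by (auto intro!: derivative_eq_intros simp: field_simps)
    show "norm (exp (x *\<^sub>R (- c)) * r x) \<le> \<rho> * exp (- (l * x))" if "0 < x" for x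
      using r[of x] that unfolding norm_mult nexp by (simp add: mult.commute mult_right_mono)
  qed (use that l in \<open>auto intro!: continuous_intros\<close>)
  have rho: "\<rho> \<ge> 0" using r[of 0] norm_ge_zero[of "r 0"] by linarith
  have B0: "B \<ge> 0" using B[of 0] norm_ge_zero[of "f 0"] by linarith
  have le: "norm (f 0) \<le> \<rho> / l + B * exp (- (l * s))" if "s > 0" for s
  proof -
    have "norm (f 0) = norm (F 0)" by (simp add: F_def)
    also have "\<dots> \<le> norm (F s - F 0) + norm (F s)" by norm
    also have "norm (F s - F 0) \<le> \<rho> / l"
    proof -
      have "\<rho> / l * exp (- (l * s)) \<ge> 0" using rho l by simp
      then show ?thesis using bd[OF that] by simp
    qed
    also have "norm (F s) \<le> B * exp (- (l * s))"
      using B[of s] that unfolding F_def norm_mult nexp by (simp add: mult.commute mult_right_mono)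
    finally show ?thesis by simp
  qed
  have "((\<lambda>s. \<rho> / l + B * exp (- (l * s))) \<longlongrightarrow> \<rho> / l + B * 0) at_top"
    using l by (intro tendsto_intros) real_asymp
  then have "norm (f 0) \<le> \<rho> / l + B * 0"
    by (rule tendsto_lowerbound) (auto intro!: eventually_mono[OF eventually_gt_at_top[of 0]] le)
  then show ?thesis by (simp add: l_def)
qed

lemma linear_ode_bound_on_rays:
  fixes f r :: "complex \<Rightarrow> complex"
  assumes der: "\<And>z. z \<in> G \<Longrightarrow> (f has_field_derivative (\<mu> * f z + r z)) (at z)"
    and G: "\<And>z s. z \<in> G \<Longrightarrow> 0 \<le> s \<Longrightarrow> z + of_real s * \<kappa> \<in> G"
    and l: "Re (\<mu> * \<kappa>) > 0" and r: "\<And>z. z \<in> G \<Longrightarrow> norm (r z) \<le> \<rho>"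
    and B: "\<And>z. z \<in> G \<Longrightarrow> norm (f z) \<le> B"
    and z: "z \<in> G"
  shows "norm (f z) \<le> norm \<kappa> * \<rho> / Re (\<mu> * \<kappa>)"
proof -
  define g where "g = (\<lambda>s::real. f (z + of_real s * \<kappa>))"
  have "norm (g 0) \<le> (norm \<kappa> * \<rho>) / Re (\<mu> * \<kappa>)"
  proof (rule linear_ode_bound_at_0[where r = "\<lambda>s. \<kappa> * r (z + of_real s * \<kappa>)" and B = B])
    fix s :: real assume s: "0 \<le> s"
    let ?w = "z + of_real s * \<kappa>"
    have w: "?w \<in> G" using G z s by blast
    have "((\<lambda>s. z + of_real s * \<kappa>) has_vector_derivative \<kappa>) (at s)"
      by (auto intro!: derivative_eq_intros)
    from field_vector_diff_chain_at[OF this der[OF w]]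
    show "(g has_vector_derivative (\<mu> * \<kappa> * g s + \<kappa> * r ?w)) (at s)"
      unfolding g_def o_def by (rule has_vector_derivative_eq_rhs) (simp add: algebra_simps)
    show "norm (\<kappa> * r ?w) \<le> norm \<kappa> * \<rho>" using r[OF w] by (simp add: norm_mult mult_left_mono)
    show "norm (g s) \<le> B" using B[OF w] by (simp add: g_def)
  qed (use l in auto)
  then show ?thesis by (simp add: g_def)
qed

text \<open>
  The operator \<open>d\<^sup>2/dz\<^sup>2 - n\<^sup>2\<close> factors as \<open>(d/dz - n) (d/dz + n)\<close>; the two first-order equations are solved
  along rays into the right and into the left half-plane respectively. The slope of the rays only enters
  through the constant, as the ratio of arc length to real part.
\<close>
lemma second_order_bound:
  fixes h h1 N :: "complex \<Rightarrow> complex"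
  assumes h: "\<And>z. z \<in> G \<Longrightarrow> (h has_field_derivative h1 z) (at z)"
    and h1: "\<And>z. z \<in> G \<Longrightarrow> (h1 has_field_derivative (of_real (n\<^sup>2) * h z + N z)) (at z)"
    and GR: "\<And>z s. z \<in> G \<Longrightarrow> 0 \<le> s \<Longrightarrow> z + of_real s * Complex 1 M \<in> G"
    and GL: "\<And>z s. z \<in> G \<Longrightarrow> 0 \<le> s \<Longrightarrow> z + of_real s * Complex (-1) M \<in> G"
    and n: "n > 0" and N: "\<And>z. z \<in> G \<Longrightarrow> norm (N z) \<le> \<nu>"
    and B: "\<And>z. z \<in> G \<Longrightarrow> norm (h z) + norm (h1 z) \<le> B"
    and z: "z \<in> G"
  shows "norm (h z) + norm (h1 z) / n \<le> 3 * (1 + M\<^sup>2) * \<nu> / n\<^sup>2"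
proof -
  define \<kappa> where "\<kappa> = sqrt (1 + M\<^sup>2)"
  have \<kappa>: "\<kappa> \<ge> 1" "\<kappa>\<^sup>2 = 1 + M\<^sup>2" by (auto simp: \<kappa>_def)
  have \<nu>: "\<nu> \<ge> 0" using N[OF z] norm_ge_zero[of "N z"] by linarith
  define k where "k z = h1 z + of_real n * h z" for z
  have kb: "norm (k z) \<le> \<kappa> * \<nu> / n" if "z \<in> G" for z
  proof -
    have "norm (k z) \<le> norm (Complex 1 M) * \<nu> / Re (of_real n * Complex 1 M)"
    proof (rule linear_ode_bound_on_rays[where f = k and \<mu> = "of_real n" and r = N and B = "B + n * B" and G = G])
      fix z assume z: "z \<in> G"
      show "(k has_field_derivative of_real n * k z + N z) (at z)"
        unfolding k_def using h[OF z] h1[OF z]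
        by (auto intro!: derivative_eq_intros simp: algebra_simps power2_eq_square)
      have "norm (h z) \<le> B" "norm (h1 z) \<le> B"
        using B[OF z] norm_ge_zero[of "h z"] norm_ge_zero[of "h1 z"] by linarith+
      then show "norm (k z) \<le> B + n * B" unfolding k_def using n
        by (intro norm_triangle_mono) (auto simp: norm_mult)
    qed (use GR N n that in auto)
    then show ?thesis using n by (simp add: \<kappa>_def cmod_def)
  qed
  have hb: "norm (h z) \<le> \<kappa> * (\<kappa> * \<nu> / n) / n"
  proof -
    have "norm (h z) \<le> norm (Complex (-1) M) * (\<kappa> * \<nu> / n) / Re (- of_real n * Complex (-1) M)"
    proof (rule linear_ode_bound_on_rays[where f = h and \<mu> = "- of_real n" and r = k and B = B and G = G])
      fix z assume z: "z \<in> G"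
      show "(h has_field_derivative - of_real n * h z + k z) (at z)"
        using h[OF z] by (simp add: k_def)
      show "norm (h z) \<le> B" 
        using B[OF z] norm_ge_zero[of "h z"] norm_ge_zero[of "h1 z"] by linarith
    qed (use GL kb n z in auto)
    then show ?thesis using n by (simp add: \<kappa>_def cmod_def)
  qed
  have "norm (h1 z) \<le> norm (k z) + n * norm (h z)"
  proof -
    have "h1 z = k z - of_real n * h z" by (simp add: k_def)
    then show ?thesis using norm_triangle_ineq4[of "k z" "of_real n * h z"] n by (simp add: norm_mult)
  qed
  then have e1: "norm (h1 z) / n \<le> norm (k z) / n + norm (h z)" using n by (simp add: field_simps)
  have e2: "norm (k z) / n \<le> \<kappa> * \<nu> / n / n" by (rule divide_right_mono[OF kb[OF z]]) (use n in simp)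
  have e3: "\<kappa> * \<nu> / n / n \<le> \<kappa> * (\<kappa> * \<nu> / n) / n"
  proof -
    have "\<nu> / n / n * \<kappa> * 1 \<le> \<nu> / n / n * \<kappa> * \<kappa>" using \<kappa> \<nu> n by (intro mult_left_mono) auto
    then show ?thesis by (simp add: field_simps)
  qed
  have "norm (h z) + norm (h1 z) / n \<le> 3 * (\<kappa> * (\<kappa> * \<nu> / n) / n)"
  proof -
    have "norm (h z) + norm (h1 z) / n \<le> \<kappa> * (\<kappa> * \<nu> / n) / n
        + (\<kappa> * (\<kappa> * \<nu> / n) / n + \<kappa> * (\<kappa> * \<nu> / n) / n)"
      by (rule add_mono[OF hb order_trans[OF e1 add_mono[OF order_trans[OF e2 e3] hb]]])
    also have "x + (x + x) = 3 * x" for x :: real by simp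
    finally show ?thesis .
  qed
  also have "\<dots> = 3 * \<kappa>\<^sup>2 * \<nu> / n\<^sup>2" by (simp add: power2_eq_square)
  finally show ?thesis by (simp add: \<kappa>)
qed

text \<open>
  When the right-hand side is itself bounded by a small multiple of the solution, that part is absorbed into the
  left-hand side. Boundedness of \<open>h\<close> and its derivative makes the supremum
  finite, without which nothing could be absorbed.
\<close>
lemma perturbed_second_order_bound:
  fixes h h1 N :: "complex \<Rightarrow> complex"
  assumes h: "\<And>z. z \<in> G \<Longrightarrow> (h has_field_derivative h1 z) (at z)"
    and h1: "\<And>z. z \<in> G \<Longrightarrow> (h1 has_field_derivative (of_real (n\<^sup>2) * h z + N z)) (at z)"
    and GR: "\<And>z s. z \<in> G \<Longrightarrow> 0 \<le> s \<Longrightarrow> z + of_real s * Complex 1 M \<in> G"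
    and GL: "\<And>z s. z \<in> G \<Longrightarrow> 0 \<le> s \<Longrightarrow> z + of_real s * Complex (-1) M \<in> G"
    and n: "n > 0"
    and N: "\<And>z. z \<in> G \<Longrightarrow> norm (N z) \<le> n\<^sup>2 * (\<epsilon> * (norm (h z) + norm (h1 z) / n) + \<eta>)"
    and \<epsilon>: "\<epsilon> \<ge> 0" "3 * (1 + M\<^sup>2) * \<epsilon> \<le> 1 / 2"
    and B: "\<And>z. z \<in> G \<Longrightarrow> norm (h z) + norm (h1 z) \<le> B"
    and z: "z \<in> G"
  shows "norm (h z) + norm (h1 z) / n \<le> 6 * (1 + M\<^sup>2) * \<eta>"
proof -
  define S where "S = (SUP z\<in>G. norm (h z) + norm (h1 z) / n)"
  have bdd: "bdd_above ((\<lambda>z. norm (h z) + norm (h1 z) / n) ` G)"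
  proof (rule bdd_aboveI2)
    fix z assume "z \<in> G"
    then have *: "norm (h z) \<le> B" "norm (h1 z) \<le> B"
      using B[of z] norm_ge_zero[of "h z"] norm_ge_zero[of "h1 z"] by linarith+
    show "norm (h z) + norm (h1 z) / n \<le> B + B / n" 
      using * n by (intro add_mono divide_right_mono) auto
  qed
  have leS: "norm (h z) + norm (h1 z) / n \<le> S" if "z \<in> G" for z
    unfolding S_def by (rule cSUP_upper[OF that bdd])
  have "norm (N z) \<le> n\<^sup>2 * (\<epsilon> * S + \<eta>)" if "z \<in> G" for z
  proof -
    have "n\<^sup>2 * (\<epsilon> * (norm (h z) + norm (h1 z) / n) + \<eta>) \<le> n\<^sup>2 * (\<epsilon> * S + \<eta>)"
      using leS[OF that] \<epsilon> n by (intro mult_left_mono add_right_mono) auto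
    then show ?thesis using N[OF that] by linarith
  qed
  from second_order_bound[OF h h1 GR GL n this B]
  have "norm (h z) + norm (h1 z) / n \<le> 3 * (1 + M\<^sup>2) * (n\<^sup>2 * (\<epsilon> * S + \<eta>)) / n\<^sup>2" if "z \<in> G" for z
    using that by blast
  moreover have "3 * (1 + M\<^sup>2) * (n\<^sup>2 * (\<epsilon> * S + \<eta>)) / n\<^sup>2 = (3 * (1 + M\<^sup>2) * \<epsilon>) * S + 3 * (1 + M\<^sup>2) * \<eta>"
    using n by (simp add: field_simps)
  ultimately have *: "norm (h z) + norm (h1 z) / n \<le> (3 * (1 + M\<^sup>2) * \<epsilon>) * S + 3 * (1 + M\<^sup>2) * \<eta>" if "z \<in> G" for z
    using that by simp
  have S0: "S \<ge> 0" 
  proof -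
    have "0 \<le> norm (h z) + norm (h1 z) / n" using n by simp
    then show ?thesis using leS[OF z] by linarith
  qed
  have "S \<le> (3 * (1 + M\<^sup>2) * \<epsilon>) * S + 3 * (1 + M\<^sup>2) * \<eta>"
    by (subst (1) S_def, rule cSUP_least) (use z * in auto)
  also have "(3 * (1 + M\<^sup>2) * \<epsilon>) * S \<le> 1 / 2 * S" using \<epsilon> S0 by (intro mult_right_mono) auto
  finally have "S \<le> 6 * (1 + M\<^sup>2) * \<eta>" by (simp add: field_simps)
  with leS[OF z] show ?thesis by linarith
qed

section \<open>Rational solutions: existence and uniqueness\<close>

definition PIII_at :: "complex \<Rightarrow> complex \<Rightarrow> (complex \<Rightarrow> complex) \<Rightarrow> complex \<Rightarrow> bool" where
  "PIII_at a b u x \<longleftrightarrow>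
     deriv (deriv u) x = (deriv u x)\<^sup>2 / u x - deriv u x / x
       + (4 * a * (u x)\<^sup>2 + 4 * (1 - b)) / x + 4 * (u x) ^ 3 - 4 / u x"

lemma solves_PIII_iff: "solves_PIII a b u \<longleftrightarrow> (\<forall>x. x \<noteq> 0 \<longrightarrow> u x \<noteq> 0 \<longrightarrow> PIII_at a b u x)"
  by (auto simp: solves_PIII_def PIII_at_def)

text \<open>
  Cauchy's inequality for \<open>u - c\<close> on the disc of radius \<open>norm x / 2\<close> around \<open>x\<close>.
\<close>
lemma tendsto_x_deriv_at_infinity:
  assumes hol: "u holomorphic_on {x. norm x > R}" and lim: "(u \<longlongrightarrow> c) at_infinity"
  shows "((\<lambda>x. x * deriv u x) \<longlongrightarrow> 0) at_infinity"
proof (rule tendstoI)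
  fix e :: real assume e: "e > 0"
  have "\<forall>\<^sub>F x in at_infinity. dist (u x) c < e / 4"
    using lim e by (intro tendstoD) auto
  then obtain b where b: "\<And>x. b \<le> norm x \<Longrightarrow> dist (u x) c < e / 4"
    by (auto simp: eventually_at_infinity)
  define r where "r = Max {b, R + 1, 1}"
  have r: "r \<ge> b" "r > R" "r \<ge> 1" by (auto simp: r_def)
  have "norm (x * deriv u x) < e" if x: "norm x \<ge> 2 * r" for x
  proof -
    have far: "norm z \<ge> r" if "dist x z \<le> norm x / 2" for z
      using that x norm_triangle_sub[of x z] by (simp add: dist_norm)
    define f where "f = (\<lambda>z. u z - c)"
    have holf: "f holomorphic_on {x. norm x > R}" unfolding f_def by (intro holomorphic_intros hol)
    have sub: "cball x (norm x / 2) \<subseteq> {x. norm x > R}"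
      using far r by fastforce
    have "norm ((deriv ^^ 1) f x) \<le> fact 1 * (e / 4) / (norm x / 2) ^ 1"
    proof (rule Cauchy_inequality)
      show "f holomorphic_on ball x (norm x / 2)"
        using holf sub ball_subset_cball by (meson holomorphic_on_subset subset_trans)
      show "continuous_on (cball x (norm x / 2)) f"
        using holf sub by (meson holomorphic_on_imp_continuous_on holomorphic_on_subset)
      show "0 < norm x / 2" using x r by linarith
      fix z assume "norm (x - z) = norm x / 2"
      then have "b \<le> norm z" using far[of z] r by (simp add: dist_norm)
      then show "norm (f z) \<le> e / 4" using b[of z] by (simp add: f_def dist_norm)
    qed
    moreover have "deriv f x = deriv u x"
    proof -
      have "x \<in> {x. norm x > R}" using x r by simp
      moreover have "open {x::complex. norm x > R}" by (intro open_Collect_less continuous_intros)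
      ultimately have "(u has_field_derivative deriv u x) (at x)" using holomorphic_derivI[OF hol] by blast
      then show ?thesis unfolding f_def by (intro DERIV_imp_deriv) (auto intro!: derivative_eq_intros)
    qed
    moreover have "norm x > 0" using x r by linarith
    ultimately have "norm x * norm (deriv u x) \<le> e / 2" by (simp add: field_simps)
    then show ?thesis using e by (simp add: norm_mult)
  qed
  then show "\<forall>\<^sub>F x in at_infinity. dist (x * deriv u x) 0 < e"
    unfolding eventually_at_infinity by (intro exI[of _ "2 * r"]) auto
qed

text \<open>
  The Baecklund transformation that raises \<open>\<Theta>\<^sub>0\<close> and lowers \<open>\<Theta>\<^sub>\<infinity>\<close> by one. With \<open>\<alpha> = W + 2 * a + 1\<close> and
  \<open>\<beta> = W + 2 * b - 3\<close> the equation for \<open>u\<close> says \<open>W' = 2 * \<alpha> * u - 2 * \<beta> / u\<close>, and \<open>v = \<beta> / (u * \<alpha>)\<close>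
  satisfies \<open>x * v' / v = 2 * x * v + 2 * x / v - W\<close>, so \<open>- W\<close> plays for \<open>v\<close>, with the signs of the last two
  terms reversed, the part that \<open>W\<close> plays for \<open>u\<close>.
\<close>
lemma backlund:
  fixes a b :: complex and S :: "complex set" and u v W :: "complex \<Rightarrow> complex"
  assumes S: "open S" and hol: "u holomorphic_on S"
    and sol: "\<And>x. x \<in> S \<Longrightarrow> x \<noteq> 0 \<and> u x \<noteq> 0 \<and> PIII_at a b u x"
    and W_def: "\<And>x. W x = x * deriv u x / u x + 2 * x * u x + 2 * x / u x"
    and nz: "\<And>x. x \<in> S \<Longrightarrow> W x + 2 * a + 1 \<noteq> 0 \<and> W x + 2 * b - 3 \<noteq> 0"
    and v: "\<And>x. x \<in> S \<Longrightarrow> v x = (W x + 2 * b - 3) / (u x * (W x + 2 * a + 1))"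
    and x: "x \<in> S"
  shows "PIII_at (a + 1) (b - 1) v x"
proof -
  have u': "(u has_field_derivative deriv u x) (at x)" if "x \<in> S" for x
    using holomorphic_derivI[OF hol S that] .
  have u'': "(deriv u has_field_derivative deriv (deriv u) x) (at x)" if "x \<in> S" for x
    using holomorphic_derivI[OF holomorphic_deriv[OF hol S] S that] .
  define al where "al x = W x + 2 * a + 1" for x
  define be where "be x = W x + 2 * b - 3" for x
  have nz': "x \<noteq> 0" "u x \<noteq> 0" "al x \<noteq> 0" "be x \<noteq> 0" "v x = be x / (u x * al x)" if "x \<in> S" for x
    using sol nz v that by (auto simp: al_def be_def)
  have du: "x * deriv u x = u x * W x - 2 * x * (u x)\<^sup>2 - 2 * x" if "x \<in> S" for x
    using nz'[OF that] by (simp add: W_def field_simps power2_eq_square)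
  have W': "(W has_field_derivative 2 * al x * u x - 2 * be x / u x) (at x)" if xS: "x \<in> S" for x
  proof -
    have E: "deriv (deriv u) x = (deriv u x)\<^sup>2 / u x - deriv u x / x
       + (4 * a * (u x)\<^sup>2 + 4 * (1 - b)) / x + 4 * (u x) ^ 3 - 4 / u x"
      using sol[OF xS] by (simp add: PIII_at_def)
    define d where "d = deriv u x"
    have Wx: "W x = x * d / u x + 2 * x * u x + 2 * x / u x" by (simp add: W_def d_def)
    show ?thesis unfolding W_def[abs_def]
      apply (rule derivative_eq_intros u'[OF xS] u''[OF xS] refl nz'(2)[OF xS])+
      unfolding E al_def be_def Wx d_def[symmetric]
      using nz'(1,2)[OF xS]
      by (simp add: divide_simps) algebra
  qed
  have v': "(v has_field_derivative 2 + 2 * (v x)\<^sup>2 - W x * v x / x) (at x)" if xS: "x \<in> S" for x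
  proof -
    have "((\<lambda>x. be x / (u x * al x)) has_field_derivative 2 + 2 * (v x)\<^sup>2 - W x * v x / x) (at x)"
    proof -
      have d: "deriv u x = (u x * W x - 2 * x * (u x)\<^sup>2 - 2 * x) / x"
        using du[OF xS] nz'[OF xS] by (simp add: field_simps)
      have al': "(al has_field_derivative 2 * al x * u x - 2 * be x / u x) (at x)"
        unfolding al_def[abs_def] by (rule derivative_eq_intros W'[OF xS] refl)+ (simp add: al_def)
      have be': "(be has_field_derivative 2 * al x * u x - 2 * be x / u x) (at x)"
        unfolding be_def[abs_def] by (rule derivative_eq_intros W'[OF xS] refl)+ (simp add: be_def)
      show ?thesis unfolding nz'(5)[OF xS]
        apply (rule derivative_eq_intros u'[OF xS] al' be' refl)+
        subgoal using nz'[OF xS] by simp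
        unfolding d using nz'(1-4)[OF xS] by (simp add: field_simps power2_eq_square)
    qed
    then show ?thesis
      by (rule has_field_derivative_transform_within_open[OF _ S xS]) (use nz'(5) in auto)
  qed
  have dv: "deriv v x = 2 + 2 * (v x)\<^sup>2 - W x * v x / x" if "x \<in> S" for x
    using v'[OF that] by (rule DERIV_imp_deriv)
  have "((\<lambda>x. 2 + 2 * (v x)\<^sup>2 - W x * v x / x) has_field_derivative
      4 * v x * deriv v x - ((2 * be x - 2 * al x * (v x)\<^sup>2) + W x * deriv v x) / x + W x * v x / x\<^sup>2) (at x)"
  proof -
    have e: "(2 * al x * u x - 2 * be x / u x) * v x = 2 * be x - 2 * al x * (v x)\<^sup>2"
      unfolding nz'(5)[OF x] using nz'(1-4)[OF x] by (simp add: field_simps power2_eq_square)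
    show ?thesis
      apply (rule derivative_eq_intros v'[OF x] W'[OF x] refl nz'(1)[OF x])+
      unfolding dv[OF x] e[symmetric]
      using nz'(1,2)[OF x] by (simp add: divide_simps) algebra
  qed
  from has_field_derivative_transform_within_open[OF this S x, of "deriv v"]
  have "deriv (deriv v) x = 4 * v x * deriv v x - ((2 * be x - 2 * al x * (v x)\<^sup>2) + W x * deriv v x) / x + W x * v x / x\<^sup>2"
    using dv by (intro DERIV_imp_deriv) auto
  moreover have "v x \<noteq> 0" using nz'[OF x] by simp
  ultimately show ?thesis
    unfolding PIII_at_def dv[OF x] al_def be_def using nz'(1)[OF x]
    by (simp add: divide_simps) algebra
qed

lemma rational_fun_regular:
  assumes "rational_fun u"
  obtains S where "finite S" "u holomorphic_on - S" "\<And>x. u x \<noteq> 0 \<Longrightarrow> x \<notin> S"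
proof -
  obtain P Q :: "complex poly" where Q: "Q \<noteq> 0" "u = (\<lambda>x. poly P x / poly Q x)"
    using assms by (auto simp: rational_fun_def)
  show ?thesis
  proof
    show "finite {x. poly Q x = 0}" using Q(1) by (rule poly_roots_finite)
    show "u holomorphic_on - {x. poly Q x = 0}" unfolding Q(2) by (intro holomorphic_intros) auto
  qed (auto simp: Q(2))
qed

lemma finite_imp_eventually_avoid:
  assumes "finite S" shows "\<forall>\<^sub>F x :: complex in at_infinity. x \<notin> S"
proof -
  obtain B where "\<forall>x\<in>S. norm x \<le> B" using finite_imp_bounded[OF assms] by (auto simp: bounded_iff)
  then show ?thesis unfolding eventually_at_infinity by (intro exI[of _ "B + 1"]) fastforce
qed

lemma rational_fun_tendsto_deriv:
  assumes "rational_fun u" "(u \<longlongrightarrow> c) at_infinity"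
  shows "((\<lambda>x. x * deriv u x) \<longlongrightarrow> 0) at_infinity"
proof -
  obtain S where S: "finite S" "u holomorphic_on - S" using rational_fun_regular[OF assms(1)] by metis
  obtain B where B: "\<forall>x\<in>S. norm x \<le> B" using finite_imp_bounded[OF S(1)] by (auto simp: bounded_iff)
  have "{x. norm x > B} \<subseteq> - S" using B by force
  then show ?thesis using tendsto_x_deriv_at_infinity[OF holomorphic_on_subset[OF S(2)] assms(2)] by blast
qed

lemma tendsto_of_x_times:
  fixes f :: "complex \<Rightarrow> complex"
  assumes "((\<lambda>x. x * f x) \<longlongrightarrow> 0) at_infinity"
  shows "(f \<longlongrightarrow> 0) at_infinity"
proof -
  have "((\<lambda>x. inverse x * (x * f x)) \<longlongrightarrow> 0 * 0) at_infinity"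
    by (intro tendsto_mult tendsto_inverse_0 assms)
  moreover have "\<forall>\<^sub>F x in at_infinity. inverse x * (x * f x) = f x"
    using finite_imp_eventually_avoid[of "{0}"] by (auto elim!: eventually_mono)
  ultimately show ?thesis by (simp add: tendsto_cong)
qed

text \<open>
  Both sides of the equation are continuous where a rational function is finite and nonzero, so
  finitely many exceptional points are harmless.
\<close>
lemma solves_PIII_off_finite:
  assumes rat: "rational_fun u" and F: "finite F"
    and sol: "\<And>x. x \<notin> F \<Longrightarrow> PIII_at a b u x"
  shows "solves_PIII a b u"
  unfolding solves_PIII_iff
proof (intro allI impI)
  fix x assume x: "x \<noteq> 0" "u x \<noteq> 0"
  obtain S where S: "finite S" "u holomorphic_on - S" "\<And>x. u x \<noteq> 0 \<Longrightarrow> x \<notin> S"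
    using rational_fun_regular[OF rat] by metis
  have o: "open (- S)" using S(1) finite_imp_closed by blast
  have xS: "x \<in> - S" using S(3) x by blast
  have cu: "isCont u x"
    using S(2) o xS by (meson continuous_on_eq_continuous_at holomorphic_on_imp_continuous_on)
  have h1: "deriv u holomorphic_on - S" using S(2) o by (rule holomorphic_deriv)
  have c1: "isCont (deriv u) x"
    using h1 o xS by (meson continuous_on_eq_continuous_at holomorphic_on_imp_continuous_on)
  have c2: "isCont (deriv (deriv u)) x"
    using holomorphic_deriv[OF h1 o] o xS
    by (meson continuous_on_eq_continuous_at holomorphic_on_imp_continuous_on)
  define r where "r = (\<lambda>x. (deriv u x)\<^sup>2 / u x - deriv u x / x
       + (4 * a * (u x)\<^sup>2 + 4 * (1 - b)) / x + 4 * (u x) ^ 3 - 4 / u x)"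
  have "isCont r x" unfolding r_def using cu c1 x by (intro continuous_intros) auto
  then have "(r \<longlongrightarrow> r x) (at x)" by (simp add: isCont_def)
  moreover have "\<forall>\<^sub>F z in at x. z \<notin> F"
    using islimpt_finite[OF F, of x] by (simp add: islimpt_iff_eventually)
  then have "\<forall>\<^sub>F z in at x. r z = deriv (deriv u) z"
    by (rule eventually_mono) (use sol in \<open>simp add: PIII_at_def r_def\<close>)
  ultimately have "(deriv (deriv u) \<longlongrightarrow> r x) (at x)"
    using tendsto_cong by fastforce
  moreover have "(deriv (deriv u) \<longlongrightarrow> deriv (deriv u) x) (at x)"
    using c2 by (simp add: isCont_def)
  ultimately show "PIII_at a b u x"
    unfolding PIII_at_def using tendsto_unique[OF at_neq_bot] r_def by metis
qed

text \<open>
  Common factors are removed one at a time; the degree of the denominator decreases.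
\<close>
lemma poly_fraction_lowest_terms:
  fixes A B :: "complex poly"
  assumes "B \<noteq> 0"
  shows "\<exists>P Q g. A = P * g \<and> B = Q * g \<and> coprime P Q"
  using assms
proof (induction "degree B" arbitrary: A B rule: less_induct)
  case less
  show ?case
  proof (cases "coprime A B")
    case True
    then show ?thesis by (intro exI[of _ A] exI[of _ B] exI[of _ 1]) simp
  next
    case False
    then obtain d where d: "d dvd A" "d dvd B" "\<not> is_unit d" by (auto simp: coprime_def)
    then obtain A' B' where AB: "A = A' * d" "B = B' * d" by (metis dvd_def mult.commute)
    have nz: "B' \<noteq> 0" "d \<noteq> 0" using less.prems AB by auto
    have "degree d \<noteq> 0" using d(3) nz(2) is_unit_iff_degree by blast
    then have "degree B' < degree B" using nz AB by (simp add: degree_mult_eq)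
    from less.hyps[OF this nz(1)] obtain P Q g where "A' = P * g" "B' = Q * g" "coprime P Q" by blast
    then show ?thesis using AB by (intro exI[of _ P] exI[of _ Q] exI[of _ "g * d"]) (simp add: mult.assoc)
  qed
qed

text \<open>
  The transformation is not degenerate on rational solutions that tend to \<open>1\<close>: there \<open>W x / x\<close> tends to \<open>4\<close>, so
  neither \<open>\<alpha>\<close> nor \<open>\<beta>\<close> vanishes identically, and \<open>v\<close> tends to \<open>4 / (1 * 4) = 1\<close>.
\<close>
lemma rational_backlund_step:
  assumes rat: "rational_fun u" and sol: "solves_PIII a b u" and lim: "(u \<longlongrightarrow> 1) at_infinity"
  shows "\<exists>v. rational_fun v \<and> solves_PIII (a + 1) (b - 1) v \<and> (v \<longlongrightarrow> 1) at_infinity"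
proof -
  obtain P Q :: "complex poly" where Q: "Q \<noteq> 0" and u: "u = (\<lambda>x. poly P x / poly Q x)"
    using rat by (auto simp: rational_fun_def)
  have ev_nz: "\<forall>\<^sub>F x in at_infinity. u x \<noteq> 0"
    using tendsto_imp_eventually_ne[OF lim, of 0] by simp
  have P: "P \<noteq> 0"
  proof
    assume "P = 0"
    then have "\<forall>\<^sub>F x::complex in at_infinity. False" using ev_nz by (simp add: u)
    then show False by (simp add: eventually_False trivial_limit_at_infinity)
  qed
  define A where "A = [:0, 1:] * (pderiv P * Q - P * pderiv Q + 2 * P * P + 2 * Q * Q)"
  define B where "B = P * Q"
  define W where "W x = x * deriv u x / u x + 2 * x * u x + 2 * x / u x" for x
  define al where "al = A + smult (2 * a + 1) B"
  define be where "be = A + smult (2 * b - 3) B"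
  define S0 where "S0 = {x. poly ([:0,1:] * B) x \<noteq> 0}"
  have S0: "x \<noteq> 0" "poly P x \<noteq> 0" "poly Q x \<noteq> 0" "u x \<noteq> 0" if "x \<in> S0" for x
    using that by (auto simp: S0_def B_def u)
  have WA: "W x = poly A x / poly B x" if "x \<in> S0" for x
  proof -
    have "(u has_field_derivative (poly (pderiv P) x * poly Q x - poly P x * poly (pderiv Q) x) / (poly Q x * poly Q x)) (at x)"
      unfolding u by (rule derivative_eq_intros refl poly_DERIV S0(3)[OF that])+ simp
    then have D: "deriv u x = (poly (pderiv P) x * poly Q x - poly P x * poly (pderiv Q) x) / (poly Q x * poly Q x)"
      by (rule DERIV_imp_deriv)
    have ux: "u x = poly P x / poly Q x" by (simp add: u)
    show ?thesis
      unfolding W_def A_def B_def D ux using S0[OF that] by (simp add: field_simps)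
  qed
  have alW: "W x + 2 * a + 1 = poly al x / poly B x" and beW: "W x + 2 * b - 3 = poly be x / poly B x"
    if "x \<in> S0" for x
    using S0[OF that] unfolding WA[OF that] al_def be_def by (auto simp: B_def field_simps)
  have S0': "- S0 = {x. poly ([:0,1:] * B) x = 0}" by (auto simp: S0_def)
  have finS0: "finite (- S0)" unfolding S0' by (rule poly_roots_finite) (use P Q in \<open>simp add: B_def\<close>)
  have ev0: "\<forall>\<^sub>F x in at_infinity. x \<in> S0"
    using finite_imp_eventually_avoid[OF finS0] by simp
  have Wlim: "((\<lambda>x. W x / x) \<longlongrightarrow> 4) at_infinity"
  proof -
    have "((\<lambda>x. deriv u x / u x + 2 * u x + 2 / u x) \<longlongrightarrow> 0 / 1 + 2 * 1 + 2 / 1) at_infinity"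
      using lim tendsto_of_x_times[OF rational_fun_tendsto_deriv[OF rat lim]] by (intro tendsto_intros) auto
    moreover have "\<forall>\<^sub>F x in at_infinity. deriv u x / u x + 2 * u x + 2 / u x = W x / x"
      using ev0 by eventually_elim (use S0 in \<open>auto simp: W_def field_simps\<close>)
    ultimately show ?thesis by (simp add: tendsto_cong)
  qed
  have Wclim: "((\<lambda>x. (W x + c) / x) \<longlongrightarrow> 4) at_infinity" for c
  proof -
    have "((\<lambda>x. W x / x + c * inverse x) \<longlongrightarrow> 4 + c * 0) at_infinity"
      by (intro tendsto_intros Wlim tendsto_inverse_0)
    then show ?thesis by (simp add: add_divide_distrib inverse_eq_divide)
  qed
  have nzpoly: "al \<noteq> 0" "be \<noteq> 0"
  proof -
    have *: "\<forall>\<^sub>F x in at_infinity. (W x + c) / x \<noteq> 0" for c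
      using tendsto_imp_eventually_ne[OF Wclim, of 0 c] by simp
    have False if "\<forall>\<^sub>F x in at_infinity. x \<in> S0 \<longrightarrow> W x + c = 0" for c
    proof -
      have "\<forall>\<^sub>F x::complex in at_infinity. False"
        using that * [of c] ev0 by eventually_elim auto
      then show False by (simp add: eventually_False trivial_limit_at_infinity)
    qed
    note F = this
    show "al \<noteq> 0"
      using F[of "2 * a + 1"] alW by (auto simp: algebra_simps)
    show "be \<noteq> 0"
      using F[of "2 * b - 3"] beW by (auto simp: algebra_simps)
  qed
  define S where "S = {x. poly ([:0,1:] * B * al * be) x \<noteq> 0}"
  have SS0: "x \<in> S0" "poly al x \<noteq> 0" "poly be x \<noteq> 0" "poly B x \<noteq> 0" if "x \<in> S" for x
    using that by (auto simp: S_def S0_def)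
  have S': "- S = {x. poly ([:0,1:] * B * al * be) x = 0}" by (auto simp: S_def)
  have finS: "finite (- S)" unfolding S' by (rule poly_roots_finite) (use P Q nzpoly in \<open>simp add: B_def\<close>)
  have "open S" using finite_imp_closed[OF finS] by (simp add: open_closed)
  obtain P' Q' g where PQ': "be * Q = P' * g" "al * P = Q' * g" "coprime P' Q'"
    using poly_fraction_lowest_terms[of "al * P" "be * Q"] nzpoly P by (metis mult_eq_0_iff)
  have Q': "Q' \<noteq> 0" using PQ'(2) nzpoly P by auto
  define v where "v = (\<lambda>x. poly P' x / poly Q' x)"
  have ratv: "rational_fun v" unfolding rational_fun_def v_def using Q' PQ'(3) by blast
  have v: "v x = (W x + 2 * b - 3) / (u x * (W x + 2 * a + 1))" if "x \<in> S" for x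
  proof -
    note x = SS0[OF that] S0[OF SS0(1)[OF that]]
    have "poly al x * poly P x = poly Q' x * poly g x" "poly be x * poly Q x = poly P' x * poly g x"
      using PQ' by (metis poly_mult)+
    moreover from this x have "poly g x \<noteq> 0" "poly Q' x \<noteq> 0" by auto
    ultimately have "v x = poly be x * poly Q x / (poly al x * poly P x)"
      by (simp add: v_def)
    then show ?thesis unfolding alW[OF x(1)] beW[OF x(1)] using x by (simp add: u field_simps)
  qed
  have "PIII_at (a + 1) (b - 1) v x" if "x \<in> S" for x
  proof (rule backlund[OF \<open>open S\<close> _ _ W_def _ v that])
    show "u holomorphic_on S" unfolding u by (intro holomorphic_intros) (use SS0 S0 in auto)
    fix x assume "x \<in> S"
    note x = SS0[OF this] S0[OF SS0(1)[OF this]]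
    show "x \<noteq> 0 \<and> u x \<noteq> 0 \<and> PIII_at a b u x" using x sol by (auto simp: solves_PIII_iff)
    show "W x + 2 * a + 1 \<noteq> 0 \<and> W x + 2 * b - 3 \<noteq> 0"
      unfolding alW[OF x(1)] beW[OF x(1)] using x by auto
  qed auto
  then have solv: "solves_PIII (a + 1) (b - 1) v"
    by (intro solves_PIII_off_finite[OF ratv finS]) auto
  have "((\<lambda>x. ((W x + (2 * b - 3)) / x) / (u x * ((W x + (2 * a + 1)) / x))) \<longlongrightarrow> 4 / (1 * 4)) at_infinity"
    by (intro tendsto_intros lim Wclim) auto
  moreover have "\<forall>\<^sub>F x in at_infinity. ((W x + (2 * b - 3)) / x) / (u x * ((W x + (2 * a + 1)) / x)) = v x"
    using finite_imp_eventually_avoid[OF finS]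
  proof eventually_elim
    case (elim x)
    then have "x \<in> S" by simp
    have "x \<noteq> 0" using S0(1)[OF SS0(1)[OF \<open>x \<in> S\<close>]] .
    then have "(p / x) / (q * (r / x)) = p / (q * r)" for p q r :: complex by simp
    then show ?case unfolding v[OF \<open>x \<in> S\<close>] by (simp add: add_diff_eq add.assoc)
  qed
  ultimately have "(v \<longlongrightarrow> 1) at_infinity" by (simp add: tendsto_cong)
  with ratv solv show ?thesis by blast
qed

lemma rational_solution_exists:
  "\<exists>u. rational_fun u \<and> solves_PIII (of_nat n + m) (m - of_nat n + 1) u \<and> (u \<longlongrightarrow> 1) at_infinity"
proof (induction n)
  case 0
  have "rational_fun (\<lambda>x. 1)" unfolding rational_fun_def
    by (rule exI[of _ 1], rule exI[of _ 1]) simp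
  moreover have "solves_PIII (of_nat 0 + m) (m - of_nat 0 + 1) (\<lambda>x. 1)"
    by (simp add: solves_PIII_def)
  ultimately show ?case by (intro exI[of _ "\<lambda>x. 1"]) simp
next
  case (Suc n)
  then obtain u where "rational_fun u" "solves_PIII (of_nat n + m) (m - of_nat n + 1) u" "(u \<longlongrightarrow> 1) at_infinity"
    by blast
  from rational_backlund_step[OF this] show ?case by (simp add: algebra_simps)
qed

text \<open>
  At a pole, where the value is \<open>0\<close> by convention, the numerator is nonzero; so cross-multiplying shows that the
  poles agree as well.
\<close>
lemma rational_fun_eqI:
  assumes "rational_fun u" "rational_fun v" "infinite {x. u x = v x \<and> u x \<noteq> 0}"
  shows "u = v"
proof -
  obtain P Q :: "complex poly" where u: "Q \<noteq> 0" "coprime P Q" "u = (\<lambda>x. poly P x / poly Q x)"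
    using assms(1) by (auto simp: rational_fun_def)
  obtain P' Q' :: "complex poly" where v: "Q' \<noteq> 0" "coprime P' Q'" "v = (\<lambda>x. poly P' x / poly Q' x)"
    using assms(2) by (auto simp: rational_fun_def)
  have "{x. u x = v x \<and> u x \<noteq> 0} \<subseteq> {x. poly (P * Q' - P' * Q) x = 0}"
    by (auto simp: u v field_simps)
  then have "infinite {x. poly (P * Q' - P' * Q) x = 0}" using assms(3) finite_subset by blast
  then have "P * Q' - P' * Q = 0" using poly_roots_finite by blast
  then have e: "poly P x * poly Q' x = poly P' x * poly Q x" for x
    by (metis eq_iff_diff_eq_0 poly_mult)
  show ?thesis
  proof
    fix x
    have c: "poly P x \<noteq> 0 \<or> poly Q x \<noteq> 0" "poly P' x \<noteq> 0 \<or> poly Q' x \<noteq> 0"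
      using u v coprime_poly_0 by blast+
    show "u x = v x"
    proof (cases "poly Q x = 0")
      case True then show ?thesis using c e[of x] by (auto simp: u v)
    next
      case False
      then have "poly Q' x \<noteq> 0" using c e[of x] by auto
      with False show ?thesis using e[of x] by (simp add: u v field_simps)
    qed
  qed
qed

text \<open>
  The difference \<open>d = u - v\<close> satisfies \<open>d'' = 16 * d + c1 * d + c2 * d'\<close> with coefficients that tend to \<open>0\<close> at
  infinity; \<open>16 = 4\<^sup>2\<close> is the derivative of \<open>4 * u ^ 3 - 4 / u\<close> at \<open>u = 1\<close>. In a half-plane far from the
  origin, which contains the horizontal rays from its points, the linear estimate with \<open>n = 4\<close> forces \<open>d = 0\<close>.
\<close>
lemma rational_solution_unique:
  assumes u: "rational_fun u" "solves_PIII a b u" "(u \<longlongrightarrow> 1) at_infinity"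
    and v: "rational_fun v" "solves_PIII a b v" "(v \<longlongrightarrow> 1) at_infinity"
  shows "u = v"
proof -
  obtain S where S: "finite S" "u holomorphic_on - S" "\<And>x. u x \<noteq> 0 \<Longrightarrow> x \<notin> S"
    using rational_fun_regular[OF u(1)] by metis
  obtain T where T: "finite T" "v holomorphic_on - T" "\<And>x. v x \<noteq> 0 \<Longrightarrow> x \<notin> T"
    using rational_fun_regular[OF v(1)] by metis
  have oS: "open (- S)" "open (- T)" using S(1) T(1) finite_imp_closed by blast+
  have u1: "(deriv u \<longlongrightarrow> 0) at_infinity" and v1: "(deriv v \<longlongrightarrow> 0) at_infinity"
    using rational_fun_tendsto_deriv[OF u(1,3)] rational_fun_tendsto_deriv[OF v(1,3)] tendsto_of_x_times by blast+
  have inv: "((\<lambda>x::complex. 1 / x) \<longlongrightarrow> 0) at_infinity"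
    using tendsto_inverse_0[where 'a = complex] by (simp add: inverse_eq_divide[abs_def])
  define c1 where "c1 x = 4 * a * (u x + v x) * (1 / x) + 4 * ((u x)\<^sup>2 + u x * v x + (v x)\<^sup>2) - 12
     + (4 / (u x * v x) - 4) - (deriv v x)\<^sup>2 / (u x * v x)" for x
  define c2 where "c2 x = (deriv u x + deriv v x) / u x - 1 / x" for x
  have "(c1 \<longlongrightarrow> 4 * a * (1 + 1) * 0 + 4 * (1\<^sup>2 + 1 * 1 + 1\<^sup>2) - 12 + (4 / (1 * 1) - 4) - 0\<^sup>2 / (1 * 1)) at_infinity"
    unfolding c1_def[abs_def] by (intro tendsto_intros u v u1 v1 inv) auto
  then have c1: "(c1 \<longlongrightarrow> 0) at_infinity" by simp
  have "(c2 \<longlongrightarrow> (0 + 0) / 1 - 0) at_infinity"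
    unfolding c2_def[abs_def] by (intro tendsto_intros u v u1 v1 inv) auto
  then have c2: "(c2 \<longlongrightarrow> 0) at_infinity" by simp
  define d where "d x = u x - v x" for x
  define d1 where "d1 x = deriv u x - deriv v x" for x
  have dl: "((\<lambda>x. norm (d x) + norm (d1 x)) \<longlongrightarrow> norm (1 - 1 :: complex) + norm (0 - 0 :: complex)) at_infinity"
    unfolding d_def d1_def by (intro tendsto_intros u v u1 v1)
  have "\<forall>\<^sub>F x in at_infinity. x \<noteq> 0 \<and> u x \<noteq> 0 \<and> v x \<noteq> 0 \<and> norm (c1 x) < 1 \<and> norm (c2 x) < 1 / 2
      \<and> norm (d x) + norm (d1 x) < 1"
    using tendsto_imp_eventually_ne[OF u(3), of 0] tendsto_imp_eventually_ne[OF v(3), of 0]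
      finite_imp_eventually_avoid[of "{0}"] order_tendstoD(2)[OF tendsto_norm[OF c1], of 1]
      order_tendstoD(2)[OF tendsto_norm[OF c2], of "1 / 2"] order_tendstoD(2)[OF dl, of 1]
    by (auto intro!: eventually_conj)
  then obtain B where B: "\<And>x. norm x \<ge> B \<Longrightarrow> x \<noteq> 0 \<and> u x \<noteq> 0 \<and> v x \<noteq> 0 \<and> norm (c1 x) < 1 \<and> norm (c2 x) < 1 / 2
      \<and> norm (d x) + norm (d1 x) < 1"
    by (auto simp: eventually_at_infinity)
  define G where "G = {x. Im x \<ge> B}"
  have G: "x \<noteq> 0" "u x \<noteq> 0" "v x \<noteq> 0" "norm (c1 x) < 1" "norm (c2 x) < 1 / 2" "norm (d x) + norm (d1 x) < 1"
    if "x \<in> G" for x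
  proof -
    have "B \<le> norm x" using that abs_Im_le_cmod[of x] by (simp add: G_def)
    then show "x \<noteq> 0" "u x \<noteq> 0" "v x \<noteq> 0" "norm (c1 x) < 1" "norm (c2 x) < 1 / 2" "norm (d x) + norm (d1 x) < 1"
      using B by blast+
  qed
  have "d x = 0" if x: "x \<in> G" for x
  proof -
    have "norm (d x) + norm (d1 x) / 4 \<le> 6 * (1 + 0\<^sup>2) * 0"
    proof (rule perturbed_second_order_bound[where G = G and h = d and ?h1.0 = d1 and z = x and n = 4 and N = "\<lambda>x. c1 x * d x + c2 x * d1 x"
          and \<epsilon> = "1 / 6" and B = 1])
      fix z assume z: "z \<in> G"
      note zG = G[OF z]
      have zS: "z \<in> - S" "z \<in> - T" using S(3) T(3) zG by blast+
      note du = holomorphic_derivI[OF S(2) oS(1) zS(1)] holomorphic_derivI[OF T(2) oS(2) zS(2)]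
      note ddu = holomorphic_derivI[OF holomorphic_deriv[OF S(2) oS(1)] oS(1) zS(1)]
          holomorphic_derivI[OF holomorphic_deriv[OF T(2) oS(2)] oS(2) zS(2)]
      show "(d has_field_derivative d1 z) (at z)" unfolding d_def d1_def
        by (intro derivative_intros du)
      have E: "PIII_at a b u z" "PIII_at a b v z" using u(2) v(2) zG by (auto simp: solves_PIII_iff)
      have "deriv (deriv u) z - deriv (deriv v) z = 16 * d z + (c1 z * d z + c2 z * d1 z)"
        using zG(1-3) unfolding E[unfolded PIII_at_def] d_def d1_def c1_def c2_def
        by (simp add: field_simps power2_eq_square power3_eq_cube)
      moreover have "(d1 has_field_derivative deriv (deriv u) z - deriv (deriv v) z) (at z)" unfolding d1_def
        by (intro derivative_intros ddu)
      ultimately show "(d1 has_field_derivative of_real (4\<^sup>2) * d z + (c1 z * d z + c2 z * d1 z)) (at z)"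
        by simp
      have "norm (c1 z * d z + c2 z * d1 z) \<le> 1 * norm (d z) + 1 / 2 * norm (d1 z)"
      proof (rule norm_triangle_mono)
        show "norm (c1 z * d z) \<le> 1 * norm (d z)" unfolding norm_mult using zG(4) by (intro mult_right_mono) auto
        show "norm (c2 z * d1 z) \<le> 1 / 2 * norm (d1 z)" unfolding norm_mult using zG(5) by (intro mult_right_mono) auto
      qed
      also have "\<dots> \<le> 4\<^sup>2 * (1 / 6 * (norm (d z) + norm (d1 z) / 4) + 0)" by simp
      finally show "norm (c1 z * d z + c2 z * d1 z) \<le> 4\<^sup>2 * (1 / 6 * (norm (d z) + norm (d1 z) / 4) + 0)" .
      show "norm (d z) + norm (d1 z) \<le> 1" using zG by simp
    qed (use x in \<open>auto simp: G_def\<close>)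
    moreover have "norm (d1 x) / 4 \<ge> 0" by simp
    ultimately have "norm (d x) \<le> 0" by linarith
    then show ?thesis by simp
  qed
  then have sub: "(\<lambda>k. Complex 0 (B + real k)) ` UNIV \<subseteq> {x. u x = v x \<and> u x \<noteq> 0}"
    using G(2) by (auto simp: G_def d_def)
  have "inj (\<lambda>k. Complex 0 (B + real k))" by (auto simp: inj_def)
  then have "infinite ((\<lambda>k. Complex 0 (B + real k)) ` UNIV)"
    by (simp add: finite_image_iff)
  with sub show ?thesis using rational_fun_eqI[OF u(1) v(1)] finite_subset by blast
qed

lemma u_PIII_properties:
  fixes n :: int
  assumes "n \<ge> 0"
  shows "rational_fun (u_PIII n m)" "solves_PIII (of_int n + m) (m - of_int n + 1) (u_PIII n m)"
    "(u_PIII n m \<longlongrightarrow> 1) at_infinity"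
proof -
  obtain u where u: "rational_fun u \<and> solves_PIII (of_int n + m) (m - of_int n + 1) u \<and> (u \<longlongrightarrow> 1) at_infinity"
    using rational_solution_exists[of "nat n" m] assms by (auto simp: of_nat_nat)
  have "rational_fun (u_PIII n m) \<and> solves_PIII (of_int n + m) (m - of_int n + 1) (u_PIII n m)
     \<and> (u_PIII n m \<longlongrightarrow> 1) at_infinity"
    unfolding u_PIII_def by (rule theI'[of "\<lambda>u. rational_fun u \<and> _ u \<and> _ u"], rule ex1I[of _ u]) (use u rational_solution_unique in blast)+
  then show "rational_fun (u_PIII n m)" "solves_PIII (of_int n + m) (m - of_int n + 1) (u_PIII n m)"
    "(u_PIII n m \<longlongrightarrow> 1) at_infinity" by auto
qed

section \<open>The phase function\<close>

definition root_branch :: "complex \<Rightarrow> complex" where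
  "root_branch y = csqrt (1 / (4 * y\<^sup>2) + 1)"

text \<open>
  The inverse hyperbolic sine of \<open>1 / (2 * y)\<close> with values in the strip \<open>\<bar>Im a\<bar> < pi / 2\<close>. It turns the other
  functions into elementary ones: the square root is \<open>cosh a\<close>, \<open>\<i> * p_PIII y\<close> is \<open>exp (- a)\<close> and the phase is
  \<open>2 * (coth a - a)\<close>. Unlike \<open>y\<close> it also resolves the two sides of the branch cut, which become the two
  boundary lines of the strip.
\<close>
definition arsinh_coord :: "complex \<Rightarrow> complex" where
  "arsinh_coord y = Ln (root_branch y + 1 / (2 * y))"

text \<open>
  Up to an imaginary constant this is \<open>- 2 * V_PIII (p_PIII y) y\<close>; for the real parts see \<open>Re_V_PIII\<close>.
\<close>
definition phase :: "complex \<Rightarrow> complex" where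
  "phase y = 4 * y * root_branch y - 2 * arsinh_coord y"

lemma Re_sinh: "Re (sinh z) = sinh (Re z) * cos (Im z)"
  and Im_sinh: "Im (sinh z) = cosh (Re z) * sin (Im z)"
  and Re_cosh: "Re (cosh z) = cosh (Re z) * cos (Im z)"
  and Im_cosh: "Im (cosh z) = sinh (Re z) * sin (Im z)"
  unfolding sinh_field_def cosh_field_def by (simp_all add: Re_exp Im_exp algebra_simps diff_divide_distrib add_divide_distrib)

lemma tanh_less_self: "tanh x < (x::real)" if "x > 0"
proof -
  have "x - tanh x > 0 - tanh (0::real)"
    by (rule DERIV_pos_imp_increasing_open[OF that])
       (use that in \<open>auto intro!: derivative_eq_intros exI continuous_intros simp: tanh_def\<close>)
  then show ?thesis by simp
qed

lemma less_tan_self: "x < tan x" if "0 < x" "x < pi / 2"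
proof -
  have c: "cos t > 0" if "0 \<le> t" "t \<le> x" for t
    using that \<open>x < pi / 2\<close> by (intro cos_gt_zero_pi) auto
  have "tan x - x > tan 0 - 0"
  proof (rule DERIV_pos_imp_increasing_open[OF that(1)])
    fix t assume t: "0 < t" "t < x"
    have "((\<lambda>t. tan t - t) has_real_derivative (tan t)\<^sup>2) (at t)"
    proof -
      have "inverse ((cos t)\<^sup>2) = 1 + (tan t)\<^sup>2" using tan_sec[of t] c[of t] t by (simp add: power_inverse)
      then show ?thesis using c[of t] t by (auto intro!: derivative_eq_intros)
    qed
    moreover have "(tan t)\<^sup>2 > 0" using tan_gt_zero[of t] t that by simp
    ultimately show "\<exists>y. ((\<lambda>t. tan t - t) has_real_derivative y) (at t) \<and> 0 < y" by blast
  next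
    show "continuous_on {0..x} (\<lambda>t. tan t - t)"
      by (intro continuous_intros) (use c in force)
  qed
  then show ?thesis by simp
qed

lemma open_Compl_branch_cut: "open (- branch_cut)"
  by (simp add: branch_cut_def open_Compl)

text \<open>
  If the real part of the principal root were \<open>0\<close>, its square would be real and nonpositive, which confines \<open>y\<close> to
  the branch cut.
\<close>
lemma notin_branch_cut:
  assumes "y \<notin> branch_cut"
  shows notin_branch_cut_nonzero: "y \<noteq> 0"
    and root_branch_squared: "(root_branch y)\<^sup>2 = 1 / (4 * y\<^sup>2) + 1"
    and Re_root_branch_pos: "Re (root_branch y) > 0"
proof -
  show y0: "y \<noteq> 0" using assms by (auto simp: branch_cut_iff)
  show sq: "(root_branch y)\<^sup>2 = 1 / (4 * y\<^sup>2) + 1" by (simp add: root_branch_def)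
  show "Re (root_branch y) > 0"
  proof (rule ccontr)
    assume "\<not> 0 < Re (root_branch y)"
    then have "Re (root_branch y) = 0" using Re_csqrt[of "1 / (4 * y\<^sup>2) + 1"] by (simp add: root_branch_def)
    then obtain t where t: "root_branch y = \<i> * complex_of_real t" by (metis complex_eq mult.commute of_real_0 add_0)
    have "1 / (4 * y\<^sup>2) + 1 = - complex_of_real (t\<^sup>2)" using sq unfolding t by (simp add: power_mult_distrib)
    then have h: "1 + 4 * y\<^sup>2 = - (4 * (y\<^sup>2 * complex_of_real (t\<^sup>2)))" using y0 by (simp add: field_simps)
    have "y\<^sup>2 * complex_of_real (4 * (1 + t\<^sup>2)) = (1 + 4 * y\<^sup>2) + 4 * (y\<^sup>2 * complex_of_real (t\<^sup>2)) - 1"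
      by (simp add: algebra_simps)
    then have "y\<^sup>2 * complex_of_real (4 * (1 + t\<^sup>2)) = - 1" unfolding h by simp
    then have e: "y\<^sup>2 = complex_of_real (- 1 / (4 * (1 + t\<^sup>2)))"
    proof -
      have "4 * (1 + t\<^sup>2) \<noteq> 0" by (smt (verit) zero_le_power2)
      then have "complex_of_real (4 * (1 + t\<^sup>2)) \<noteq> 0" by (simp only: of_real_eq_0_iff not_False_eq_True)
      then have "y\<^sup>2 = (y\<^sup>2 * complex_of_real (4 * (1 + t\<^sup>2))) / complex_of_real (4 * (1 + t\<^sup>2))"
        by simp
      also have "\<dots> = - 1 / complex_of_real (4 * (1 + t\<^sup>2))" by (simp only: \<open>y\<^sup>2 * complex_of_real (4 * (1 + t\<^sup>2)) = - 1\<close>)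
      finally show ?thesis by simp
    qed
    define r where "r = 1 / (4 * (1 + t\<^sup>2))"
    have r: "0 < r" "r \<le> 1 / 4"
    proof -
      have q: "4 \<le> 4 * (1 + t\<^sup>2)" by simp
      then show "0 < r" unfolding r_def by (simp add: add_pos_nonneg)
      show "r \<le> 1 / 4" unfolding r_def using q by (intro divide_left_mono) (auto intro: add_pos_nonneg)
    qed
    have re: "(Re y)\<^sup>2 - (Im y)\<^sup>2 = - r" and im: "2 * Re y * Im y = 0"
      using arg_cong[OF e, of Re] arg_cong[OF e, of Im] unfolding Re_power2 Im_power2 r_def by simp_all
    have "Im y \<noteq> 0" using re r zero_le_power2[of "Re y"] by (intro notI) simp
    then have "Re y = 0" using im by simp
    moreover have "\<bar>Im y\<bar> \<le> 1 / 2"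
      by (rule power2_le_imp_le) (use re r \<open>Re y = 0\<close> in \<open>simp_all add: power2_eq_square\<close>)
    ultimately show False using assms by (simp add: branch_cut_iff)
  qed
qed

lemma root_branch_product:
  assumes "y \<notin> branch_cut"
  shows "(root_branch y + 1 / (2 * y)) * (root_branch y - 1 / (2 * y)) = 1"
proof -
  have "(root_branch y + 1 / (2 * y)) * (root_branch y - 1 / (2 * y)) = (root_branch y)\<^sup>2 - 1 / (4 * y\<^sup>2)"
    by (simp add: algebra_simps power2_eq_square)
  then show ?thesis unfolding root_branch_squared[OF assms] by simp
qed

text \<open>
  A negative value \<open>r\<close> would give \<open>2 * root_branch y = r + 1 / r < 0\<close>, since the two factors in
  \<open>root_branch_product\<close> are inverse to each other.
\<close>
lemma arsinh_coord_arg_notin: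
  assumes "y \<notin> branch_cut"
  shows "root_branch y + 1 / (2 * y) \<notin> \<real>\<^sub>\<le>\<^sub>0"
proof
  assume "root_branch y + 1 / (2 * y) \<in> \<real>\<^sub>\<le>\<^sub>0"
  then obtain r where r: "root_branch y + 1 / (2 * y) = complex_of_real r" "r \<le> 0"
    by (auto elim: nonpos_Reals_cases)
  then have "r \<noteq> 0" using root_branch_product[OF assms] by auto
  have "root_branch y - 1 / (2 * y) = complex_of_real (1 / r)"
    using root_branch_product[OF assms] \<open>r \<noteq> 0\<close> unfolding r by (simp add: field_simps)
  moreover have "2 * root_branch y = (root_branch y + 1 / (2 * y)) + (root_branch y - 1 / (2 * y))" by simp
  ultimately have "2 * root_branch y = complex_of_real (r + 1 / r)" using r by simp
  then have "2 * Re (root_branch y) = r + 1 / r" by (metis Re_complex_of_real Re_divide_numeral nonzero_mult_div_cancel_left mult_2 plus_complex.simps(1))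
  moreover have "r + 1 / r < 0" using r \<open>r \<noteq> 0\<close> by (simp add: add_neg_neg)
  ultimately show False using Re_root_branch_pos[OF assms] by linarith
qed

lemma arsinh_coord:
  assumes "y \<notin> branch_cut"
  shows exp_arsinh_coord: "exp (arsinh_coord y) = root_branch y + 1 / (2 * y)"
    and exp_minus_arsinh_coord: "exp (- arsinh_coord y) = root_branch y - 1 / (2 * y)"
    and cosh_arsinh_coord: "cosh (arsinh_coord y) = root_branch y"
    and sinh_arsinh_coord: "sinh (arsinh_coord y) = 1 / (2 * y)"
    and Im_arsinh_coord: "\<bar>Im (arsinh_coord y)\<bar> < pi / 2"
    and phase_eq_coth: "phase y = 2 * (cosh (arsinh_coord y) / sinh (arsinh_coord y) - arsinh_coord y)"
proof -
  let ?e = "root_branch y + 1 / (2 * y)" and ?a = "arsinh_coord y"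
  have nz: "?e \<noteq> 0" using root_branch_product[OF assms] by auto
  show 1: "exp ?a = ?e" using nz by (simp add: arsinh_coord_def)
  show 2: "exp (- ?a) = root_branch y - 1 / (2 * y)"
    unfolding exp_minus 1 by (rule inverse_unique[OF root_branch_product[OF assms]])
  show 3: "cosh ?a = root_branch y" unfolding cosh_field_def 1 2 by simp
  show 4: "sinh ?a = 1 / (2 * y)" unfolding sinh_field_def 1 2 by simp
  have "cosh (Re ?a) * cos (Im ?a) > 0"
    using Re_root_branch_pos[OF assms] unfolding 3[symmetric] Re_cosh .
  then have c: "cos (Im ?a) > 0" using cosh_real_pos[of "Re ?a"] by (metis zero_less_mult_pos)
  have "\<bar>Im ?a\<bar> \<le> pi" using Im_Ln_le_pi[OF nz] mpi_less_Im_Ln[OF nz] by (simp add: arsinh_coord_def)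
  then show "\<bar>Im ?a\<bar> < pi / 2"
  proof -
    have "cos \<bar>Im ?a\<bar> > 0" using c by (simp add: abs_if)
    moreover have "cos \<bar>Im ?a\<bar> \<le> cos (pi / 2)" if "\<bar>Im ?a\<bar> \<ge> pi / 2"
      by (rule cos_monotone_0_pi_le) (use that \<open>\<bar>Im ?a\<bar> \<le> pi\<close> in auto)
    ultimately show ?thesis by (metis cos_pi_half linorder_not_le)
  qed
  show "phase y = 2 * (cosh ?a / sinh ?a - ?a)"
    unfolding phase_def 3 4 by simp
qed

lemma sgn_Re_arsinh_coord:
  assumes "y \<notin> branch_cut"
  shows "Re (arsinh_coord y) > 0 \<longleftrightarrow> Re y > 0" "Re (arsinh_coord y) < 0 \<longleftrightarrow> Re y < 0"
proof -
  have y0: "y \<noteq> 0" using notin_branch_cut_nonzero[OF assms] .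
  have c: "cos (Im (arsinh_coord y)) > 0" using Im_arsinh_coord[OF assms] by (intro cos_gt_zero_pi) auto
  have "sinh (Re (arsinh_coord y)) * cos (Im (arsinh_coord y)) = Re y / (2 * (norm y)\<^sup>2)"
  proof -
    have "1 / (2 * y) = (1 / y) / 2" by simp
    moreover have "Re (1 / y) = Re y / (norm y)\<^sup>2" by (simp add: Re_divide cmod_power2)
    ultimately have "Re (1 / (2 * y)) = Re y / (norm y)\<^sup>2 / 2" by (simp only: Re_divide_numeral)
    then show ?thesis using arg_cong[OF sinh_arsinh_coord[OF assms], of Re] unfolding Re_sinh by simp
  qed
  moreover have "(norm y)\<^sup>2 > 0" using y0 by simp
  ultimately have e: "sinh (Re (arsinh_coord y)) * (cos (Im (arsinh_coord y)) * (2 * (norm y)\<^sup>2)) = Re y"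
    by (simp add: field_simps)
  obtain q where q: "q = cos (Im (arsinh_coord y)) * (2 * (norm y)\<^sup>2)" by blast
  then have p: "q > 0" using c \<open>(norm y)\<^sup>2 > 0\<close> by simp
  show "Re (arsinh_coord y) > 0 \<longleftrightarrow> Re y > 0" unfolding e[symmetric] q[symmetric] using p
    by (auto simp: zero_less_mult_iff)
  show "Re (arsinh_coord y) < 0 \<longleftrightarrow> Re y < 0" unfolding e[symmetric] q[symmetric] using p
    by (auto simp: mult_less_0_iff)
qed

lemma root_branch_arg_notin:
  assumes "y \<notin> branch_cut"
  shows "1 / (4 * y\<^sup>2) + 1 \<notin> \<real>\<^sub>\<le>\<^sub>0"
proof
  assume "1 / (4 * y\<^sup>2) + 1 \<in> \<real>\<^sub>\<le>\<^sub>0"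
  then obtain r where "1 / (4 * y\<^sup>2) + 1 = complex_of_real r" "r \<le> 0" by (auto elim: nonpos_Reals_cases)
  then show False using Re_root_branch_pos[OF assms] by (simp add: root_branch_def)
qed

lemma root_branch_has_derivative:
  assumes "y \<notin> branch_cut"
  shows "(root_branch has_field_derivative - 1 / (4 * y ^ 3 * root_branch y)) (at y)"
proof -
  have "y \<noteq> 0" using notin_branch_cut_nonzero[OF assms] .
  have "((\<lambda>y. csqrt (1 / (4 * y\<^sup>2) + 1)) has_field_derivative - 1 / (4 * y ^ 3 * root_branch y)) (at y)"
  proof -
    have "((\<lambda>y. 1 / (4 * y\<^sup>2) + 1) has_field_derivative - 1 / (2 * y ^ 3)) (at y)"
      using \<open>y \<noteq> 0\<close> by (auto intro!: derivative_eq_intros simp: field_simps power2_eq_square power3_eq_cube)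
    from has_field_derivative_csqrt'[OF this root_branch_arg_notin[OF assms]]
    show ?thesis by (simp add: root_branch_def mult.assoc)
  qed
  then show ?thesis by (simp add: root_branch_def[abs_def])
qed

lemma arsinh_coord_has_derivative:
  assumes "y \<notin> branch_cut"
  shows "(arsinh_coord has_field_derivative - 1 / (2 * y\<^sup>2 * root_branch y)) (at y)"
proof -
  have y: "y \<noteq> 0" using notin_branch_cut_nonzero[OF assms] .
  have s: "root_branch y \<noteq> 0" using Re_root_branch_pos[OF assms] by auto
  have e: "root_branch y + 1 / (2 * y) \<noteq> 0" using root_branch_product[OF assms] by auto
  have "((\<lambda>y. root_branch y + 1 / (2 * y)) has_field_derivative - 1 / (4 * y ^ 3 * root_branch y) - 1 / (2 * y\<^sup>2)) (at y)"
    by (rule derivative_eq_intros refl root_branch_has_derivative[OF assms])+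
       (use y in \<open>simp_all add: power2_eq_square\<close>)
  also have "- 1 / (4 * y ^ 3 * root_branch y) - 1 / (2 * y\<^sup>2)
      = (root_branch y + 1 / (2 * y)) * (- 1 / (2 * y\<^sup>2 * root_branch y))"
    using y s by (simp add: field_simps power2_eq_square power3_eq_cube)
  finally have d: "((\<lambda>y. root_branch y + 1 / (2 * y)) has_field_derivative
     (root_branch y + 1 / (2 * y)) * (- 1 / (2 * y\<^sup>2 * root_branch y))) (at y)" .
  have "((\<lambda>y. Ln (root_branch y + 1 / (2 * y))) has_field_derivative
      inverse (root_branch y + 1 / (2 * y)) * ((root_branch y + 1 / (2 * y)) * (- 1 / (2 * y\<^sup>2 * root_branch y)))) (at y)"
    by (rule DERIV_chain2[OF has_field_derivative_Ln[OF arsinh_coord_arg_notin[OF assms]] d])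
  also have "inverse (root_branch y + 1 / (2 * y)) * ((root_branch y + 1 / (2 * y)) * (- 1 / (2 * y\<^sup>2 * root_branch y)))
      = - 1 / (2 * y\<^sup>2 * root_branch y)"
    unfolding mult.assoc[symmetric] left_inverse[OF e] by simp
  finally show ?thesis by (simp add: arsinh_coord_def[abs_def])
qed

lemma phase_has_derivative:
  assumes "y \<notin> branch_cut"
  shows "(phase has_field_derivative 4 * root_branch y) (at y)"
proof -
  have y: "y \<noteq> 0" using notin_branch_cut_nonzero[OF assms] .
  have s: "root_branch y \<noteq> 0" using Re_root_branch_pos[OF assms] by auto
  have "((\<lambda>y. 4 * y * root_branch y - 2 * arsinh_coord y) has_field_derivative
      (4 * root_branch y + (- 1 / (4 * y ^ 3 * root_branch y)) * (4 * y)) - 2 * (- 1 / (2 * y\<^sup>2 * root_branch y))) (at y)"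
    using DERIV_diff[OF DERIV_mult[OF DERIV_cmult[OF DERIV_ident, of 4] root_branch_has_derivative[OF assms]]
        DERIV_cmult[OF arsinh_coord_has_derivative[OF assms], of 2]] by simp
  also have "(4 * root_branch y + (- 1 / (4 * y ^ 3 * root_branch y)) * (4 * y)) - 2 * (- 1 / (2 * y\<^sup>2 * root_branch y))
      = 4 * root_branch y"
    using y s by (simp add: field_simps power2_eq_square power3_eq_cube)
  finally show ?thesis by (simp add: phase_def[abs_def])
qed

lemma holomorphic_phase: "phase holomorphic_on - branch_cut"
  unfolding holomorphic_on_open[OF open_Compl_branch_cut]
  using phase_has_derivative by blast

lemma branch_cut_minus [simp]: "- y \<in> branch_cut \<longleftrightarrow> y \<in> branch_cut"
  by (simp add: branch_cut_iff)

lemma arsinh_coord_minus: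
  assumes "y \<notin> branch_cut" shows "arsinh_coord (- y) = - arsinh_coord y"
proof -
  have "exp (arsinh_coord (- y)) = root_branch y - 1 / (2 * y)"
    using exp_arsinh_coord[of "- y"] assms by (simp add: root_branch_def)
  then have "exp (arsinh_coord (- y)) = exp (- arsinh_coord y)"
    using exp_minus_arsinh_coord[OF assms] by simp
  moreover have "\<bar>Im (arsinh_coord y)\<bar> < pi / 2" "\<bar>Im (arsinh_coord (- y))\<bar> < pi / 2"
    using Im_arsinh_coord assms by simp_all
  then have "\<bar>Im (arsinh_coord (- y)) - Im (- arsinh_coord y)\<bar> < 2 * pi"
    using pi_gt_zero unfolding uminus_complex.sel by linarith
  ultimately show ?thesis using exp_complex_eqI by blast
qed

lemma phase_minus: "y \<notin> branch_cut \<Longrightarrow> phase (- y) = - phase y"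
  by (simp add: phase_def arsinh_coord_minus root_branch_def)

text \<open>
  The derivative \<open>4 * root_branch y\<close> of the phase has positive real part (the Noshiro-Warschawski argument): the
  difference quotient is an average of its values on the segment. This gives injectivity on convex sets, and
  monotonicity of \<open>Re (phase y)\<close> in the horizontal direction.
\<close>
lemma phase_difference:
  assumes "closed_segment y1 y2 \<subseteq> - branch_cut" "y1 \<noteq> y2"
  shows "Re ((phase y2 - phase y1) / (y2 - y1)) > 0"
proof -
  define d where "d = y2 - y1"
  have d: "d \<noteq> 0" using assms(2) by (simp add: d_def)
  define f where "f t = Re (phase (y1 + of_real t * d) / d)" for t
  have mem: "y1 + of_real t * d \<notin> branch_cut" if "0 \<le> t" "t \<le> 1" for t
  proof -
    have "y1 + of_real t * d \<in> closed_segment y1 y2" using that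
      unfolding closed_segment_def d_def scaleR_conv_of_real
      by (intro CollectI exI[of _ t]) (simp add: algebra_simps)
    then show ?thesis using assms(1) by blast
  qed
  have der: "(f has_real_derivative Re (4 * root_branch (y1 + of_real t * d))) (at t)" if t: "0 \<le> t" "t \<le> 1" for t
  proof -
    have "((\<lambda>t. phase (y1 + of_real t * d)) has_vector_derivative d * (4 * root_branch (y1 + of_real t * d))) (at t)"
    proof -
      have "((\<lambda>t. y1 + of_real t * d) has_vector_derivative d) (at t)"
        by (auto intro!: derivative_eq_intros)
      from field_vector_diff_chain_at[OF this phase_has_derivative[OF mem[OF t]]]
      show ?thesis by (simp add: o_def)
    qed
    then have "((\<lambda>t. phase (y1 + of_real t * d) / d) has_vector_derivative d * (4 * root_branch (y1 + of_real t * d)) / d) (at t)"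
      by (rule has_vector_derivative_divide)
    then have "((\<lambda>t. phase (y1 + of_real t * d) / d) has_vector_derivative 4 * root_branch (y1 + of_real t * d)) (at t)"
      using d by simp
    then have "(f has_vector_derivative Re (4 * root_branch (y1 + of_real t * d))) (at t)"
      unfolding f_def by (rule bounded_linear.has_vector_derivative[OF bounded_linear_Re])
    then show ?thesis by (simp add: has_real_derivative_iff_has_vector_derivative)
  qed
  have "f 0 < f 1"
  proof (rule DERIV_pos_imp_increasing[where f = f and a = 0 and b = 1])
    fix t :: real assume t: "0 \<le> t" "t \<le> 1"
    show "\<exists>y. DERIV f t :> y \<and> 0 < y"
      using der[OF t] Re_root_branch_pos[OF mem[OF t]] by auto
  qed simp
  then show ?thesis by (simp add: f_def d_def diff_divide_distrib)
qed

text \<open>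
  For \<open>norm y \<ge> 1\<close> the square root has modulus between \<open>3 / 4\<close> and \<open>3 / 2\<close>, so the phase differs from a
  quantity of modulus at least \<open>3 * norm y\<close> by a bounded one.
\<close>
lemma phase_large:
  assumes "norm y \<ge> 1"
  shows "norm (phase y) \<ge> 3 * norm y - 8" "norm (root_branch y) \<ge> 3 / 4" "norm (arsinh_coord y) \<le> 4"
    "y \<notin> branch_cut"
proof -
  show cut: "y \<notin> branch_cut"
  proof
    assume "y \<in> branch_cut"
    then have "norm y \<le> 1 / 2" using cmod_le[of y] by (simp add: branch_cut_iff)
    then show False using assms by simp
  qed
  have y: "norm (1 / (4 * y\<^sup>2)) \<le> 1 / 4" "norm (1 / (2 * y)) \<le> 1 / 2" 
  proof -
    have "(norm y)\<^sup>2 \<ge> 1" using assms by simp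
    then have "inverse ((norm y)\<^sup>2) \<le> 1" "inverse (norm y) \<le> 1" using assms by (auto intro!: inverse_le_1_iff[THEN iffD2])
    then show "norm (1 / (4 * y\<^sup>2)) \<le> 1 / 4" "norm (1 / (2 * y)) \<le> 1 / 2"
      by (simp_all add: norm_divide norm_mult norm_power inverse_eq_divide)
  qed
  have sq: "norm ((root_branch y)\<^sup>2) \<ge> 1 - 1 / 4" "norm ((root_branch y)\<^sup>2) \<le> 1 + 1 / 4"
    unfolding root_branch_squared[OF cut]
    using y(1) norm_triangle_ineq[of "1 / (4 * y\<^sup>2)" 1] norm_triangle_ineq2[of 1 "- (1 / (4 * y\<^sup>2))"] by (auto simp: add.commute)
  show s: "norm (root_branch y) \<ge> 3 / 4"
    by (rule power2_le_imp_le) (use sq in \<open>auto simp: norm_power power2_eq_square norm_mult\<close>)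
  have s2: "norm (root_branch y) \<le> 3 / 2"
    by (rule power2_le_imp_le) (use sq in \<open>auto simp: norm_power power2_eq_square norm_mult\<close>)
  have e: "norm (exp (arsinh_coord y)) \<le> 2" "norm (exp (- arsinh_coord y)) \<le> 2"
    unfolding exp_arsinh_coord[OF cut] exp_minus_arsinh_coord[OF cut]
    using s2 y(2) norm_triangle_ineq[of "root_branch y" "1 / (2 * y)"] norm_triangle_ineq4[of "root_branch y" "1 / (2 * y)"]
    by linarith+
  have "\<bar>Re (arsinh_coord y)\<bar> \<le> 1"
  proof -
    have 2: "(2::real) \<le> exp 1" using exp_ge_add_one_self[of "1::real"] by simp
    have "Re (arsinh_coord y) \<le> 1" "- Re (arsinh_coord y) \<le> 1"
      using order_trans[OF e(1) 2] order_trans[OF e(2) 2] by simp_all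
    then show ?thesis by linarith
  qed
  moreover have "\<bar>Im (arsinh_coord y)\<bar> \<le> 2" using Im_arsinh_coord[OF cut] pi_less_4 by linarith
  ultimately show a: "norm (arsinh_coord y) \<le> 4" using cmod_le[of "arsinh_coord y"] by linarith
  have "norm (4 * y * root_branch y) \<ge> 3 * norm y"
  proof -
    have "4 * norm y * (3 / 4) \<le> 4 * norm y * norm (root_branch y)" using s by (intro mult_left_mono) auto
    then show ?thesis by (simp add: norm_mult)
  qed
  moreover have "norm (phase y) \<ge> norm (4 * y * root_branch y) - norm (2 * arsinh_coord y)"
    unfolding phase_def by (rule norm_triangle_ineq2)
  ultimately show "norm (phase y) \<ge> 3 * norm y - 8" using a unfolding norm_mult[of 2] by simp
qed

section \<open>The exterior of the eye\<close>

text \<open>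
  The real part of the phase vanishes on the imaginary axis outside the branch cut and, outside the eye, has the sign of
  \<open>Re y\<close>. The first set makes the union open across the imaginary rays; there the sign condition holds by itself
  (\<open>Re_phase_pos_above\<close>).
\<close>
definition eye_exterior :: "complex set" where
  "eye_exterior = {y. 1 / 2 < \<bar>Im y\<bar>} \<union> {y. 0 < Re y \<and> 0 < Re (phase y)}
     \<union> {y. Re y < 0 \<and> Re (phase y) < 0}"

lemma phase_cnj:
  assumes "y \<notin> branch_cut" shows "phase (cnj y) = cnj (phase y)"
proof -
  have s: "root_branch (cnj y) = cnj (root_branch y)"
    unfolding root_branch_def cnj_csqrt[OF root_branch_arg_notin[OF assms]] by simp
  have "arsinh_coord (cnj y) = cnj (arsinh_coord y)"
    unfolding arsinh_coord_def s cnj_Ln[OF arsinh_coord_arg_notin[OF assms]] by simp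
  then show ?thesis unfolding phase_def s by simp
qed

text \<open>
  On the imaginary axis complex conjugation is \<open>y \<mapsto> - y\<close>, and the phase is odd.
\<close>
lemma Re_phase_imaginary_axis:
  assumes "y \<notin> branch_cut" "Re y = 0" shows "Re (phase y) = 0"
proof -
  have "cnj y = - y" using assms(2) by (simp add: complex_eq_iff)
  then have "cnj (phase y) = - phase y" using phase_cnj[OF assms(1)] phase_minus[OF assms(1)] by simp
  then have "Re (cnj (phase y)) = Re (- phase y)" by (rule arg_cong)
  then show ?thesis by simp
qed

lemma Im_gt_half_notin_branch_cut: "1 / 2 < \<bar>Im y\<bar> \<Longrightarrow> y \<notin> branch_cut"
  and Re_nonzero_notin_branch_cut: "Re y \<noteq> 0 \<Longrightarrow> y \<notin> branch_cut"
  by (auto simp: branch_cut_iff)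

lemma eye_exterior_notin_branch_cut: "y \<in> eye_exterior \<Longrightarrow> y \<notin> branch_cut"
  by (auto simp: eye_exterior_def branch_cut_iff)

lemma eye_exterior_minus [simp]: "- y \<in> eye_exterior \<longleftrightarrow> y \<in> eye_exterior"
proof -
  have "- y \<in> eye_exterior" if "y \<in> eye_exterior" for y
    using phase_minus[OF eye_exterior_notin_branch_cut[OF that]] that by (auto simp: eye_exterior_def)
  from this[of y] this[of "- y"] show ?thesis by auto
qed

lemma Re_phase_pos_above:
  assumes "1 / 2 < \<bar>Im y\<bar>" "Re y > 0" shows "Re (phase y) > 0"
proof -
  define y1 where "y1 = Complex 0 (Im y)"
  have y1: "y1 \<notin> branch_cut" "Re y1 = 0" using assms by (auto simp: y1_def branch_cut_iff)
  have seg: "closed_segment y1 y \<subseteq> - branch_cut"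
  proof
    fix z assume "z \<in> closed_segment y1 y"
    then obtain t where "z = (1 - t) *\<^sub>R y1 + t *\<^sub>R y" by (auto simp: closed_segment_def)
    then have "Im z = (1 - t) * Im y1 + t * Im y" by simp
    then have "Im z = Im y" by (simp add: y1_def algebra_simps)
    then show "z \<in> - branch_cut" using assms by (simp add: branch_cut_iff)
  qed
  have d: "y - y1 = of_real (Re y)" by (simp add: y1_def complex_eq_iff)
  have "y1 \<noteq> y" using assms(2) y1(2) by auto
  from phase_difference[OF seg this] have "0 < Re (phase y - phase y1) / Re y"
    unfolding d by (simp only: Re_divide_of_real)
  then show ?thesis using assms Re_phase_imaginary_axis[OF y1] by (simp add: zero_less_divide_iff)
qed

lemma eye_exterior_cases:
  assumes "y \<in> eye_exterior"
  obtains (right) "Re y > 0" "Re (phase y) > 0"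
    | (left) "Re y < 0" "Re (phase y) < 0"
    | (axis) "Re y = 0" "1 / 2 < \<bar>Im y\<bar>" "Re (phase y) = 0"
proof -
  consider "Re y > 0" | "Re y < 0" | "Re y = 0" by linarith
  then show ?thesis
  proof cases
    case 1
    then have "Re (phase y) > 0" using assms Re_phase_pos_above[of y] by (auto simp: eye_exterior_def)
    with 1 right show ?thesis by blast
  next
    case 2
    have "Re (phase y) < 0"
    proof (cases "1 / 2 < \<bar>Im y\<bar>")
      case True
      then have "Re (phase (- y)) > 0" using 2 by (intro Re_phase_pos_above) auto
      then show ?thesis using phase_minus[OF Im_gt_half_notin_branch_cut[OF True]] by simp
    qed (use assms 2 in \<open>auto simp: eye_exterior_def\<close>)
    with 2 left show ?thesis by blast
  next
    case 3
    then have "1 / 2 < \<bar>Im y\<bar>" using assms by (auto simp: eye_exterior_def)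
    with 3 axis show ?thesis using Re_phase_imaginary_axis[OF Im_gt_half_notin_branch_cut] by blast
  qed
qed

lemma Re_neq_0_continuous_phase:
  "continuous_on {y. Re y > 0} (\<lambda>y. Re (phase y))" "continuous_on {y. Re y < 0} (\<lambda>y. Re (phase y))"
proof -
  have c: "continuous_on (- branch_cut) phase" using holomorphic_phase by (rule holomorphic_on_imp_continuous_on)
  show "continuous_on {y. Re y > 0} (\<lambda>y. Re (phase y))" "continuous_on {y. Re y < 0} (\<lambda>y. Re (phase y))"
    by (rule continuous_on_subset[OF continuous_on_Re[OF c]]; auto simp: branch_cut_iff)+
qed

lemma open_eye_exterior: "open eye_exterior"
proof -
  have "open ({y. Re y > 0} \<inter> (\<lambda>y. Re (phase y)) -` {0<..})"
    by (rule continuous_open_preimage[OF Re_neq_0_continuous_phase(1)])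
       (auto intro!: open_Collect_less continuous_intros)
  moreover have "open ({y. Re y < 0} \<inter> (\<lambda>y. Re (phase y)) -` {..<0})"
    by (rule continuous_open_preimage[OF Re_neq_0_continuous_phase(2)])
       (auto intro!: open_Collect_less continuous_intros)
  moreover have "open {y. 1 / 2 < \<bar>Im y\<bar>}" by (intro open_Collect_less continuous_intros)
  moreover have "eye_exterior = {y. 1 / 2 < \<bar>Im y\<bar>} \<union> ({y. Re y > 0} \<inter> (\<lambda>y. Re (phase y)) -` {0<..})
     \<union> ({y. Re y < 0} \<inter> (\<lambda>y. Re (phase y)) -` {..<0})"
    by (auto simp: eye_exterior_def)
  ultimately show ?thesis using open_Un by metis
qed

text \<open>
  The trigonometric terms combine by \<open>cos\<^sup>2 + sin\<^sup>2 = 1\<close>, so the sign is that of \<open>Re a\<close>.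
\<close>
lemma Re_coth:
  fixes a :: complex
  shows "Re (cosh a / sinh a) = sinh (Re a) * cosh (Re a) / (norm (sinh a))\<^sup>2"
proof -
  have "(C * c) * (S * c) + (S * s) * (C * s) = S * C * (c\<^sup>2 + s\<^sup>2)" for C S c s :: real
    by (simp add: algebra_simps power2_eq_square)
  then have "Re (cosh a) * Re (sinh a) + Im (cosh a) * Im (sinh a) = sinh (Re a) * cosh (Re a)"
    unfolding Re_sinh Im_sinh Re_cosh Im_cosh by simp
  then show ?thesis unfolding Re_divide cmod_power2 by simp
qed

lemma Re_times_root_branch_pos:
  assumes "Re y > 0" shows "Re (y * root_branch y) > 0"
proof -
  have cut: "y \<notin> branch_cut" using assms by (intro Re_nonzero_notin_branch_cut) auto
  let ?a = "arsinh_coord y"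
  have a: "Re ?a > 0" using sgn_Re_arsinh_coord(1)[OF cut] assms by simp
  have y: "y = 1 / (2 * sinh ?a)" unfolding sinh_arsinh_coord[OF cut] by simp
  have nz: "sinh ?a \<noteq> 0" unfolding sinh_arsinh_coord[OF cut] using notin_branch_cut_nonzero[OF cut] by simp
  have "y * root_branch y = (cosh ?a / sinh ?a) / 2"
    by (subst y) (simp add: cosh_arsinh_coord[OF cut])
  then have "Re (y * root_branch y) = Re (cosh ?a / sinh ?a) / 2" by (simp only: Re_divide_numeral)
  also note Re_coth
  finally show ?thesis using a nz by simp
qed

text \<open>
  The derivative of \<open>phase (r * y)\<close> in \<open>r\<close> is \<open>4 / r\<close> times \<open>(r * y) * root_branch (r * y)\<close>.
\<close>
lemma Re_phase_increasing_on_rays: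
  assumes y: "Re y > 0" and t: "1 < t"
  shows "Re (phase y) < Re (phase (of_real t * y))"
proof -
  define f where "f r = Re (phase (of_real r * y))" for r
  have "f 1 < f t"
  proof (rule DERIV_pos_imp_increasing[where f = f and a = 1 and b = t, OF t])
    fix r :: real assume r: "1 \<le> r" "r \<le> t"
    have p: "Re (of_real r * y) > 0" using r y by simp
    have cut: "of_real r * y \<notin> branch_cut" using p by (intro Re_nonzero_notin_branch_cut) auto
    have "((\<lambda>r. of_real r * y) has_vector_derivative y) (at r)" by (auto intro!: derivative_eq_intros)
    from field_vector_diff_chain_at[OF this phase_has_derivative[OF cut]]
    have "((\<lambda>r. phase (of_real r * y)) has_vector_derivative y * (4 * root_branch (of_real r * y))) (at r)"
      by (simp add: o_def)
    then have "(f has_vector_derivative Re (y * (4 * root_branch (of_real r * y)))) (at r)"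
      unfolding f_def by (rule bounded_linear.has_vector_derivative[OF bounded_linear_Re])
    then have d: "(f has_real_derivative Re (y * (4 * root_branch (of_real r * y)))) (at r)"
      by (simp add: has_real_derivative_iff_has_vector_derivative)
    have "y * (4 * root_branch (of_real r * y)) = (of_real r * y * root_branch (of_real r * y)) * of_real (4 / r)"
      using r by simp
    then have "Re (y * (4 * root_branch (of_real r * y))) = Re (of_real r * y * root_branch (of_real r * y)) * (4 / r)"
      by (simp only: times_complex.sel Re_complex_of_real Im_complex_of_real)
    then have "Re (y * (4 * root_branch (of_real r * y))) > 0"
      using Re_times_root_branch_pos[OF p] r by (metis divide_pos_pos less_le_trans mult_pos_pos zero_less_numeral zero_less_one)
    with d show "\<exists>l. DERIV f r :> l \<and> 0 < l" by blast
  qed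
  then show ?thesis by (simp add: f_def)
qed

text \<open>
  This is what makes the eye star-shaped about \<open>0\<close>.
\<close>
lemma eye_exterior_scaling:
  assumes "y \<in> eye_exterior" "1 \<le> t" shows "of_real t * y \<in> eye_exterior"
proof -
  have R: "of_real t * y \<in> eye_exterior" if "Re y > 0" "Re (phase y) > 0" for y
  proof (cases "t = 1")
    case False
    then have "Re (phase (of_real t * y)) > 0" using Re_phase_increasing_on_rays[OF that(1), of t] that assms(2) by linarith
    then show ?thesis using that(1) assms(2) by (simp add: eye_exterior_def)
  qed (use that in \<open>simp add: eye_exterior_def\<close>)
  show ?thesis using assms(1)
  proof (cases rule: eye_exterior_cases)
    case right then show ?thesis by (rule R)
  next
    case left
    then have "Re (phase (- y)) > 0" using phase_minus[OF eye_exterior_notin_branch_cut[OF assms(1)]] by simp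
    then have "of_real t * (- y) \<in> eye_exterior" using left by (intro R) auto
    then show ?thesis using eye_exterior_minus[of "of_real t * y"] by simp
  next
    case axis
    have "1 * \<bar>Im y\<bar> \<le> t * \<bar>Im y\<bar>" using assms(2) by (intro mult_right_mono) auto
    then have "1 / 2 < \<bar>Im (of_real t * y)\<bar>" using axis assms(2) by (simp add: abs_mult)
    then show ?thesis by (simp add: eye_exterior_def)
  qed
qed

lemma norm_cosh_sinh_bounds:
  fixes a :: complex
  shows "norm (cosh a) \<le> cosh (Re a)" "norm (sinh a) \<le> cosh (Re a)" "norm (sinh a) \<ge> sinh (Re a)"
proof -
  have e: "norm (exp a) = exp (Re a)" "norm (exp (- a)) = exp (- Re a)" by simp_all
  show "norm (cosh a) \<le> cosh (Re a)" unfolding cosh_field_def norm_divide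
    using norm_triangle_ineq[of "exp a" "exp (- a)"] e by simp
  show "norm (sinh a) \<le> cosh (Re a)" unfolding cosh_field_def sinh_field_def norm_divide
    using norm_triangle_ineq4[of "exp a" "exp (- a)"] e by simp
  show "norm (sinh a) \<ge> sinh (Re a)" unfolding sinh_field_def norm_divide
    using norm_triangle_ineq2[of "exp a" "exp (- a)"] e by simp
qed

text \<open>
  For \<open>Re a \<ge> 2\<close> one has \<open>norm (coth a) \<le> coth (Re a) \<le> 2 \<le> Re a\<close>, and the phase would have nonpositive
  real part.
\<close>
lemma Re_arsinh_coord_bound:
  assumes "y \<in> eye_exterior" "Re y > 0"
  shows "0 < Re (arsinh_coord y)" "Re (arsinh_coord y) < 2"
proof -
  have cut: "y \<notin> branch_cut" using eye_exterior_notin_branch_cut[OF assms(1)] .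
  let ?a = "arsinh_coord y"
  show a: "0 < Re ?a" using sgn_Re_arsinh_coord(1)[OF cut] assms(2) by simp
  show "Re ?a < 2"
  proof (rule ccontr)
    assume "\<not> Re ?a < 2"
    then have a2: "Re ?a \<ge> 2" by simp
    have s: "sinh (Re ?a) > 0" using a by simp
    have "cosh (Re ?a) \<le> 2 * sinh (Re ?a)"
    proof -
      have "3 \<le> exp (2 * Re ?a)" using exp_ge_add_one_self[of "2 * Re ?a"] a2 by linarith
      then have "3 * exp (- Re ?a) \<le> exp (2 * Re ?a) * exp (- Re ?a)" by (intro mult_right_mono) auto
      also have "\<dots> = exp (Re ?a)" by (simp flip: exp_add)
      finally show ?thesis unfolding cosh_field_def sinh_field_def by (simp add: field_simps)
    qed
    then have "norm (cosh ?a) \<le> 2 * norm (sinh ?a)" using norm_cosh_sinh_bounds[of ?a] by linarith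
    moreover have "norm (sinh ?a) > 0" using norm_cosh_sinh_bounds(3)[of ?a] s by linarith
    ultimately have "norm (cosh ?a / sinh ?a) \<le> 2" by (simp add: norm_divide field_simps)
    then have "Re (cosh ?a / sinh ?a) \<le> 2" using complex_Re_le_cmod order_trans by blast
    moreover have "Re (phase y) = 2 * (Re (cosh ?a / sinh ?a) - Re ?a)"
    proof -
      have "Re (2 * w) = 2 * Re w" for w by simp
      then show ?thesis unfolding phase_eq_coth[OF cut] by (simp only: minus_complex.sel)
    qed
    moreover have "Re (phase y) > 0" using assms by (cases rule: eye_exterior_cases) auto
    ultimately show False using a2 by simp
  qed
qed

lemma eye_exterior_norm_ge:
  assumes "y \<in> eye_exterior" shows "norm y \<ge> 1 / (2 * cosh 2)"
proof -
  have R: "norm y \<ge> 1 / (2 * cosh 2)" if "y \<in> eye_exterior" "Re y > 0" for y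
  proof -
    have cut: "y \<notin> branch_cut" using eye_exterior_notin_branch_cut[OF that(1)] .
    let ?a = "arsinh_coord y"
    have "norm (sinh ?a) \<le> cosh (Re ?a)" by (rule norm_cosh_sinh_bounds)
    also have "\<dots> \<le> cosh 2"
      using Re_arsinh_coord_bound[OF that] by (subst cosh_real_nonneg_le_iff) auto
    finally have "1 / (2 * norm y) \<le> cosh 2" unfolding sinh_arsinh_coord[OF cut] by (simp add: norm_divide norm_mult)
    moreover have "norm y > 0" using notin_branch_cut_nonzero[OF cut] by simp
    ultimately show ?thesis by (simp add: field_simps)
  qed
  show ?thesis using assms
  proof (cases rule: eye_exterior_cases)
    case right then show ?thesis using R assms by blast
  next
    case left then show ?thesis using R[of "- y"] assms by simp
  next
    case axis
    have "1 / (2 * cosh 2) \<le> 1 / (2 * (1::real))" using cosh_real_ge_1[of 2] by (intro divide_left_mono) auto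
    also have "\<dots> \<le> norm y" using axis abs_Im_le_cmod[of y] by linarith
    finally show ?thesis .
  qed
qed

lemma abs_Re_arsinh_coord_le:
  assumes "y \<in> eye_exterior" shows "\<bar>Re (arsinh_coord y)\<bar> \<le> 2"
proof -
  have cut: "y \<notin> branch_cut" using eye_exterior_notin_branch_cut[OF assms] .
  show ?thesis using assms
  proof (cases rule: eye_exterior_cases)
    case right then show ?thesis using Re_arsinh_coord_bound[OF assms] by simp
  next
    case left then show ?thesis using Re_arsinh_coord_bound[of "- y"] assms arsinh_coord_minus[OF cut] by simp
  next
    case axis then show ?thesis using sgn_Re_arsinh_coord[OF cut] by auto
  qed
qed

lemma eye_exterior_norm_phase_le:
  assumes "y \<in> eye_exterior" shows "norm (phase y) \<le> 4 * norm y + 12"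
proof -
  have cut: "y \<notin> branch_cut" using eye_exterior_notin_branch_cut[OF assms] .
  have "(norm (y * root_branch y))\<^sup>2 = norm (y\<^sup>2 * (1 / (4 * y\<^sup>2) + 1))"
    unfolding root_branch_squared[OF cut, symmetric] by (simp add: norm_power norm_mult power_mult_distrib)
  also have "y\<^sup>2 * (1 / (4 * y\<^sup>2) + 1) = y\<^sup>2 + 1 / 4"
    using notin_branch_cut_nonzero[OF cut] by (simp add: field_simps)
  also have "norm (y\<^sup>2 + 1 / 4) \<le> (norm y)\<^sup>2 + 1 / 4"
    by (rule norm_triangle_le) (simp add: norm_power)
  also have "\<dots> \<le> (norm y + 1)\<^sup>2" by (simp add: power2_eq_square algebra_simps)
  finally have w: "norm (y * root_branch y) \<le> norm y + 1" by (rule power2_le_imp_le) simp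
  have "\<bar>Re (arsinh_coord y)\<bar> \<le> 2" by (rule abs_Re_arsinh_coord_le[OF assms])
  moreover have "\<bar>Im (arsinh_coord y)\<bar> \<le> 2" using Im_arsinh_coord[OF cut] pi_less_4 by linarith
  ultimately have "norm (arsinh_coord y) \<le> 4" using cmod_le[of "arsinh_coord y"] by linarith
  then have "norm (2 * arsinh_coord y) \<le> 8" unfolding norm_mult by simp
  moreover have "norm (4 * y * root_branch y) \<le> 4 * (norm y + 1)" using w unfolding mult.assoc norm_mult[of 4] by simp
  moreover have "norm (phase y) \<le> norm (4 * y * root_branch y) + norm (2 * arsinh_coord y)"
    unfolding phase_def by (rule norm_triangle_ineq4)
  ultimately have "norm (phase y) \<le> 4 * (norm y + 1) + 8" using add_mono order_trans by blast
  then show ?thesis by simp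
qed

text \<open>
  Compactness in the closed strip: a bounded sequence in the right half of the exterior converges, after passing to a
  subsequence, together with its phase, even when the limit lies on the branch cut, where the phase itself is
  discontinuous.
\<close>
lemma eye_exterior_right_limit:
  fixes y :: "nat \<Rightarrow> complex"
  assumes y: "\<And>k. y k \<in> eye_exterior" "\<And>k. Re (y k) > 0" and B: "\<And>k. norm (y k) \<le> B"
  obtains a r where "strict_mono r" "0 \<le> Re a" "\<bar>Im a\<bar> \<le> pi / 2" "sinh a \<noteq> 0"
    "(y \<circ> r) \<longlonglongrightarrow> 1 / (2 * sinh a)" "(phase \<circ> y \<circ> r) \<longlonglongrightarrow> 2 * (cosh a / sinh a - a)"
proof -
  define K where "K = cbox (Complex 0 (- (pi / 2))) (Complex 2 (pi / 2))"
  have cut: "y k \<notin> branch_cut" for k using eye_exterior_notin_branch_cut[OF y(1)] .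
  have mem: "arsinh_coord (y k) \<in> K" for k
    using Re_arsinh_coord_bound[OF y, of k] Im_arsinh_coord[OF cut, of k]
    by (simp add: K_def in_cbox_complex_iff abs_le_iff less_imp_le abs_less_iff)
  have "seq_compact K" unfolding K_def by (intro compact_imp_seq_compact compact_cbox)
  then obtain a r where a: "a \<in> K" "strict_mono r" "((\<lambda>k. arsinh_coord (y k)) \<circ> r) \<longlonglongrightarrow> a"
    by (rule seq_compactE[of K "\<lambda>k. arsinh_coord (y k)"]) (use mem in auto)
  then have lim: "(\<lambda>k. arsinh_coord (y (r k))) \<longlonglongrightarrow> a" by (simp add: o_def)
  have Bpos: "B > 0" using B[of 0] y(2)[of 0] complex_Re_le_cmod[of "y 0"] by linarith
  have "norm (sinh a) \<ge> 1 / (2 * B)"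
  proof (rule tendsto_lowerbound)
    show "(\<lambda>k. norm (sinh (arsinh_coord (y (r k))))) \<longlonglongrightarrow> norm (sinh a)"
      by (intro tendsto_intros lim)
    show "\<forall>\<^sub>F k in sequentially. 1 / (2 * B) \<le> norm (sinh (arsinh_coord (y (r k))))"
    proof (rule always_eventually, rule allI)
      fix k
      have "norm (y (r k)) > 0" using notin_branch_cut_nonzero[OF cut] by simp
      then have "1 / (2 * B) \<le> 1 / (2 * norm (y (r k)))" using B[of "r k"] Bpos by (intro divide_left_mono) auto
      then show "1 / (2 * B) \<le> norm (sinh (arsinh_coord (y (r k))))"
        unfolding sinh_arsinh_coord[OF cut] by (simp add: norm_divide norm_mult)
    qed
  qed simp
  then have nz: "sinh a \<noteq> 0" using Bpos by (intro notI) (simp add: divide_le_0_iff)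
  have "(\<lambda>k. 1 / (2 * sinh (arsinh_coord (y (r k))))) \<longlonglongrightarrow> 1 / (2 * sinh a)"
    using nz by (intro tendsto_intros lim) auto
  then have 1: "(y \<circ> r) \<longlonglongrightarrow> 1 / (2 * sinh a)" unfolding sinh_arsinh_coord[OF cut] by (simp add: o_def)
  have "(\<lambda>k. 2 * (cosh (arsinh_coord (y (r k))) / sinh (arsinh_coord (y (r k))) - arsinh_coord (y (r k))))
      \<longlonglongrightarrow> 2 * (cosh a / sinh a - a)"
    using nz by (intro tendsto_intros lim) auto
  then have 2: "(phase \<circ> y \<circ> r) \<longlonglongrightarrow> 2 * (cosh a / sinh a - a)"
    unfolding phase_eq_coth[OF cut, symmetric] by (simp add: o_def)
  have "0 \<le> Re a" "\<bar>Im a\<bar> \<le> pi / 2" using a(1) by (auto simp: K_def in_cbox_complex_iff abs_le_iff)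
  with that a(2) nz 1 2 show ?thesis by blast
qed

text \<open>
  On the boundary lines \<open>\<bar>Im a\<bar> = pi / 2\<close> of the strip the real part of \<open>coth a\<close> is \<open>tanh (Re a)\<close>, which is less than
  \<open>Re a\<close>; on the imaginary axis both terms are imaginary.
\<close>
lemma Re_coth_boundary:
  assumes "0 \<le> Re a" "\<bar>Im a\<bar> = pi / 2 \<or> Re a = 0" "sinh a \<noteq> 0"
  shows "Re (cosh a / sinh a - a) \<le> 0" "Re a \<noteq> 0 \<Longrightarrow> Re (cosh a / sinh a - a) < 0"
proof -
  have *: "Re (cosh a / sinh a - a) < 0" if ra: "Re a > 0"
  proof -
    have "\<bar>Im a\<bar> = pi / 2" using assms(2) ra by auto
    then have "Im a = pi / 2 \<or> Im a = - (pi / 2)" by linarith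
    then have "cos (Im a) = 0" by (elim disjE) (simp_all only: cos_minus cos_pi_half)
    then have "(sin (Im a))\<^sup>2 = 1" using sin_cos_squared_add[of "Im a"] by simp
    then have "(norm (sinh a))\<^sup>2 = (cosh (Re a))\<^sup>2" using \<open>cos (Im a) = 0\<close> unfolding cmod_power2 Re_sinh Im_sinh
      by (simp add: power_mult_distrib)
    then have "Re (cosh a / sinh a) = tanh (Re a)" unfolding Re_coth tanh_def by (simp add: power2_eq_square)
    then show ?thesis using tanh_less_self[OF ra] by simp
  qed
  show "Re a \<noteq> 0 \<Longrightarrow> Re (cosh a / sinh a - a) < 0" using * assms(1) by simp
  show "Re (cosh a / sinh a - a) \<le> 0"
    using * assms(1) Re_coth[of a] by (cases "Re a = 0") (auto simp: less_imp_le)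
qed

text \<open>
  The image of the right half of the exterior is open by the open mapping theorem. It is also closed in the right
  half-plane: a limit of values of the phase is \<open>2 * (coth a - a)\<close> for some \<open>a\<close> in the closed half-strip, and
  \<open>Re_coth_boundary\<close> excludes the boundary of the half-strip.
\<close>
lemma phase_image_right: "Re Z > 0 \<Longrightarrow> \<exists>y\<in>eye_exterior. Re y > 0 \<and> phase y = Z"
proof -
  assume Z: "Re Z > 0"
  define XR where "XR = eye_exterior \<inter> {y. Re y > 0}"
  define H where "H = {Z. Re Z > 0}"
  have oX: "open XR" unfolding XR_def by (intro open_Int open_eye_exterior open_Collect_less continuous_intros)
  have subcut: "XR \<subseteq> - branch_cut" using eye_exterior_notin_branch_cut by (auto simp: XR_def)
  have sub: "phase ` XR \<subseteq> H"
  proof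
    fix Z assume "Z \<in> phase ` XR"
    then obtain y where "y \<in> eye_exterior" "Re y > 0" "Z = phase y" by (auto simp: XR_def)
    then show "Z \<in> H" by (cases rule: eye_exterior_cases) (auto simp: H_def)
  qed
  have inj: "inj_on phase XR"
  proof (rule inj_onI, rule ccontr)
    fix y1 y2 assume *: "y1 \<in> XR" "y2 \<in> XR" "phase y1 = phase y2" "y1 \<noteq> y2"
    have "closed_segment y1 y2 \<subseteq> {y. Re y > 0}"
      by (rule closed_segment_subset) (use * in \<open>auto simp: XR_def convex_halfspace_Re_gt\<close>)
    then have "closed_segment y1 y2 \<subseteq> - branch_cut" by (auto simp: branch_cut_iff)
    from phase_difference[OF this *(4)] *(3) show False by simp
  qed
  have "open (phase ` XR)"
    by (rule open_mapping_thm3[OF holomorphic_on_subset[OF holomorphic_phase subcut] oX inj])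
  then have op: "openin (top_of_set H) (phase ` XR)" using sub by (simp add: open_subset)
  have "closedin (top_of_set H) (phase ` XR)"
  proof -
    have "Z \<in> phase ` XR" if Z: "Z \<in> H" "Z \<in> closure (phase ` XR)" for Z
    proof -
      obtain f where f: "\<And>k. f k \<in> phase ` XR" "f \<longlonglongrightarrow> Z" using Z(2) unfolding closure_sequential by blast
      have "\<forall>k. \<exists>y. y \<in> XR \<and> f k = phase y" using f(1) by blast
      then obtain y where y: "\<And>k. y k \<in> XR" "\<And>k. f k = phase (y k)" by metis
      have "Bseq f" using f(2) by (intro convergent_imp_Bseq convergentI)
      then obtain C where C: "\<And>k. norm (f k) \<le> C" unfolding Bseq_def by blast
      have bd: "norm (y k) \<le> C + 8 + 1" for k
      proof (cases "norm (y k) \<ge> 1")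
        case True
        have "3 * norm (y k) - 8 \<le> C" using phase_large(1)[OF True] C[of k] y(2)[of k] by simp
        then show ?thesis using norm_ge_zero[of "y k"] by linarith
      next
        case False
        then show ?thesis using norm_ge_zero[of "f k"] C[of k] by linarith
      qed
      have yE: "\<And>k. y k \<in> eye_exterior" and yR: "\<And>k. Re (y k) > 0" using y(1) by (auto simp: XR_def)
      obtain a r where ar: "strict_mono r" "0 \<le> Re a" "\<bar>Im a\<bar> \<le> pi / 2" "sinh a \<noteq> 0"
          "(y \<circ> r) \<longlonglongrightarrow> 1 / (2 * sinh a)" "(phase \<circ> y \<circ> r) \<longlonglongrightarrow> 2 * (cosh a / sinh a - a)"
        by (rule eye_exterior_right_limit[OF yE yR bd], rule that)
      have "(phase \<circ> y \<circ> r) \<longlonglongrightarrow> Z"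
        using LIMSEQ_subseq_LIMSEQ[OF f(2) ar(1)] y(2) by (simp add: o_def)
      then have Za: "Z = 2 * (cosh a / sinh a - a)" using ar(6) LIMSEQ_unique by blast
      have "Re (2 * w) = 2 * Re w" for w by simp
      then have "Re Z = 2 * Re (cosh a / sinh a - a)" unfolding Za .
      then have "Re (cosh a / sinh a - a) > 0" using Z(1) by (simp add: H_def)
      then have a: "Re a > 0" "\<bar>Im a\<bar> < pi / 2" using Re_coth_boundary(1)[of a] ar by force+
      define y0 where "y0 = 1 / (2 * sinh a)"
      have "Re (sinh a) > 0" unfolding Re_sinh using a by (intro mult_pos_pos cos_gt_zero_pi) auto
      then have p2: "Re (2 * sinh a) > 0" by simp
      have "Re y0 = Re (2 * sinh a) / ((Re (2 * sinh a))\<^sup>2 + (Im (2 * sinh a))\<^sup>2)"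
        unfolding y0_def Re_divide by simp
      also have "\<dots> > 0" by (intro divide_pos_pos add_pos_nonneg zero_less_power zero_le_power2 p2)
      finally have Rey0: "Re y0 > 0" .
      then have y0cut: "y0 \<notin> branch_cut" by (intro Re_nonzero_notin_branch_cut) auto
      have "isCont phase y0" using phase_has_derivative[OF y0cut] DERIV_isCont by blast
      then have "(phase \<circ> y \<circ> r) \<longlonglongrightarrow> phase y0"
        using isCont_tendsto_compose[of y0 phase "y \<circ> r"] ar(5) by (simp add: y0_def o_def)
      then have "Z = phase y0" using \<open>(phase \<circ> y \<circ> r) \<longlonglongrightarrow> Z\<close> LIMSEQ_unique by blast
      moreover have "y0 \<in> XR" using Z(1) Rey0 \<open>Z = phase y0\<close> by (simp add: XR_def eye_exterior_def H_def)
      ultimately show ?thesis by blast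
    qed
    then have "H \<inter> closure (phase ` XR) \<subseteq> phase ` XR" by (intro subsetI) (elim IntE)
    moreover have "phase ` XR \<subseteq> H \<inter> closure (phase ` XR)" by (intro Int_greatest sub closure_subset)
    ultimately have "phase ` XR = H \<inter> closure (phase ` XR)" by (rule equalityI[rotated])
    then show ?thesis using closedin_closed_Int[OF closed_closure, of H "phase ` XR"] by simp
  qed
  moreover have "connected H" unfolding H_def by (intro convex_connected convex_halfspace_Re_gt)
  ultimately have "phase ` XR = {} \<or> phase ` XR = H" using op unfolding connected_clopen by (elim allE) (erule mp, rule conjI)
  moreover have "Complex 1 1 \<in> XR" by (simp add: XR_def eye_exterior_def)
  ultimately have "phase ` XR = H" by blast
  then have "Z \<in> phase ` XR" using Z by (simp add: H_def)
  then show ?thesis by (auto simp: XR_def)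
qed

section \<open>The phase as a conformal coordinate\<close>

text \<open>
  On the upper imaginary ray \<open>y\<close> corresponds to the coordinate \<open>- \<i> * \<theta>\<close> with \<open>\<theta> = arcsin (1 / (2 * Im y))\<close>.
\<close>
lemma phase_on_axis:
  assumes "0 < \<theta>" "\<theta> < pi / 2"
  defines "y \<equiv> \<i> / of_real (2 * sin \<theta>)"
  shows "y \<in> eye_exterior" "Re y = 0" "phase y = \<i> * of_real (2 * (cos \<theta> / sin \<theta> + \<theta>))"
proof -
  have s: "0 < sin \<theta>" "sin \<theta> < 1" and c: "0 < cos \<theta>"
    using sin_gt_zero_02[of \<theta>] assms sin_gt_zero[of \<theta>] cos_gt_zero_pi[of \<theta>] sin_monotone_2pi[of \<theta> "pi / 2"] by auto
  have im: "Im y = 1 / (2 * sin \<theta>)" by (simp add: y_def)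
  have "1 / 2 < Im y" unfolding im using s by (simp add: field_simps)
  then show X: "y \<in> eye_exterior" by (simp add: eye_exterior_def)
  show "Re y = 0" by (simp add: y_def)
  have cut: "y \<notin> branch_cut" using eye_exterior_notin_branch_cut[OF X] .
  have sc: "(complex_of_real (cos \<theta>))\<^sup>2 = 1 - (complex_of_real (sin \<theta>))\<^sup>2"
    by (metis cos_squared_eq of_real_1 of_real_diff of_real_power)
  have "1 / (4 * y\<^sup>2) + 1 = (complex_of_real (cos \<theta>))\<^sup>2"
    using s unfolding sc y_def by (simp add: power_divide power_mult_distrib field_simps)
  then have rb: "root_branch y = of_real (cos \<theta>)"
    unfolding root_branch_def using c by (simp add: csqrt_square)
  have "1 / (2 * y) = - \<i> * of_real (sin \<theta>)" using s by (simp add: y_def field_simps)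
  then have e: "root_branch y + 1 / (2 * y) = exp (- (\<i> * of_real \<theta>))"
    unfolding rb by (simp add: exp_eq_polar complex_eq_iff exp_Euler cis.ctr Re_exp Im_exp)
  have a: "arsinh_coord y = - (\<i> * of_real \<theta>)" unfolding arsinh_coord_def e
    using assms by (intro Ln_exp) auto
  show "phase y = \<i> * of_real (2 * (cos \<theta> / sin \<theta> + \<theta>))"
  proof -
    have "phase y = 4 * y * of_real (cos \<theta>) + 2 * (\<i> * of_real \<theta>)" unfolding phase_def a rb by simp
    also have "\<dots> = \<i> * of_real (2 * (cos \<theta> / sin \<theta> + \<theta>))"
      unfolding y_def using s by (simp add: field_simps)
    finally show ?thesis .
  qed
qed

text \<open>
  This is \<open>tan t > t\<close> at \<open>t = pi / 2 - \<theta>\<close>.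
\<close>
lemma cot_plus_gt:
  assumes "0 < \<theta>" "\<theta> < pi / 2" shows "2 * (cos \<theta> / sin \<theta> + \<theta>) > pi"
proof -
  have "pi / 2 - \<theta> < tan (pi / 2 - \<theta>)" using assms by (intro less_tan_self) auto
  also have "\<dots> = cos \<theta> / sin \<theta>" by (simp add: tan_def sin_cos_eq[symmetric] cos_sin_eq[symmetric] sin_diff cos_diff)
  finally show ?thesis by (simp add: field_simps)
qed

lemma axis_parametrization:
  assumes "Re y = 0" "Im y > 1 / 2"
  obtains \<theta> where "0 < \<theta>" "\<theta> < pi / 2" "y = \<i> / of_real (2 * sin \<theta>)"
proof
  define s where "s = 1 / (2 * Im y)"
  have s: "0 < s" "s < 1" using assms(2) by (auto simp: s_def field_simps)
  show "0 < arcsin s" using s arcsin_less_arcsin[of 0 s] by simp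
  show "arcsin s < pi / 2" using s arcsin_less_arcsin[of s 1] by simp
  have "sin (arcsin s) = s" using s by simp
  then show "y = \<i> / of_real (2 * sin (arcsin s))" using assms by (simp add: s_def complex_eq_iff)
qed

lemma Im_phase_axis_gt:
  assumes "Re y = 0" "Im y > 1 / 2" shows "Im (phase y) > pi"
proof -
  obtain \<theta> where t: "0 < \<theta>" "\<theta> < pi / 2" "y = \<i> / of_real (2 * sin \<theta>)"
    using axis_parametrization[OF assms] .
  show ?thesis using phase_on_axis(3)[OF t(1,2)] cot_plus_gt[OF t(1,2)] unfolding t(3) by simp
qed

text \<open>
  The image of the eye's boundary: both arcs collapse onto the segment from \<open>- \<i> * pi\<close> to \<open>\<i> * pi\<close>, one to each side.
\<close>
definition phase_segment :: "complex set" where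
  "phase_segment = {Z. Re Z = 0 \<and> \<bar>Im Z\<bar> \<le> pi}"

text \<open>
  The right and the left half of the exterior cover the open half-planes, and the two imaginary rays cover the rest of the
  imaginary axis, by the intermediate value theorem for \<open>2 * (cot \<theta> + \<theta>)\<close>.
\<close>
lemma phase_image: "phase ` eye_exterior = - phase_segment"
proof (intro equalityI subsetI)
  fix Z assume "Z \<in> phase ` eye_exterior"
  then obtain y where y: "y \<in> eye_exterior" "Z = phase y" by blast
  from y(1) show "Z \<in> - phase_segment"
  proof (cases rule: eye_exterior_cases)
    case axis
    have "\<bar>Im (phase y)\<bar> > pi"
    proof (cases "Im y > 0")
      case True then show ?thesis using Im_phase_axis_gt[of y] axis by auto
    next
      case False
      then have "Im (phase (- y)) > pi" using Im_phase_axis_gt[of "- y"] axis by auto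
      then show ?thesis using phase_minus[OF eye_exterior_notin_branch_cut[OF y(1)]] by simp
    qed
    then show ?thesis by (simp add: phase_segment_def y(2))
  qed (auto simp: phase_segment_def y(2))
next
  fix Z assume Z: "Z \<in> - phase_segment"
  have neg: "Z \<in> phase ` eye_exterior" if "- Z \<in> phase ` eye_exterior"
  proof -
    obtain y where y: "y \<in> eye_exterior" "- Z = phase y" using \<open>- Z \<in> phase ` eye_exterior\<close> by blast
    then have "Z = phase (- y)" using phase_minus[OF eye_exterior_notin_branch_cut[OF y(1)]] by (metis minus_minus)
    then show ?thesis using y(1) eye_exterior_minus by blast
  qed
  have pos: "Z \<in> phase ` eye_exterior" if "Re Z = 0" "Im Z > pi" for Z
  proof -
    define f where "f \<theta> = 2 * (cos \<theta> / sin \<theta> + \<theta>)" for \<theta> :: real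
    \<comment> \<open>at \<open>t0\<close> the first term \<open>2 * cot t0\<close> alone equals \<open>Im Z\<close>\<close>
    define t0 where "t0 = arctan (2 / Im Z)"
    have "0 < 2 / Im Z" using that pi_gt_zero by (intro divide_pos_pos) linarith+
    then have t0: "0 < t0" "t0 < pi / 2" using arctan_ubound[of "2 / Im Z"] unfolding t0_def zero_less_arctan_iff by blast+
    have "tan t0 = 2 / Im Z" by (simp add: t0_def tan_arctan)
    then have ct: "cos t0 / sin t0 = Im Z / 2" 
    proof -
      have "cos t0 / sin t0 = inverse (tan t0)" by (simp add: tan_def)
      then show ?thesis by (simp add: \<open>tan t0 = 2 / Im Z\<close>)
    qed
    have f0: "f t0 \<ge> Im Z" unfolding f_def ct using t0 by simp
    have f1: "f (pi / 2) \<le> Im Z" using that by (simp add: f_def)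
    have "\<exists>x\<ge>t0. x \<le> pi / 2 \<and> f x = Im Z"
    proof (rule IVT2)
      show "\<forall>x. t0 \<le> x \<and> x \<le> pi / 2 \<longrightarrow> isCont f x"
      proof (intro allI impI)
        fix x assume x: "t0 \<le> x \<and> x \<le> pi / 2"
        then have "sin x > 0" using t0 by (intro sin_gt_zero) auto
        then show "isCont f x" unfolding f_def by (intro continuous_intros) auto
      qed
    qed (use f0 f1 t0 in auto)
    then obtain x where x: "t0 \<le> x" "x \<le> pi / 2" "f x = Im Z" by blast
    have "f (pi / 2) \<noteq> Im Z" using that by (simp add: f_def)
    then have "x \<noteq> pi / 2" using x(3) by metis
    then have x': "0 < x" "x < pi / 2" using x t0 by auto
    have "phase (\<i> / of_real (2 * sin x)) = Z"
      unfolding phase_on_axis(3)[OF x'] using x(3) that by (simp add: f_def complex_eq_iff)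
    then show ?thesis using phase_on_axis(1)[OF x'] by blast
  qed
  consider "Re Z > 0" | "Re (- Z) > 0" | "Re Z = 0" "Im Z > pi" | "Re (- Z) = 0" "Im (- Z) > pi"
  proof -
    assume a: "Re Z > 0 \<Longrightarrow> thesis" "Re (- Z) > 0 \<Longrightarrow> thesis" "Re Z = 0 \<Longrightarrow> Im Z > pi \<Longrightarrow> thesis"
      "Re (- Z) = 0 \<Longrightarrow> Im (- Z) > pi \<Longrightarrow> thesis"
    have "Re Z > 0 \<or> Re (- Z) > 0 \<or> (Re Z = 0 \<and> Im Z > pi) \<or> (Re (- Z) = 0 \<and> Im (- Z) > pi)"
      using Z unfolding phase_segment_def Compl_iff mem_Collect_eq uminus_complex.sel by argo
    then show thesis using a by blast
  qed
  then show "Z \<in> phase ` eye_exterior"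
  proof cases
    case 1 then show ?thesis using phase_image_right[of Z] by blast
  next
    case 2
    then obtain y where "y \<in> eye_exterior" "phase y = - Z" using phase_image_right by blast
    then show ?thesis by (intro neg) (metis imageI)
  next
    case 3 then show ?thesis by (rule pos)
  next
    case 4 then show ?thesis by (intro neg pos)
  qed
qed

text \<open>
  The sign of the real part, or of the imaginary part if the real part vanishes, tells on which of four convex sets
  \<open>y\<close> lies, and on each of them the phase is injective by \<open>phase_difference\<close>.
\<close>
lemma inj_on_phase: "inj_on phase eye_exterior"
proof (rule inj_onI, rule ccontr)
  fix y1 y2 assume *: "y1 \<in> eye_exterior" "y2 \<in> eye_exterior" "phase y1 = phase y2" "y1 \<noteq> y2"
  have no: "\<not> closed_segment y1 y2 \<subseteq> - branch_cut"
    using phase_difference[of y1 y2] * by auto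
  have half: "\<not> closed_segment y1 y2 \<subseteq> S" if "S \<inter> branch_cut = {}" for S using no that by blast
  have conv: False if "convex S" "S \<inter> branch_cut = {}" "y1 \<in> S" "y2 \<in> S" for S
    using half[OF that(2)] closed_segment_subset[OF that(3,4,1)] by blast
  have cR: "{y. Re y > 0} \<inter> branch_cut = {}" "{y. Re y < 0} \<inter> branch_cut = {}"
     "{y. Im y > 1 / 2} \<inter> branch_cut = {}" "{y. Im y < - 1 / 2} \<inter> branch_cut = {}"
    by (auto simp: branch_cut_iff)
  show False using *(1)
  proof (cases rule: eye_exterior_cases)
    case right
    have "Re y2 > 0" using *(2) right *(3) by (cases rule: eye_exterior_cases) auto
    then show False using conv[OF convex_halfspace_Re_gt cR(1)] right by simp
  next
    case left
    have "Re y2 < 0" using *(2) left *(3) by (cases rule: eye_exterior_cases) auto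
    then show False using conv[OF convex_halfspace_Re_lt cR(2)] left by simp
  next
    case axis
    have 2: "Re y2 = 0" "1 / 2 < \<bar>Im y2\<bar>" using *(2) axis *(3) by (cases rule: eye_exterior_cases; simp)+
    have neg: "Im (phase y) < - pi" if "y \<in> eye_exterior" "Re y = 0" "Im y < - 1 / 2" for y
      using Im_phase_axis_gt[of "- y"] that phase_minus[OF eye_exterior_notin_branch_cut[OF that(1)]] by simp
    consider "Im y1 > 1 / 2" "Im y2 > 1 / 2" | "Im y1 < - 1 / 2" "Im y2 < - 1 / 2"
      | "Im y1 > 1 / 2" "Im y2 < - 1 / 2" | "Im y1 < - 1 / 2" "Im y2 > 1 / 2"
      using axis 2 by linarith
    then show False
    proof cases
      case 1 then show False using conv[OF convex_halfspace_Im_gt cR(3)] by simp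
    next
      case 2 then show False using conv[OF convex_halfspace_Im_lt cR(4)] by simp
    next
      case 3 then show False using Im_phase_axis_gt[of y1] neg[of y2] axis 2 * pi_gt_zero by auto
    next
      case 4 then show False using Im_phase_axis_gt[of y2] neg[of y1] axis 2 * pi_gt_zero by auto
    qed
  qed
qed

definition phase_inv :: "complex \<Rightarrow> complex" where
  "phase_inv = inv_into eye_exterior phase"

lemma phase_inv_phase: "y \<in> eye_exterior \<Longrightarrow> phase_inv (phase y) = y"
  unfolding phase_inv_def by (rule inv_into_f_f[OF inj_on_phase])

lemma phase_inv_in: "Z \<notin> phase_segment \<Longrightarrow> phase_inv Z \<in> eye_exterior"
  and phase_phase_inv: "Z \<notin> phase_segment \<Longrightarrow> phase (phase_inv Z) = Z"
  unfolding phase_inv_def by (metis Compl_iff inv_into_into phase_image, metis Compl_iff f_inv_into_f phase_image)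

lemma phase_notin_segment: "y \<in> eye_exterior \<Longrightarrow> phase y \<notin> phase_segment"
  using phase_image by blast

lemma phase_inv_has_derivative:
  assumes "Z \<notin> phase_segment"
  shows "(phase_inv has_field_derivative 1 / (4 * root_branch (phase_inv Z))) (at Z)"
proof -
  have sub: "eye_exterior \<subseteq> - branch_cut" using eye_exterior_notin_branch_cut by blast
  obtain g where g: "g holomorphic_on (phase ` eye_exterior)"
      "\<And>y. y \<in> eye_exterior \<Longrightarrow> deriv phase y * deriv g (phase y) = 1"
      "\<And>y. y \<in> eye_exterior \<Longrightarrow> g (phase y) = y"
    by (rule holomorphic_has_inverse[OF holomorphic_on_subset[OF holomorphic_phase sub] open_eye_exterior inj_on_phase], rule that)
  let ?y = "phase_inv Z"
  have y: "?y \<in> eye_exterior" "phase ?y = Z" using phase_inv_in phase_phase_inv assms by blast+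
  have o: "open (phase ` eye_exterior)"
    by (rule open_mapping_thm3[OF holomorphic_on_subset[OF holomorphic_phase sub] open_eye_exterior inj_on_phase])
  have "(g has_field_derivative deriv g Z) (at Z)"
    using holomorphic_derivI[OF g(1) o] y by (metis imageI)
  moreover have "deriv phase ?y = 4 * root_branch ?y"
    using phase_has_derivative[of ?y] y(1) sub by (intro DERIV_imp_deriv) auto
  then have "deriv g Z = 1 / (4 * root_branch ?y)"
    using g(2)[OF y(1)] y(2) by (metis mult_zero_left nonzero_eq_divide_eq mult.commute zero_neq_one)
  ultimately have "(g has_field_derivative 1 / (4 * root_branch ?y)) (at Z)" by simp
  then show ?thesis
  proof (rule has_field_derivative_transform_within_open[OF _ o])
    show "Z \<in> phase ` eye_exterior" using y by (metis imageI)
  qed (auto simp: g(3) phase_inv_phase)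
qed

lemma phase_inv_norm_ge:
  assumes "Z \<notin> phase_segment" shows "norm (phase_inv Z) \<ge> (norm Z - 12) / 4"
  using eye_exterior_norm_phase_le[OF phase_inv_in[OF assms]] unfolding phase_phase_inv[OF assms] by simp

section \<open>The eye is the complement of the exterior\<close>

lemma i_p_PIII:
  assumes "y \<notin> branch_cut" shows "\<i> * p_PIII y = exp (- arsinh_coord y)"
  unfolding exp_minus_arsinh_coord[OF assms] p_PIII_def root_branch_def[symmetric]
  by (simp add: algebra_simps)

text \<open>
  With \<open>p = - \<i> * exp (- a)\<close> one has \<open>- \<i> * y * (p - 1 / p) = - 2 * y * cosh a\<close> and \<open>ln (norm p) = - Re a\<close>.
\<close>
lemma Re_V_PIII:
  assumes "y \<notin> branch_cut" shows "Re (V_PIII (p_PIII y) y) = - Re (phase y) / 2"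
proof -
  let ?a = "arsinh_coord y"
  have p: "p_PIII y = - \<i> * exp (- ?a)" unfolding i_p_PIII[OF assms, symmetric] by simp
  have ip: "inverse (p_PIII y) = \<i> * exp ?a" 
  proof (rule inverse_unique)
    have "(- \<i> * E) * (\<i> * F) = F * E" for E F :: complex by (simp add: complex_eq_iff algebra_simps)
    then show "p_PIII y * (\<i> * exp ?a) = 1" unfolding p by (simp only: exp_minus_inverse)
  qed
  have "p_PIII y - inverse (p_PIII y) = - 2 * \<i> * root_branch y"
    unfolding ip unfolding p cosh_arsinh_coord[OF assms, symmetric] cosh_field_def by (simp add: algebra_simps)
  then have e: "- \<i> * y * (p_PIII y - inverse (p_PIII y)) = - 2 * (y * root_branch y)" by simp
  have "Re (Ln (p_PIII y)) = ln (norm (p_PIII y))" unfolding p by (intro Re_Ln) auto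
  also have "norm (p_PIII y) = exp (- Re ?a)" unfolding p by (simp add: norm_mult)
  finally have l: "Re (Ln (p_PIII y)) = - Re ?a" by simp
  have "Re (2 * w) = 2 * Re w" for w by simp
  have "V_PIII (p_PIII y) y = - Ln (p_PIII y) + - \<i> * y * (p_PIII y - inverse (p_PIII y))"
    unfolding V_PIII_def by simp
  then have "V_PIII (p_PIII y) y = - Ln (p_PIII y) + - 2 * (y * root_branch y)"
    unfolding e .
  then have "Re (V_PIII (p_PIII y) y) = Re ?a - 2 * Re (y * root_branch y)" using l by simp
  moreover have "Re (phase y) = 4 * Re (y * root_branch y) - 2 * Re ?a" unfolding phase_def mult.assoc by simp
  ultimately show ?thesis by simp
qed

lemma eye_boundary_iff:
  "y \<in> eye_boundary \<longleftrightarrow> (Re y \<noteq> 0 \<and> Re (phase y) = 0) \<or> y = \<i> / 2 \<or> y = - \<i> / 2"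
proof -
  have "y \<in> V_zero_set \<longleftrightarrow> Re (phase y) = 0" if "Re y \<noteq> 0"
    using Re_V_PIII[OF Re_nonzero_notin_branch_cut[OF that]] Re_nonzero_notin_branch_cut[OF that]
    by (simp add: V_zero_set_def)
  then show ?thesis unfolding eye_boundary_def by (cases "Re y = 0") (auto simp: neq_iff)
qed

text \<open>
  The open branch cut lies in the interior of the eye. A sequence in the exterior that converges to a point of it
  may be reflected into the right half-plane; in the strip it then accumulates at a point \<open>a\<close> with \<open>sinh a\<close> imaginary
  and \<open>norm (sinh a) > 1\<close>, hence on a boundary line and off the imaginary axis, where the limit of the phase has
  negative real part.
\<close>
lemma axis_notin_closure_eye_exterior:
  assumes "Re y = 0" "\<bar>Im y\<bar> < 1 / 2" shows "y \<notin> closure eye_exterior"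
proof
  assume "y \<in> closure eye_exterior"
  then obtain f where f: "\<And>k. f k \<in> eye_exterior" "f \<longlonglongrightarrow> y" unfolding closure_sequential by blast
  have "(\<lambda>k. \<bar>Im (f k)\<bar>) \<longlonglongrightarrow> \<bar>Im y\<bar>" by (intro tendsto_intros f)
  then have "\<forall>\<^sub>F k in sequentially. \<bar>Im (f k)\<bar> < 1 / 2" using assms(2) by (rule order_tendstoD)
  then obtain N where N: "\<And>k. k \<ge> N \<Longrightarrow> \<bar>Im (f k)\<bar> < 1 / 2" by (auto simp: eventually_sequentially)
  have nz: "Re (f (k + N)) \<noteq> 0" for k
    using f(1)[of "k + N"] N[of "k + N"] by (cases rule: eye_exterior_cases) auto
  \<comment> \<open>reflect into the right half-plane; real and imaginary parts keep their absolute values\<close>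
  define g where "g k = (if Re (f (k + N)) > 0 then f (k + N) else - f (k + N))" for k
  have gE: "\<And>k. g k \<in> eye_exterior" and gR: "\<And>k. Re (g k) > 0"
    using f(1) nz by (auto simp: g_def neq_iff)
  have fN: "(\<lambda>k. f (k + N)) \<longlonglongrightarrow> y" using f(2) by (rule LIMSEQ_ignore_initial_segment)
  then have "Bseq (\<lambda>k. f (k + N))" by (intro convergent_imp_Bseq convergentI)
  then obtain C where C: "\<And>k. norm (f (k + N)) \<le> C" unfolding Bseq_def by blast
  have gB: "\<And>k. norm (g k) \<le> C" using C by (simp add: g_def)
  obtain a r where ar: "strict_mono r" "0 \<le> Re a" "\<bar>Im a\<bar> \<le> pi / 2" "sinh a \<noteq> 0"
      "(g \<circ> r) \<longlonglongrightarrow> 1 / (2 * sinh a)" "(phase \<circ> g \<circ> r) \<longlonglongrightarrow> 2 * (cosh a / sinh a - a)"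
    by (rule eye_exterior_right_limit[OF gE gR gB], rule that)
  define y0 where "y0 = 1 / (2 * sinh a)"
  have "(\<lambda>k. \<bar>Re (g k)\<bar>) \<longlonglongrightarrow> \<bar>Re y\<bar>" "(\<lambda>k. \<bar>Im (g k)\<bar>) \<longlonglongrightarrow> \<bar>Im y\<bar>"
  proof -
    have "\<bar>Re (g k)\<bar> = \<bar>Re (f (k + N))\<bar>" "\<bar>Im (g k)\<bar> = \<bar>Im (f (k + N))\<bar>" for k by (auto simp: g_def)
    then show "(\<lambda>k. \<bar>Re (g k)\<bar>) \<longlonglongrightarrow> \<bar>Re y\<bar>" "(\<lambda>k. \<bar>Im (g k)\<bar>) \<longlonglongrightarrow> \<bar>Im y\<bar>"
      by (simp_all only:) (intro tendsto_intros fN)+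
  qed
  then have "(\<lambda>k. \<bar>Re (g (r k))\<bar>) \<longlonglongrightarrow> \<bar>Re y\<bar>" "(\<lambda>k. \<bar>Im (g (r k))\<bar>) \<longlonglongrightarrow> \<bar>Im y\<bar>"
    using LIMSEQ_subseq_LIMSEQ[OF _ ar(1)] by (auto simp: o_def)
  moreover have gl: "(\<lambda>k. g (r k)) \<longlonglongrightarrow> y0" using ar(5) by (simp add: o_def y0_def)
  have "(\<lambda>k. \<bar>Re (g (r k))\<bar>) \<longlonglongrightarrow> \<bar>Re y0\<bar>" "(\<lambda>k. \<bar>Im (g (r k))\<bar>) \<longlonglongrightarrow> \<bar>Im y0\<bar>"
    by (intro tendsto_intros gl)+
  ultimately have y0: "Re y0 = 0" "\<bar>Im y0\<bar> < 1 / 2"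
    using LIMSEQ_unique assms by fastforce+
  have "norm y0 = \<bar>Im y0\<bar>" using y0(1) by (simp add: cmod_def)
  then have "norm y0 < 1 / 2" using y0(2) by simp
  moreover have "norm y0 * (2 * norm (sinh a)) = 1" using ar(4) by (simp add: y0_def norm_divide norm_mult)
  ultimately have big: "norm (sinh a) > 1"
  proof -
    assume *: "norm y0 < 1 / 2" "norm y0 * (2 * norm (sinh a)) = 1"
    have "norm y0 * (2 * norm (sinh a)) < 1 / 2 * (2 * norm (sinh a))" using * ar(4) by (intro mult_strict_right_mono) auto
    then show ?thesis using * by simp
  qed
  have "2 * sinh a = 1 / y0" by (simp add: y0_def)
  then have "Re (2 * sinh a) = Re (1 / y0)" by (rule arg_cong)
  also have "\<dots> = 0" using y0(1) unfolding Re_divide by simp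
  finally have rs: "sinh (Re a) * cos (Im a) = 0" by (simp flip: Re_sinh)
  have n2: "(norm (sinh a))\<^sup>2 = (cosh (Re a) * sin (Im a))\<^sup>2" unfolding cmod_power2 Re_sinh rs Im_sinh by simp
  have a0: "Re a \<noteq> 0"
  proof
    assume "Re a = 0"
    then have "(norm (sinh a))\<^sup>2 \<le> 1" unfolding n2 by (simp add: abs_square_le_1)
    then show False using big by (simp add: power_le_one_iff)
  qed
  then have "cos (Im a) = 0" using rs by simp
  then have "\<not> \<bar>Im a\<bar> < pi / 2" using cos_gt_zero_pi[of "Im a"] unfolding abs_less_iff by linarith
  then have "\<bar>Im a\<bar> = pi / 2" using ar(3) by linarith
  then have "Re (cosh a / sinh a - a) < 0" using Re_coth_boundary(2)[of a] ar a0 by blast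
  moreover have "Re (2 * (cosh a / sinh a - a)) \<ge> 0"
  proof (rule tendsto_lowerbound)
    show "(\<lambda>k. Re (phase (g (r k)))) \<longlonglongrightarrow> Re (2 * (cosh a / sinh a - a))"
      using ar(6) by (intro tendsto_intros) (simp add: o_def)
    have "Re (phase (g k)) \<ge> 0" for k using gE[of k] gR[of k] by (cases rule: eye_exterior_cases) auto
    then show "\<forall>\<^sub>F k in sequentially. 0 \<le> Re (phase (g (r k)))" by simp
  qed simp
  moreover have "Re (2 * w) = 2 * Re w" for w by simp
  ultimately show False by (metis linorder_not_less mult_less_0_iff zero_less_numeral)
qed

lemma closure_eye_exterior_minus: "- y \<in> closure eye_exterior \<longleftrightarrow> y \<in> closure eye_exterior"
proof -
  have "- y \<in> closure eye_exterior" if "y \<in> closure eye_exterior" for y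
  proof -
    obtain f where f: "\<And>k. f k \<in> eye_exterior" "f \<longlonglongrightarrow> y" using \<open>y \<in> closure eye_exterior\<close> unfolding closure_sequential by blast
    then have "(\<lambda>k. - f k) \<longlonglongrightarrow> - y" "\<And>k. - f k \<in> eye_exterior" by (auto intro: tendsto_intros)
    then show ?thesis unfolding closure_sequential by (intro exI[of _ "\<lambda>k. - f k"] conjI allI)
  qed
  from this[of y] this[of "- y"] show ?thesis by auto
qed

text \<open>
  On the arcs, scaling by \<open>t > 1\<close> leads into the exterior, so these points are limits of exterior points;
  conversely a limit with \<open>Re y > 0\<close> outside the exterior has \<open>Re (phase y) = 0\<close> by continuity.
\<close>
lemma frontier_eye_exterior: "frontier eye_exterior = eye_boundary"
proof -
  have fr: "frontier eye_exterior = closure eye_exterior - eye_exterior"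
    using open_eye_exterior by (simp add: frontier_def interior_open)
  have 1: "Re (phase y) = 0" if y: "y \<in> closure eye_exterior" "y \<notin> eye_exterior" "Re y > 0" for y
  proof -
    obtain f where f: "\<And>k. f k \<in> eye_exterior" "f \<longlonglongrightarrow> y" using y(1) unfolding closure_sequential by blast
    have cut: "y \<notin> branch_cut" using y(3) by (intro Re_nonzero_notin_branch_cut) auto
    have "(\<lambda>k. Re (f k)) \<longlonglongrightarrow> Re y" by (intro tendsto_intros f)
    then have ev: "\<forall>\<^sub>F k in sequentially. Re (f k) > 0" using y(3) by (rule order_tendstoD)
    have "isCont phase y" using phase_has_derivative[OF cut] DERIV_isCont by blast
    then have "(\<lambda>k. Re (phase (f k))) \<longlonglongrightarrow> Re (phase y)"
      using isCont_tendsto_compose f(2) by (intro tendsto_intros)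
    moreover have "\<forall>\<^sub>F k in sequentially. 0 \<le> Re (phase (f k))"
      using ev
    proof eventually_elim
      case (elim k) show ?case using f(1)[of k] elim by (cases rule: eye_exterior_cases) auto
    qed
    ultimately have "0 \<le> Re (phase y)" by (rule tendsto_lowerbound) simp
    then show ?thesis using y by (auto simp: eye_exterior_def)
  qed
  have 2: "y \<in> closure eye_exterior" if "\<And>t. 1 < t \<Longrightarrow> of_real t * y \<in> eye_exterior" for y
  proof -
    have "(\<lambda>k. of_real (1 + inverse (real (Suc k))) * y) \<longlonglongrightarrow> of_real (1 + 0) * y"
      by (intro tendsto_intros LIMSEQ_inverse_real_of_nat)
    moreover have "of_real (1 + inverse (real (Suc k))) * y \<in> eye_exterior" for k
      by (rule that) simp
    ultimately show ?thesis unfolding closure_sequential by (intro exI conjI allI) auto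
  qed
  have 3: "y \<in> closure eye_exterior - eye_exterior" if y: "Re y > 0" "Re (phase y) = 0" for y
  proof
    show "y \<notin> eye_exterior"
    proof
      assume "y \<in> eye_exterior" then show False using y by (cases rule: eye_exterior_cases) auto
    qed
    show "y \<in> closure eye_exterior"
    proof (rule 2)
      fix t :: real assume "1 < t"
      then show "of_real t * y \<in> eye_exterior" using Re_phase_increasing_on_rays[OF y(1), of t] y
        by (auto simp: eye_exterior_def)
    qed
  qed
  have 4: "\<i> / 2 \<in> closure eye_exterior - eye_exterior"
    by (intro DiffI 2) (auto simp: eye_exterior_def)
  show ?thesis unfolding fr
  proof (intro equalityI subsetI)
    fix y assume y: "y \<in> closure eye_exterior - eye_exterior"
    consider "Re y > 0" | "Re y < 0" | "Re y = 0" by linarith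
    then show "y \<in> eye_boundary"
    proof cases
      case 1 then show ?thesis using \<open>\<And>y. \<lbrakk>y \<in> closure eye_exterior; y \<notin> eye_exterior; Re y > 0\<rbrakk> \<Longrightarrow> Re (phase y) = 0\<close>[of y] y
        by (simp add: eye_boundary_iff)
    next
      case 2
      then have "Re (phase (- y)) = 0" using 1[of "- y"] y closure_eye_exterior_minus by simp
      then show ?thesis using 2 phase_minus[OF Re_nonzero_notin_branch_cut[of y]] by (simp add: eye_boundary_iff)
    next
      case 3
      have "\<bar>Im y\<bar> \<le> 1 / 2" using y by (auto simp: eye_exterior_def)
      moreover have "\<not> \<bar>Im y\<bar> < 1 / 2" using axis_notin_closure_eye_exterior 3 y by blast
      ultimately have "Im y = 1 / 2 \<or> Im y = - 1 / 2" by linarith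
      then have "y = \<i> / 2 \<or> y = - \<i> / 2" using 3 by (auto simp: complex_eq_iff)
      then show ?thesis by (simp add: eye_boundary_iff)
    qed
  next
    fix y assume "y \<in> eye_boundary"
    then consider "Re y > 0" "Re (phase y) = 0" | "Re y < 0" "Re (phase y) = 0" | "y = \<i> / 2" | "y = - (\<i> / 2)"
      by (auto simp: eye_boundary_iff neq_iff)
    then show "y \<in> closure eye_exterior - eye_exterior"
    proof cases
      case 1 then show ?thesis by (rule 3)
    next
      case 2
      then have "Re (phase (- y)) = 0" using phase_minus[OF Re_nonzero_notin_branch_cut[of y]] by simp
      then have "- y \<in> closure eye_exterior - eye_exterior" using 2 by (intro 3) auto
      then show ?thesis using closure_eye_exterior_minus[of y] by simp
    next
      case 3 show ?thesis unfolding 3 by (rule 4)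
    next
      case 4 show ?thesis unfolding 4 using \<open>\<i> / 2 \<in> closure eye_exterior - eye_exterior\<close>
        unfolding Diff_iff closure_eye_exterior_minus eye_exterior_minus .
    qed
  qed
qed

text \<open>
  For large \<open>y\<close> the product \<open>y * root_branch y\<close> is close to \<open>y\<close>, so \<open>Re (phase y)\<close> is positive once \<open>Re y > 3\<close>.
\<close>
lemma notin_eye_exterior_bound:
  assumes "y \<notin> eye_exterior" shows "norm y \<le> 4"
proof -
  have im: "\<bar>Im y\<bar> \<le> 1 / 2" using assms by (auto simp: eye_exterior_def)
  have R: "Re y \<le> 3" if "y \<notin> eye_exterior" for y
  proof (rule ccontr)
    assume "\<not> Re y \<le> 3"
    then have re: "Re y > 3" by simp
    have n: "norm y \<ge> 1" using re complex_Re_le_cmod[of y] by linarith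
    have cut: "y \<notin> branch_cut" using re by (intro Re_nonzero_notin_branch_cut) auto
    have y0: "y \<noteq> 0" using n by auto
    let ?s = "root_branch y"
    have "norm (?s + 1) \<ge> 1" using Re_root_branch_pos[OF cut] complex_Re_le_cmod[of "?s + 1"] by simp
    have "(y * ?s - y) * (?s + 1) = y * ((?s)\<^sup>2 - 1)" by (simp add: algebra_simps power2_eq_square)
    also have "\<dots> = 1 / (4 * y)" unfolding root_branch_squared[OF cut] using y0 by (simp add: power2_eq_square)
    finally have "norm (y * ?s - y) * norm (?s + 1) = 1 / (4 * norm y)" by (metis norm_divide norm_mult norm_numeral norm_one)
    also have "\<dots> \<le> 1" using n by (intro divide_le_eq_1_pos[THEN iffD2]) auto
    finally have "norm (y * ?s - y) * norm (?s + 1) \<le> 1" .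
    moreover have "norm (y * ?s - y) * 1 \<le> norm (y * ?s - y) * norm (?s + 1)"
      using \<open>norm (?s + 1) \<ge> 1\<close> by (intro mult_left_mono) auto
    ultimately have "norm (y * ?s - y) \<le> 1" by linarith
    then have "Re (y * ?s) \<ge> Re y - 1" using abs_Re_le_cmod[of "y * ?s - y"] by simp
    moreover have "Re (arsinh_coord y) \<le> 4"
      using phase_large(3)[OF n] complex_Re_le_cmod[of "arsinh_coord y"] by linarith
    moreover have "Re (phase y) = 4 * Re (y * ?s) - 2 * Re (arsinh_coord y)" unfolding phase_def mult.assoc by simp
    ultimately have "Re (phase y) > 0" using re by linarith
    then show False using that re by (simp add: eye_exterior_def)
  qed
  have "\<bar>Re y\<bar> \<le> 3" using R[OF assms] R[of "- y"] assms by simp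
  then show ?thesis using im cmod_le[of y] by linarith
qed

lemma zero_in_interior_eye: "0 \<in> interior (- eye_exterior)"
proof -
  have "ball 0 (1 / (2 * cosh 2)) \<subseteq> - eye_exterior" using eye_exterior_norm_ge by fastforce
  then show ?thesis by (intro interiorI[of "ball 0 (1 / (2 * cosh 2))"]) auto
qed

lemma Compl_eye_exterior_scaling:
  assumes "y \<notin> eye_exterior" "0 \<le> t" "t \<le> 1" shows "of_real t * y \<notin> eye_exterior"
proof (cases "t = 0")
  case True then show ?thesis using zero_in_interior_eye interior_subset by auto
next
  case False
  show ?thesis
  proof
    assume "of_real t * y \<in> eye_exterior"
    from eye_exterior_scaling[OF this, of "1 / t"] have "y \<in> eye_exterior" using False assms by (simp add: field_simps)
    then show False using assms by simp
  qed
qed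

text \<open>
  Every point is joined by a radial segment to the connected set \<open>norm y > 4\<close>.
\<close>
lemma connected_eye_exterior: "connected eye_exterior"
proof -
  define C where "C = - cball (0::complex) 4"
  have CX: "C \<subseteq> eye_exterior"
  proof
    fix y assume "y \<in> C"
    then have "\<not> norm y \<le> 4" by (simp add: C_def)
    then show "y \<in> eye_exterior" using notin_eye_exterior_bound[of y] by blast
  qed
  have cC: "connected C" unfolding C_def by (intro connected_complement_bounded_convex) auto
  define F where "F = (\<lambda>y. closed_segment y (of_real (1 + 5 / norm y) * y) \<union> C) ` eye_exterior"
  have seg: "closed_segment y (of_real (1 + 5 / norm y) * y) \<subseteq> eye_exterior" if "y \<in> eye_exterior" for y
  proof
    fix z assume "z \<in> closed_segment y (of_real (1 + 5 / norm y) * y)"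
    then obtain u where u: "0 \<le> u" "z = (1 - u) *\<^sub>R y + u *\<^sub>R (of_real (1 + 5 / norm y) * y)"
      by (auto simp: closed_segment_def)
    then have "z = of_real (1 + u * (5 / norm y)) * y" by (simp add: scaleR_conv_of_real algebra_simps)
    then show "z \<in> eye_exterior" using eye_exterior_scaling[OF that, of "1 + u * (5 / norm y)"] u by simp
  qed
  have conn: "connected (closed_segment y (of_real (1 + 5 / norm y) * y) \<union> C)" if "y \<in> eye_exterior" for y
  proof (rule connected_Un)
    have "y \<noteq> 0" using that zero_in_interior_eye interior_subset by auto
    have "norm (of_real (1 + 5 / norm y) * y) = (1 + 5 / norm y) * norm y"
      unfolding norm_mult norm_of_real by (subst abs_of_nonneg) auto
    also have "\<dots> = norm y + 5" using \<open>y \<noteq> 0\<close> by (simp add: field_simps)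
    finally have "norm (of_real (1 + 5 / norm y) * y) > 4" using norm_ge_zero[of y] by linarith
    then have "of_real (1 + 5 / norm y) * y \<in> C" by (simp add: C_def)
    then show "closed_segment y (of_real (1 + 5 / norm y) * y) \<inter> C \<noteq> {}" by blast
  qed (use cC in auto)
  have "connected (\<Union>F)"
  proof (rule connected_Union)
    show "connected S" if "S \<in> F" for S using that conn by (auto simp: F_def)
    have "C \<subseteq> \<Inter>F" by (auto simp: F_def)
    moreover have "5 \<in> C" by (simp add: C_def)
    ultimately show "\<Inter>F \<noteq> {}" by blast
  qed
  moreover have "\<Union>F = eye_exterior"
  proof
    show "\<Union>F \<subseteq> eye_exterior" using seg CX by (auto simp: F_def)
    show "eye_exterior \<subseteq> \<Union>F" by (auto simp: F_def)
  qed
  ultimately show ?thesis by simp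
qed

text \<open>
  A compact set with the prescribed frontier contains none of the connected unbounded set \<open>eye_exterior\<close>, and since it contains
  \<open>0\<close> it contains all of the interior of the complement, which is star-shaped about \<open>0\<close> and disjoint from the
  frontier.
\<close>
lemma eye_eq: "eye = - eye_exterior"
  unfolding eye_def
proof (rule the_equality)
  have frE: "frontier (- eye_exterior) = eye_boundary" using frontier_eye_exterior frontier_complement by metis
  have bd: "bounded (- eye_exterior)" using notin_eye_exterior_bound unfolding bounded_iff by auto
  have star: "closed_segment 0 y \<subseteq> - eye_exterior" if "y \<in> - eye_exterior" for y
    using Compl_eye_exterior_scaling[of y] that by (auto simp: closed_segment_def scaleR_conv_of_real)
  have z: "0 \<in> - eye_exterior" using zero_in_interior_eye interior_subset by blast
  have sl: "starlike (- eye_exterior)" unfolding starlike_def using star z by blast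
  show "compact (- eye_exterior) \<and> simply_connected (- eye_exterior) \<and> 0 \<in> - eye_exterior \<and> frontier (- eye_exterior) = eye_boundary"
    using bd open_eye_exterior starlike_imp_simply_connected[OF sl] z frE
    by (simp add: compact_eq_bounded_closed closed_open)
  fix E assume E: "compact E \<and> simply_connected E \<and> 0 \<in> E \<and> frontier E = eye_boundary"
  have "eye_exterior \<inter> frontier E = {}"
    using E frE open_eye_exterior by (metis frontier_eye_exterior frontier_def interior_open Diff_disjoint)
  then have "eye_exterior \<inter> E = {} \<or> eye_exterior - E = {}"
    using connected_Int_frontier[OF connected_eye_exterior, of E] by blast
  moreover have "\<not> eye_exterior \<subseteq> E"
  proof
    assume "eye_exterior \<subseteq> E"
    moreover have "bounded E" using E compact_imp_bounded by blast
    ultimately have "bounded (eye_exterior \<union> - eye_exterior)" using bd by (meson bounded_Un bounded_subset)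
    then show False by (simp add: not_bounded_UNIV)
  qed
  ultimately have 1: "E \<subseteq> - eye_exterior" by blast
  define N where "N = interior (- eye_exterior)"
  have "starlike N"
    unfolding starlike_def
  proof (intro bexI ballI subsetI)
    show "0 \<in> N" using zero_in_interior_eye by (simp add: N_def)
    fix y z assume y: "y \<in> N" and "z \<in> closed_segment 0 y"
    then obtain t where t: "0 \<le> t" "t \<le> 1" "z = of_real t * y" by (auto simp: closed_segment_def scaleR_conv_of_real)
    show "z \<in> N"
    proof (cases "t = 0")
      case True then show ?thesis using t zero_in_interior_eye by (simp add: N_def)
    next
      case False
      have "open ((*) (of_real t) ` N)"
        using open_scaling[of t N] False by (simp add: N_def scaleR_conv_of_real[abs_def])
      moreover have "(*) (of_real t) ` N \<subseteq> - eye_exterior"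
        using Compl_eye_exterior_scaling[OF _ t(1,2)] interior_subset[of "- eye_exterior"] by (auto simp: N_def)
      ultimately have "(*) (of_real t) ` N \<subseteq> N" unfolding N_def by (rule interior_maximal[rotated])
      then show ?thesis using y t(3) by blast
    qed
  qed
  then have "connected N" by (rule starlike_imp_connected)
  moreover have "N \<inter> frontier E = {}" using E frE by (auto simp: N_def frontier_def)
  moreover have "N \<inter> E \<noteq> {}" using E zero_in_interior_eye by (auto simp: N_def)
  ultimately have "N \<subseteq> E" using connected_Int_frontier[of N E] by blast
  moreover have "frontier (- eye_exterior) \<subseteq> E"
    using E frE frontier_subset_closed[OF compact_imp_closed] by metis
  moreover have "- eye_exterior \<subseteq> N \<union> frontier (- eye_exterior)"
    using closure_subset[of "- eye_exterior"] by (auto simp: N_def frontier_def)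
  ultimately show "E = - eye_exterior" using 1 by blast
qed

text \<open>
  By compactness near the eye, and by the growth of the phase far from it.
\<close>
lemma phase_separated_from_segment:
  assumes "0 < d"
  obtains \<eta> where "0 < \<eta>" "\<And>y Z. d \<le> infdist y eye \<Longrightarrow> Z \<in> phase_segment \<Longrightarrow> \<eta> \<le> dist (phase y) Z"
proof -
  define A where "A = cball 0 5 \<inter> {y. d \<le> infdist y eye}"
  have cl: "closed {y. d \<le> infdist y eye}" by (intro closed_Collect_le continuous_intros)
  have "compact A" unfolding A_def using cl by (intro compact_Int_closed) auto
  have AX: "A \<subseteq> eye_exterior"
  proof
    fix y assume "y \<in> A"
    then have "y \<notin> eye" using assms by (auto simp: A_def)
    then show "y \<in> eye_exterior" by (simp add: eye_eq)
  qed
  then have "A \<subseteq> - branch_cut" using eye_exterior_notin_branch_cut by blast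
  then have "continuous_on A phase"
    using holomorphic_on_imp_continuous_on[OF holomorphic_phase] continuous_on_subset by blast
  then have "compact (phase ` A)" using \<open>compact A\<close> by (rule compact_continuous_image)
  moreover have "closed phase_segment"
    unfolding phase_segment_def by (intro closed_Collect_conj closed_Collect_le closed_Collect_eq continuous_intros)
  moreover have "phase ` A \<inter> phase_segment = {}" using AX phase_notin_segment by blast
  ultimately obtain e where e: "e > 0" "\<forall>x\<in>phase ` A. \<forall>y\<in>phase_segment. e \<le> dist x y"
    using separate_compact_closed by metis
  have "min e 1 \<le> dist (phase y) Z" if y: "d \<le> infdist y eye" and Z: "Z \<in> phase_segment" for y Z
  proof (cases "y \<in> A")
    case True then show ?thesis using e Z by fastforce
  next
    case False
    then have "norm y > 5" using y by (simp add: A_def)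
    then have "norm (phase y) \<ge> 7" using phase_large(1)[of y] by linarith
    moreover have "norm Z \<le> 4" using Z cmod_le[of Z] pi_less_4 by (auto simp: phase_segment_def)
    ultimately show ?thesis using norm_triangle_ineq2[of "phase y" Z] by (simp add: dist_norm)
  qed
  then show ?thesis using that[of "min e 1"] e(1) by simp
qed

section \<open>The equation in the phase coordinate\<close>

text \<open>
  This is \<open>- tanh a\<close>, as a function of the phase. It satisfies an autonomous differential equation, and the
  coefficients of the equation for \<open>h\<close> are polynomials in it.
\<close>
definition tau :: "complex \<Rightarrow> complex" where
  "tau Z = - 1 / (2 * phase_inv Z * root_branch (phase_inv Z))"

definition coord :: "complex \<Rightarrow> complex" where
  "coord Z = arsinh_coord (phase_inv Z)"

lemma phase_inv_facts:
  assumes "Z \<notin> phase_segment"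
  shows "phase_inv Z \<notin> branch_cut" "phase_inv Z \<noteq> 0" "root_branch (phase_inv Z) \<noteq> 0" "tau Z \<noteq> 0"
    "(root_branch (phase_inv Z))\<^sup>2 = 1 / (4 * (phase_inv Z)\<^sup>2) + 1"
proof -
  show 1: "phase_inv Z \<notin> branch_cut" using eye_exterior_notin_branch_cut[OF phase_inv_in[OF assms]] .
  show 2: "phase_inv Z \<noteq> 0" using notin_branch_cut_nonzero[OF 1] .
  show 3: "root_branch (phase_inv Z) \<noteq> 0" using Re_root_branch_pos[OF 1] by auto
  show "tau Z \<noteq> 0" using 2 3 by (simp add: tau_def)
  show "(root_branch (phase_inv Z))\<^sup>2 = 1 / (4 * (phase_inv Z)\<^sup>2) + 1" by (rule root_branch_squared[OF 1])
qed

lemma tau_has_derivative: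
  assumes "Z \<notin> phase_segment"
  shows "(tau has_field_derivative (tau Z)\<^sup>2 * (1 - (tau Z)\<^sup>2) / 2) (at Z)"
proof -
  note f = phase_inv_facts[OF assms]
  let ?y = "phase_inv Z" and ?s = "root_branch (phase_inv Z)"
  have "((\<lambda>y. y * root_branch y) has_field_derivative ?s + (- 1 / (4 * ?y ^ 3 * ?s)) * ?y) (at ?y)"
    using DERIV_mult[OF DERIV_ident root_branch_has_derivative[OF f(1)]] by simp
  from DERIV_chain2[OF this phase_inv_has_derivative[OF assms]]
  have d: "((\<lambda>Z. phase_inv Z * root_branch (phase_inv Z)) has_field_derivative
      (?s + (- 1 / (4 * ?y ^ 3 * ?s)) * ?y) * (1 / (4 * ?s))) (at Z)" .
  have e: "(?s + (- 1 / (4 * ?y ^ 3 * ?s)) * ?y) * (1 / (4 * ?s)) = (1 - (tau Z)\<^sup>2) / 4"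
    unfolding tau_def using f(2,3) by (simp add: field_simps power2_eq_square power3_eq_cube)
  have "((\<lambda>Z. - 1 / 2 * inverse (phase_inv Z * root_branch (phase_inv Z))) has_field_derivative
      - 1 / 2 * (- (inverse (?y * ?s) * ((1 - (tau Z)\<^sup>2) / 4) * inverse (?y * ?s)))) (at Z)"
    using f(2,3) by (intro DERIV_cmult DERIV_inverse' d[unfolded e]) auto
  also have "(\<lambda>Z. - 1 / 2 * inverse (phase_inv Z * root_branch (phase_inv Z))) = tau"
    by (rule ext) (simp add: tau_def inverse_eq_divide)
  also have "- 1 / 2 * (- (inverse (?y * ?s) * ((1 - (tau Z)\<^sup>2) / 4) * inverse (?y * ?s))) = (tau Z)\<^sup>2 * (1 - (tau Z)\<^sup>2) / 2"
  proof -
    have "inverse (?y * ?s) = - 2 * tau Z" by (simp add: tau_def inverse_eq_divide)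
    then show ?thesis by (simp add: power2_eq_square)
  qed
  finally show ?thesis .
qed

lemma coord_has_derivative:
  assumes "Z \<notin> phase_segment"
  shows "(coord has_field_derivative - (tau Z)\<^sup>2 / 2) (at Z)"
proof -
  note f = phase_inv_facts[OF assms]
  have "(coord has_field_derivative - 1 / (2 * (phase_inv Z)\<^sup>2 * root_branch (phase_inv Z)) * (1 / (4 * root_branch (phase_inv Z)))) (at Z)"
    unfolding coord_def[abs_def]
    by (rule DERIV_chain2[OF arsinh_coord_has_derivative[OF f(1)] phase_inv_has_derivative[OF assms]])
  also have "- 1 / (2 * (phase_inv Z)\<^sup>2 * root_branch (phase_inv Z)) * (1 / (4 * root_branch (phase_inv Z))) = - (tau Z)\<^sup>2 / 2"
    unfolding tau_def using f(2,3) by (simp add: field_simps power2_eq_square)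
  finally show ?thesis .
qed

text \<open>
  Multiplying the equation by \<open>x / u\<close> turns the left-hand side, together with the first two terms on the right,
  into a derivative.
\<close>
lemma log_derivative_PIII:
  assumes S: "open S" "u holomorphic_on S" "x \<in> S"
    and x: "x \<noteq> 0" "u x \<noteq> 0" "PIII_at a b u x"
  shows "((\<lambda>x. x * deriv u x / u x) has_field_derivative
      4 * a * u x + 4 * (1 - b) / u x + 4 * x * (u x)\<^sup>2 - 4 * x / (u x)\<^sup>2) (at x)"
proof -
  have u': "(u has_field_derivative deriv u x) (at x)" using holomorphic_derivI[OF S(2,1,3)] .
  have u'': "(deriv u has_field_derivative deriv (deriv u) x) (at x)"
    using holomorphic_derivI[OF holomorphic_deriv[OF S(2,1)] S(1,3)] .
  have "((\<lambda>x. x * deriv u x / u x) has_field_derivative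
      ((1 * deriv u x + deriv (deriv u) x * x) * u x - (x * deriv u x) * deriv u x) / (u x * u x)) (at x)"
    by (rule DERIV_divide[OF DERIV_mult[OF DERIV_ident u''] u' x(2)])
  also have "((1 * deriv u x + deriv (deriv u) x * x) * u x - (x * deriv u x) * deriv u x) / (u x * u x)
      = 4 * a * u x + 4 * (1 - b) / u x + 4 * x * (u x)\<^sup>2 - 4 * x / (u x)\<^sup>2"
    unfolding x(3)[unfolded PIII_at_def] using x(1,2)
    by (simp add: field_simps power2_eq_square power3_eq_cube)
  finally show ?thesis .
qed

text \<open>
  The part of the rescaled equation of order \<open>n\<^sup>2\<close>. Its expansion starts with \<open>h\<close>; this is the normalization achieved by
  the phase coordinate.
\<close>
definition sinh_nonlinearity :: "complex \<Rightarrow> complex \<Rightarrow> complex" where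
  "sinh_nonlinearity t h = (cosh h + t * sinh h) * (sinh h + t * (cosh h - 1))"

text \<open>
  What remains of the second derivative of \<open>h\<close> when \<open>n\<^sup>2 * h\<close> is subtracted, with \<open>h1\<close> for the derivative of \<open>h\<close>
  and \<open>t\<close> for \<open>tau\<close>.
\<close>
definition phase_perturbation :: "real \<Rightarrow> complex \<Rightarrow> complex \<Rightarrow> complex \<Rightarrow> complex \<Rightarrow> complex" where
  "phase_perturbation n m t h h1 = t * (1 - t\<^sup>2) / 2 * h1 - t ^ 3 * (1 - t\<^sup>2) / 4
     + (of_real n)\<^sup>2 * (sinh_nonlinearity t h - h) - of_real n * m * t * (sinh h + t * cosh h)"

text \<open>
  With \<open>v = 1 / u\<close> the identities \<open>u = s * (1 + t) * E\<close> and \<open>v = s * (1 - t) / E\<close> express the hyperbolic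
  functions of \<open>h\<close>, where \<open>E = exp h\<close>, through \<open>u + v\<close> and \<open>u - v\<close>; then both sides are polynomials in \<open>u\<close>, \<open>v\<close>
  and \<open>t\<close>.
\<close>
lemma rescaled_PIII_algebra:
  fixes n m y s E t :: complex
  assumes nz: "y \<noteq> 0" "s \<noteq> 0" "E \<noteq> 0"
    and s2: "s\<^sup>2 = 1 / (4 * y\<^sup>2) + 1" and t: "t = - 1 / (2 * y * s)"
    and u: "u = E * (s - 1 / (2 * y))"
    and ch: "ch = (E + 1 / E) / 2" and sh: "sh = (E - 1 / E) / 2"
  shows "- (t / 2) * (n / (4 * s) * (4 * (n + m) * u + 4 * (n - m) / u + 4 * (n * y) * u\<^sup>2 - 4 * (n * y) / u\<^sup>2))
     = n\<^sup>2 * ((ch + t * sh) * (sh + t * (ch - 1))) - n * m * t * (sh + t * ch)"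
proof -
  define v where "v = (s + 1 / (2 * y)) / E"
  have "(s - 1 / (2 * y)) * (s + 1 / (2 * y)) = s\<^sup>2 - 1 / (4 * y\<^sup>2)" by (simp add: algebra_simps power2_eq_square)
  then have e1: "(s - 1 / (2 * y)) * (s + 1 / (2 * y)) = 1" unfolding s2 by simp
  have "u * v = (s - 1 / (2 * y)) * (s + 1 / (2 * y))" using nz(3) by (simp add: u v_def)
  then have uv: "u * v = 1" using e1 by simp
  then have "u \<noteq> 0" by auto
  have iv: "1 / u = v" using uv \<open>u \<noteq> 0\<close> by (simp add: field_simps)
  have iv2: "c / u = c * v" "c / u\<^sup>2 = c * v\<^sup>2" for c
    using iv by (metis mult.right_neutral times_divide_eq_right, metis mult.right_neutral power_one_over times_divide_eq_right)
  have st: "s * (1 + t) = s - 1 / (2 * y)" "s * (1 - t) = s + 1 / (2 * y)" using nz by (simp_all add: t field_simps)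
  have U: "u = E * (s * (1 + t))" "v = (s * (1 - t)) / E" unfolding st u v_def by simp_all
  have b1: "ch + t * sh = (u + v) / (2 * s)" unfolding U ch sh using nz by (simp add: field_simps)
  have b2: "sh + t * ch = (u - v) / (2 * s)" unfolding U ch sh using nz by (simp add: field_simps)
  have b3: "sh + t * (ch - 1) = (u - v) / (2 * s) - t" unfolding b2[symmetric] by (simp add: algebra_simps)
  have yt: "y * t = - 1 / (2 * s)" using nz by (simp add: t)
  have "- (t / 2) * (n / (4 * s) * (4 * (n + m) * u + 4 * (n - m) / u + 4 * (n * y) * u\<^sup>2 - 4 * (n * y) / u\<^sup>2))
     = - (t / 2) * (n / (4 * s)) * (4 * n * (u + v) + 4 * m * (u - v)) - (n\<^sup>2 / (2 * s)) * (y * t) * (u\<^sup>2 - v\<^sup>2)"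
    unfolding iv2 using nz(2) by (simp add: field_simps power2_eq_square)
  also have "\<dots> = n\<^sup>2 * ((u + v) / (2 * s) * ((u - v) / (2 * s) - t)) - n * m * t * ((u - v) / (2 * s))"
    unfolding yt using nz(2) by (simp add: field_simps power2_eq_square)
  finally show ?thesis unfolding b1 b2 b3 .
qed

text \<open>
  The equation for \<open>h = Ln F\<close>, where \<open>F = u / (\<i> * p_PIII)\<close> is written with \<open>exp (coord Z)\<close> for the reciprocal of
  \<open>\<i> * p_PIII y\<close>. The derivative of \<open>h\<close> is an affine function of \<open>x * u' / u\<close> at \<open>x = n * y\<close>, so that its own derivative
  is given by \<open>log_derivative_PIII\<close>.
\<close>
lemma rescaled_PIII:
  fixes u :: "complex \<Rightarrow> complex" and n :: real and m :: complex
  assumes n: "n > 0" and S: "open S" "u holomorphic_on S"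
    and sol: "\<And>x. x \<in> S \<Longrightarrow> x \<noteq> 0 \<Longrightarrow> u x \<noteq> 0 \<Longrightarrow> PIII_at (of_real n + m) (m - of_real n + 1) u x"
    and Z: "Z \<notin> phase_segment" "of_real n * phase_inv Z \<in> S"
  defines "F \<equiv> \<lambda>Z. u (of_real n * phase_inv Z) * exp (coord Z)"
    and "h1 \<equiv> \<lambda>Z. - (tau Z / 2) * (of_real n * phase_inv Z * deriv u (of_real n * phase_inv Z) / u (of_real n * phase_inv Z)) - (tau Z)\<^sup>2 / 2"
  assumes F: "norm (F Z - 1) < 1"
  shows "((\<lambda>Z. Ln (F Z)) has_field_derivative h1 Z) (at Z)"
    and "(h1 has_field_derivative of_real (n\<^sup>2) * Ln (F Z) + phase_perturbation n m (tau Z) (Ln (F Z)) (h1 Z)) (at Z)"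
proof -
  note f = phase_inv_facts[OF Z(1)]
  let ?y = "phase_inv Z" and ?s = "root_branch (phase_inv Z)" and ?t = "tau Z" and ?x = "of_real n * phase_inv Z"
  define q where "q = (\<lambda>x. x * deriv u x / u x)"
  have F0: "F Z \<noteq> 0" using F by auto
  then have u0: "u ?x \<noteq> 0" by (simp add: F_def)
  have x0: "?x \<noteq> 0" using n f by simp
  have dx: "((\<lambda>Z. of_real n * phase_inv Z) has_field_derivative of_real n * (1 / (4 * ?s))) (at Z)"
    by (rule DERIV_cmult[OF phase_inv_has_derivative[OF Z(1)]])
  have du: "((\<lambda>Z. u (of_real n * phase_inv Z)) has_field_derivative deriv u ?x * (of_real n * (1 / (4 * ?s)))) (at Z)"
    by (rule DERIV_chain2[OF holomorphic_derivI[OF S(2,1) Z(2)] dx])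
  have de: "((\<lambda>Z. exp (coord Z)) has_field_derivative exp (coord Z) * (- ?t\<^sup>2 / 2)) (at Z)"
    by (rule DERIV_chain2[OF DERIV_exp coord_has_derivative[OF Z(1)]])
  have dF: "(F has_field_derivative F Z * h1 Z) (at Z)"
  proof -
    have "of_real n * (1 / (4 * ?s)) = - (?t / 2) * ?x" unfolding tau_def using f by (simp add: field_simps)
    then have e: "deriv u ?x * (of_real n * (1 / (4 * ?s))) = u ?x * (- (?t / 2) * q ?x)"
      using u0 by (simp add: q_def)
    have "(F has_field_derivative u ?x * (- (?t / 2) * q ?x) * exp (coord Z) + exp (coord Z) * (- ?t\<^sup>2 / 2) * u ?x) (at Z)"
      unfolding F_def by (rule DERIV_mult[OF du[unfolded e] de])
    then show ?thesis
      by (rule DERIV_cong) (simp add: F_def h1_def q_def algebra_simps)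
  qed
  have Fn: "F Z \<notin> \<real>\<^sub>\<le>\<^sub>0"
  proof
    assume "F Z \<in> \<real>\<^sub>\<le>\<^sub>0"
    then have "Re (F Z) \<le> 0" by (auto simp: complex_nonpos_Reals_iff)
    then show False using F abs_Re_le_cmod[of "F Z - 1"] by simp
  qed
  have "((\<lambda>Z. Ln (F Z)) has_field_derivative inverse (F Z) * (F Z * h1 Z)) (at Z)"
    by (rule DERIV_chain2[OF has_field_derivative_Ln[OF Fn] dF])
  moreover have "inverse (F Z) * (F Z * h1 Z) = h1 Z" using F0 by (simp add: field_simps)
  ultimately show "((\<lambda>Z. Ln (F Z)) has_field_derivative h1 Z) (at Z)" by (rule DERIV_cong)
  define E where "E = F Z"
  define h where "h = Ln (F Z)"
  have Eh: "E = exp h" unfolding E_def h_def using F0 by simp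
  have E0: "E \<noteq> 0" unfolding E_def by (rule F0)
  have chE: "cosh h = (E + 1 / E) / 2" and shE: "sinh h = (E - 1 / E) / 2"
    unfolding Eh cosh_field_def sinh_field_def exp_minus inverse_eq_divide by (rule refl)+
  have ux: "u ?x = E * (?s - 1 / (2 * ?y))"
    unfolding E_def F_def exp_minus_arsinh_coord[OF f(1), symmetric] coord_def
    by (simp add: exp_minus)
  have dq: "(q has_field_derivative
      4 * (of_real n + m) * u ?x + 4 * (of_real n - m) / u ?x + 4 * ?x * (u ?x)\<^sup>2 - 4 * ?x / (u ?x)\<^sup>2) (at ?x)"
    using log_derivative_PIII[OF S Z(2) x0 u0 sol[OF Z(2) x0 u0]] unfolding q_def by simp
  define R where "R = 4 * (of_real n + m) * u ?x + 4 * (of_real n - m) / u ?x + 4 * ?x * (u ?x)\<^sup>2 - 4 * ?x / (u ?x)\<^sup>2"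
  have dqZ: "((\<lambda>Z. q (of_real n * phase_inv Z)) has_field_derivative R * (of_real n * (1 / (4 * ?s)))) (at Z)"
    unfolding R_def by (rule DERIV_chain2[OF dq dx])
  define t' where "t' = ?t\<^sup>2 * (1 - ?t\<^sup>2) / 2"
  have h1q: "h1 = (\<lambda>Z. (- 1 / 2 * tau Z) * q (of_real n * phase_inv Z) - 1 / 2 * (tau Z * tau Z))"
    by (rule ext) (simp add: h1_def q_def power2_eq_square)
  have td: "(tau has_field_derivative t') (at Z)" unfolding t'_def by (rule tau_has_derivative[OF Z(1)])
  have e0: "(h1 has_field_derivative (- 1 / 2 * t') * q ?x + R * (of_real n * (1 / (4 * ?s))) * (- 1 / 2 * ?t)
      - 1 / 2 * (t' * ?t + t' * ?t)) (at Z)"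
    unfolding h1q
    by (intro DERIV_diff DERIV_mult[OF DERIV_cmult[OF td] dqZ] DERIV_cmult DERIV_mult[OF td td])
  have e1: "(- 1 / 2 * t') * q ?x = ?t * (1 - ?t\<^sup>2) / 2 * (h1 Z + ?t\<^sup>2 / 2)"
  proof -
    have "h1 Z + ?t\<^sup>2 / 2 = - (?t / 2) * q ?x" by (simp add: h1_def q_def)
    moreover have "(- 1 / 2 * (t\<^sup>2 * (1 - t\<^sup>2) / 2)) * w = t * (1 - t\<^sup>2) / 2 * (- (t / 2) * w)" for t w :: complex
      by (simp add: power2_eq_square field_simps)
    ultimately show ?thesis unfolding t'_def by (simp only:)
  qed
  have e2: "R * (of_real n * (1 / (4 * ?s))) * (- 1 / 2 * ?t)
      = of_real (n\<^sup>2) * sinh_nonlinearity ?t h - of_real n * m * ?t * (sinh h + ?t * cosh h)"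
  proof -
    have "- (?t / 2) * (of_real n / (4 * ?s) * (4 * (of_real n + m) * u ?x + 4 * (of_real n - m) / u ?x + 4 * (of_real n * ?y) * (u ?x)\<^sup>2 - 4 * (of_real n * ?y) / (u ?x)\<^sup>2))
      = (of_real n)\<^sup>2 * ((cosh h + ?t * sinh h) * (sinh h + ?t * (cosh h - 1))) - of_real n * m * ?t * (sinh h + ?t * cosh h)"
      by (rule rescaled_PIII_algebra[OF f(2,3) E0 f(5) tau_def ux chE shE])
    moreover have "R * (a * (1 / b)) * (- 1 / 2 * t) = - (t / 2) * (a / b * R)" for a b t :: complex by (simp add: mult_ac)
    ultimately show ?thesis unfolding R_def sinh_nonlinearity_def of_real_power by (simp only:)
  qed
  have collect: "t * (1 - t\<^sup>2) / 2 * (g + t\<^sup>2 / 2) + (of_real (n\<^sup>2) * sinh_nonlinearity t h - c) - 1 / 2 * (t\<^sup>2 * (1 - t\<^sup>2) / 2 * t + t\<^sup>2 * (1 - t\<^sup>2) / 2 * t)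
      = of_real (n\<^sup>2) * h + (t * (1 - t\<^sup>2) / 2 * g - t ^ 3 * (1 - t\<^sup>2) / 4 + (of_real n)\<^sup>2 * (sinh_nonlinearity t h - h) - c)"
    for t g c :: complex by (simp add: power2_eq_square power3_eq_cube field_simps)
  show "(h1 has_field_derivative of_real (n\<^sup>2) * Ln (F Z) + phase_perturbation n m (tau Z) (Ln (F Z)) (h1 Z)) (at Z)"
    unfolding h_def[symmetric] phase_perturbation_def by (intro DERIV_cong[OF e0], unfold e1 e2, unfold t'_def, rule collect)
qed

lemma cosh_sinh_small:
  fixes h :: complex assumes "norm h \<le> 1"
  shows "norm (exp h - 1 - h) \<le> 3 * (norm h)\<^sup>2" "norm (cosh h - 1) \<le> 3 * (norm h)\<^sup>2" "norm (sinh h - h) \<le> 3 * (norm h)\<^sup>2"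
    "norm (sinh h) \<le> 4 * norm h" "norm (cosh h) \<le> 4"
proof -
  have e: "norm (exp z - 1 - z) \<le> 3 * (norm z)\<^sup>2" if "norm z \<le> 1" for z :: complex
  proof -
    have "norm (exp z - (\<Sum>k\<le>1. z ^ k / fact k)) \<le> exp \<bar>Re z\<bar> * (norm z ^ Suc 1) / fact 1"
      by (rule Taylor_exp)
    moreover have "(\<Sum>k\<le>1. z ^ k / fact k) = 1 + z" by simp
    moreover have "exp \<bar>Re z\<bar> \<le> 3"
    proof -
      have "exp \<bar>Re z\<bar> \<le> exp 1" using abs_Re_le_cmod[of z] that by simp
      then show ?thesis using exp_le by linarith
    qed
    then have "exp \<bar>Re z\<bar> * (norm z)\<^sup>2 \<le> 3 * (norm z)\<^sup>2" by (intro mult_right_mono) auto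
    ultimately show ?thesis by (simp add: diff_diff_eq numeral_2_eq_2)
  qed
  show e1: "norm (exp h - 1 - h) \<le> 3 * (norm h)\<^sup>2" by (rule e[OF assms])
  have e2: "norm (exp (- h) - 1 - - h) \<le> 3 * (norm h)\<^sup>2" using e[of "- h"] assms by (simp del: diff_minus_eq_add)
  have "cosh h - 1 = ((exp h - 1 - h) + (exp (- h) - 1 - - h)) / 2"
    by (simp add: cosh_field_def field_simps)
  then have "norm (cosh h - 1) = norm ((exp h - 1 - h) + (exp (- h) - 1 - - h)) / 2" by (simp only: norm_divide norm_numeral)
  then show c: "norm (cosh h - 1) \<le> 3 * (norm h)\<^sup>2"
    using norm_triangle_ineq[of "exp h - 1 - h" "exp (- h) - 1 - - h"] e1 e2 by linarith
  have "sinh h - h = ((exp h - 1 - h) - (exp (- h) - 1 - - h)) / 2"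
    by (simp add: sinh_field_def field_simps)
  then have "norm (sinh h - h) = norm ((exp h - 1 - h) - (exp (- h) - 1 - - h)) / 2" by (simp only: norm_divide norm_numeral)
  then show s: "norm (sinh h - h) \<le> 3 * (norm h)\<^sup>2"
    using norm_triangle_ineq4[of "exp h - 1 - h" "exp (- h) - 1 - - h"] e1 e2 by linarith
  have sq: "(norm h)\<^sup>2 \<le> norm h" using assms by (simp add: power2_eq_square mult_left_le)
  show "norm (sinh h) \<le> 4 * norm h" using norm_triangle_sub[of "sinh h" h] s sq by linarith
  show "norm (cosh h) \<le> 4" using norm_triangle_sub[of "cosh h" 1] c sq assms by simp
qed

lemma norm_sinh_nonlinearity_minus:
  assumes h: "norm h \<le> 1" and t: "norm t \<le> T" and T: "T \<ge> 1"
  shows "norm (sinh_nonlinearity t h - h) \<le> 55 * T\<^sup>2 * (norm h)\<^sup>2"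
proof -
  note b = cosh_sinh_small[OF h]
  define H where "H = norm h"
  have H: "0 \<le> H" "H \<le> 1" using h by (auto simp: H_def)
  have T0: "0 \<le> norm t" "1 \<le> T\<^sup>2" "T \<le> T\<^sup>2" using T one_le_power[of T 2] self_le_power[of T 2] by auto
  have e: "sinh_nonlinearity t h - h = (sinh h - h) + (cosh h - 1) * sinh h + t * (cosh h * (cosh h - 1)) + t * (sinh h * sinh h)
      + t * t * (sinh h * (cosh h - 1))"
    unfolding sinh_nonlinearity_def by (simp add: algebra_simps)
  have 1: "norm (sinh h - h) \<le> 3 * H\<^sup>2" using b by (simp add: H_def)
  have 2: "norm ((cosh h - 1) * sinh h) \<le> 3 * H\<^sup>2 * 4"
    unfolding norm_mult using b H by (intro mult_mono) (auto simp: H_def intro: order_trans)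
  have 3: "norm (t * (cosh h * (cosh h - 1))) \<le> T * (4 * (3 * H\<^sup>2))"
    unfolding norm_mult using b t T by (intro mult_mono) (auto simp: H_def)
  have 4: "norm (t * (sinh h * sinh h)) \<le> T * ((4 * H) * (4 * H))"
    unfolding norm_mult using b t T by (intro mult_mono) (auto simp: H_def)
  have 5: "norm (t * t * (sinh h * (cosh h - 1))) \<le> T * T * (4 * (3 * H\<^sup>2))"
    unfolding norm_mult using b t T H by (intro mult_mono) (auto simp: H_def intro: order_trans)
  have "norm (sinh_nonlinearity t h - h) \<le> 3 * H\<^sup>2 + 3 * H\<^sup>2 * 4 + T * (4 * (3 * H\<^sup>2)) + T * ((4 * H) * (4 * H)) + T * T * (4 * (3 * H\<^sup>2))"
    unfolding e using 1 2 3 4 5 by (intro norm_triangle_mono)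
  also have "\<dots> = (15 + 28 * T + 12 * T\<^sup>2) * H\<^sup>2" by (simp add: algebra_simps power2_eq_square)
  also have "\<dots> \<le> (55 * T\<^sup>2) * H\<^sup>2" using T0 by (intro mult_right_mono) auto
  finally show ?thesis by (simp add: H_def)
qed

text \<open>
  The derivative of \<open>h\<close> is of order \<open>n\<close> times \<open>h\<close>, so it is measured as \<open>norm h1 / n\<close>; relative to \<open>n\<^sup>2\<close> its coefficient and
  the inhomogeneous terms are then of order \<open>1 / n\<close>.
\<close>
lemma norm_phase_perturbation:
  assumes h: "norm h \<le> \<delta>" "\<delta> \<le> 1" and t: "norm t \<le> T" and T: "T \<ge> 1" and n: "n \<ge> 1"
  shows "norm (phase_perturbation n m t h h1) \<le> n\<^sup>2 * (55 * T\<^sup>2 * \<delta> * norm h + T ^ 3 / n * (norm h1 / n) + (8 * norm m * T\<^sup>2 + T ^ 5) / n)"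
proof -
  have h1': "norm h \<le> 1" using h by simp
  note b = cosh_sinh_small[OF h1']
  have T2: "T\<^sup>2 \<ge> 1" using T by simp
  have t2: "norm (1 - t\<^sup>2) \<le> 2 * T\<^sup>2"
  proof -
    have "norm (1 - t\<^sup>2) \<le> 1 + (norm t)\<^sup>2" using norm_triangle_ineq4[of 1 "t\<^sup>2"] by (simp add: norm_power)
    moreover have "(norm t)\<^sup>2 \<le> T\<^sup>2" using t by (intro power_mono) auto
    ultimately show ?thesis using T2 by linarith
  qed
  have a1: "norm (t * (1 - t\<^sup>2) / 2 * h1) \<le> T ^ 3 * norm h1"
  proof -
    have "norm t * norm (1 - t\<^sup>2) \<le> T * (2 * T\<^sup>2)" using t t2 T by (intro mult_mono) auto
    then have "norm t * norm (1 - t\<^sup>2) / 2 \<le> T ^ 3" by (simp add: power2_eq_square power3_eq_cube)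
    then show ?thesis unfolding norm_mult norm_divide by (intro mult_right_mono) (auto simp: norm_mult)
  qed
  have a2: "norm (t ^ 3 * (1 - t\<^sup>2) / 4) \<le> n * T ^ 5"
  proof -
    have "norm t ^ 3 * norm (1 - t\<^sup>2) \<le> T ^ 3 * (2 * T\<^sup>2)" using t t2 T by (intro mult_mono power_mono) auto
    also have "T ^ 3 * (2 * T\<^sup>2) = 2 * T ^ 5" by (simp add: power_numeral_reduce)
    finally have "norm (t ^ 3 * (1 - t\<^sup>2) / 4) \<le> T ^ 5"
    proof -
      assume *: "norm t ^ 3 * norm (1 - t\<^sup>2) \<le> 2 * T ^ 5"
      have "norm (t ^ 3 * (1 - t\<^sup>2) / 4) = norm t ^ 3 * norm (1 - t\<^sup>2) / 4" by (simp add: norm_mult norm_divide norm_power)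
      moreover have "0 \<le> T ^ 5" using T by simp
      ultimately show ?thesis using * by linarith
    qed
    also have "1 * T ^ 5 \<le> n * T ^ 5" using n T by (intro mult_right_mono) auto
    finally show ?thesis by simp
  qed
  have a3: "norm ((of_real n)\<^sup>2 * (sinh_nonlinearity t h - h)) \<le> n\<^sup>2 * (55 * T\<^sup>2 * \<delta> * norm h)"
  proof -
    have "(norm h)\<^sup>2 \<le> \<delta> * norm h" using h unfolding power2_eq_square by (intro mult_right_mono) auto
    then have "55 * T\<^sup>2 * (norm h)\<^sup>2 \<le> 55 * T\<^sup>2 * (\<delta> * norm h)" by (intro mult_left_mono) auto
    then have "norm (sinh_nonlinearity t h - h) \<le> 55 * T\<^sup>2 * \<delta> * norm h" using norm_sinh_nonlinearity_minus[OF h1' t T] by (simp add: mult.assoc)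
    then show ?thesis unfolding norm_mult by (auto simp: norm_power intro!: mult_left_mono)
  qed
  have a4: "norm (of_real n * m * t * (sinh h + t * cosh h)) \<le> n * (8 * norm m * T\<^sup>2)"
  proof -
    have "norm (sinh h + t * cosh h) \<le> 4 + T * 4"
      using b h1' t T by (intro norm_triangle_mono) (auto simp: norm_mult intro!: mult_mono)
    then have *: "norm (sinh h + t * cosh h) \<le> 8 * T" using T by linarith
    have "norm (of_real n * m * t * (sinh h + t * cosh h)) = n * norm m * norm t * norm (sinh h + t * cosh h)"
      using n by (simp add: norm_mult)
    also have "\<dots> \<le> n * norm m * T * (8 * T)" using * t T n by (intro mult_mono) auto
    finally show ?thesis by (simp add: power2_eq_square mult_ac)
  qed
  have "norm (phase_perturbation n m t h h1) \<le> T ^ 3 * norm h1 + n * T ^ 5 + n\<^sup>2 * (55 * T\<^sup>2 * \<delta> * norm h) + n * (8 * norm m * T\<^sup>2)"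
    unfolding phase_perturbation_def using a1 a2 a3 a4
    by (intro order_trans[OF norm_triangle_ineq4] order_trans[OF norm_triangle_ineq] add_mono order_refl)
       (auto intro!: add_mono order_trans[OF norm_triangle_ineq] order_trans[OF norm_triangle_ineq4])
  also have "\<dots> = n\<^sup>2 * (55 * T\<^sup>2 * \<delta> * norm h + T ^ 3 / n * (norm h1 / n) + (8 * norm m * T\<^sup>2 + T ^ 5) / n)"
    using n by (simp add: field_simps power2_eq_square)
  finally show ?thesis .
qed

section \<open>Propagation of the estimate from infinity\<close>

definition outside_diamond :: "real \<Rightarrow> real \<Rightarrow> complex set" where
  "outside_diamond b M = {Z. b \<le> M * \<bar>Re Z\<bar> + \<bar>Im Z\<bar>}"

text \<open>
  The part of the complement of the diamond on one side of a horizontal line; \<open>\<sigma> = 1\<close> gives the upper and \<open>\<sigma> = - 1\<close>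
  the lower side.
\<close>
definition half_region :: "real \<Rightarrow> real \<Rightarrow> real \<Rightarrow> real \<Rightarrow> complex set" where
  "half_region b M \<sigma> \<beta> = {Z \<in> outside_diamond b M. \<beta> \<le> \<sigma> * Im Z}"

text \<open>
  The rays have the slope of the edges of the diamond, so \<open>M * \<bar>Re Z\<bar> + \<bar>Im Z\<bar>\<close> does not decrease on them.
\<close>
lemma half_region_rays:
  assumes Z: "Z \<in> half_region b M \<sigma> \<beta>" and \<sigma>: "\<sigma> = 1 \<or> \<sigma> = - 1" and \<beta>: "0 \<le> \<beta>" and M: "0 \<le> M" and s: "0 \<le> s"
    and e: "e = 1 \<or> e = - 1"
  shows "Z + of_real s * Complex e (\<sigma> * M) \<in> half_region b M \<sigma> \<beta>"
proof -
  let ?W = "Z + of_real s * Complex e (\<sigma> * M)"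
  have z: "b \<le> M * \<bar>Re Z\<bar> + \<bar>Im Z\<bar>" "\<beta> \<le> \<sigma> * Im Z"
    using Z by (auto simp: half_region_def outside_diamond_def)
  have re: "Re ?W = Re Z + s * e" and im: "Im ?W = Im Z + s * (\<sigma> * M)" by simp_all
  have sM: "0 \<le> s * M" using s M by simp
  have si: "\<sigma> * Im ?W = \<sigma> * Im Z + s * M" using \<sigma> unfolding im by (auto simp: algebra_simps)
  have absi: "\<bar>Im Z\<bar> = \<sigma> * Im Z" "\<bar>Im ?W\<bar> = \<sigma> * Im ?W"
    using \<sigma> z(2) \<beta> si sM by auto
  have "\<bar>Re Z\<bar> - s \<le> \<bar>Re ?W\<bar>" unfolding re using e s by auto
  then have "M * (\<bar>Re Z\<bar> - s) \<le> M * \<bar>Re ?W\<bar>" using M by (rule mult_left_mono)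
  then have "b \<le> M * \<bar>Re ?W\<bar> + \<bar>Im ?W\<bar>" using z(1) unfolding absi si by (simp add: algebra_simps)
  moreover have "\<beta> \<le> \<sigma> * Im ?W" using si z(2) sM by linarith
  ultimately show ?thesis by (simp add: half_region_def outside_diamond_def)
qed

lemma closed_outside_diamond: "closed (outside_diamond b M)"
  unfolding outside_diamond_def by (intro closed_Collect_le continuous_intros)

lemma closed_half_region: "closed (half_region b M \<sigma> \<beta>)"
proof -
  have "half_region b M \<sigma> \<beta> = outside_diamond b M \<inter> {Z. \<beta> \<le> \<sigma> * Im Z}"
    unfolding half_region_def by blast
  moreover have "closed {Z. \<beta> \<le> \<sigma> * Im Z}" by (intro closed_Collect_le continuous_intros)
  ultimately show ?thesis using closed_outside_diamond by (metis closed_Int)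
qed

lemma outside_diamond_notin_segment:
  assumes "pi < b" "Z \<in> outside_diamond b M" shows "Z \<notin> phase_segment"
proof
  assume "Z \<in> phase_segment"
  then have "Re Z = 0" "\<bar>Im Z\<bar> \<le> pi" by (auto simp: phase_segment_def)
  then show False using assms by (simp add: outside_diamond_def)
qed

lemma half_region_notin_segment:
  "pi < b \<Longrightarrow> Z \<in> half_region b M \<sigma> \<beta> \<Longrightarrow> Z \<notin> phase_segment"
  unfolding half_region_def using outside_diamond_notin_segment by blast

lemma bounded_on_closed_avoiding_segment:
  fixes f :: "complex \<Rightarrow> complex"
  assumes "closed G" "continuous_on G f" "\<And>Z. Z \<in> G \<Longrightarrow> R \<le> norm Z \<Longrightarrow> norm (f Z) \<le> c"
  obtains B where "1 \<le> B" "\<And>Z. Z \<in> G \<Longrightarrow> norm (f Z) \<le> B"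
proof -
  have "compact (G \<inter> cball 0 R)" using assms(1) by (intro closed_Int_compact) auto
  then have "compact (f ` (G \<inter> cball 0 R))"
    using assms(2) by (intro compact_continuous_image) (auto intro: continuous_on_subset)
  then obtain B where B: "\<And>x. x \<in> f ` (G \<inter> cball 0 R) \<Longrightarrow> norm x \<le> B"
    using compact_imp_bounded bounded_iff by metis
  show ?thesis
  proof (rule that[of "Max {B, c, 1}"])
    fix Z assume Z: "Z \<in> G"
    show "norm (f Z) \<le> Max {B, c, 1}"
    proof (cases "R \<le> norm Z")
      case True
      then have "norm (f Z) \<le> c" using assms(3) Z by blast
      then show ?thesis by (simp add: le_max_iff_disj)
    next
      case False
      then have "f Z \<in> f ` (G \<inter> cball 0 R)" using Z by (intro imageI) simp
      then have "norm (f Z) \<le> B" by (rule B)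
      then show ?thesis by (simp add: le_max_iff_disj)
    qed
  qed simp
qed

lemma norm_tau_far:
  assumes "Z \<notin> phase_segment" "16 \<le> norm Z" shows "norm (tau Z) \<le> 1"
proof -
  have y: "norm (phase_inv Z) \<ge> 1" 
  proof -
    have "1 \<le> (norm Z - 12) / 4" using assms(2) by simp
    then show ?thesis using phase_inv_norm_ge[OF assms(1)] by (rule order_trans)
  qed
  have s: "norm (root_branch (phase_inv Z)) \<ge> 3 / 4" by (rule phase_large(2)[OF y])
  have "1 * (3 / 4) \<le> norm (phase_inv Z) * norm (root_branch (phase_inv Z))" using y s by (intro mult_mono) auto
  then have "1 \<le> 2 * norm (phase_inv Z) * norm (root_branch (phase_inv Z))" by simp
  then show ?thesis unfolding tau_def by (simp add: norm_divide norm_mult divide_le_eq_1)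
qed

text \<open>
  The bound is a constant of the diamond: it grows without limit as the diamond shrinks to the segment, whose end points
  correspond to the zeros of the square root.
\<close>
lemma tau_bounded:
  assumes "pi < b"
  obtains T where "1 \<le> T" "\<And>Z. Z \<in> outside_diamond b M \<Longrightarrow> norm (tau Z) \<le> T"
proof -
  have cont: "continuous_on (outside_diamond b M) tau"
    by (intro continuous_at_imp_continuous_on ballI)
       (use tau_has_derivative outside_diamond_notin_segment[OF assms] DERIV_isCont in blast)
  have far: "norm (tau Z) \<le> 1" if "Z \<in> outside_diamond b M" "16 \<le> norm Z" for Z
    by (rule norm_tau_far[OF outside_diamond_notin_segment[OF assms that(1)] that(2)])
  show ?thesis
    by (rule bounded_on_closed_avoiding_segment[OF closed_outside_diamond cont far]) (assumption | rule that)+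
qed

lemma filterlim_phase_inv:
  "filterlim phase_inv at_infinity (inf at_infinity (principal (- phase_segment)))"
  unfolding filterlim_at_infinity[OF order_refl]
proof (intro allI impI)
  fix r :: real assume "0 < r"
  have "\<forall>\<^sub>F Z in at_infinity. Z \<in> - phase_segment \<longrightarrow> r \<le> norm (phase_inv Z)"
    unfolding eventually_at_infinity
  proof (intro exI allI impI)
    fix Z assume "4 * r + 12 \<le> norm Z" "Z \<in> - phase_segment"
    then show "r \<le> norm (phase_inv Z)" using phase_inv_norm_ge[of Z] by simp
  qed
  then show "\<forall>\<^sub>F Z in inf at_infinity (principal (- phase_segment)). r \<le> norm (phase_inv Z)"
    unfolding eventually_inf_principal .
qed

text \<open>
  Limits at infinity are taken along the complement of \<open>phase_segment\<close>, since \<open>phase_inv\<close> has no meaning on the segment.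
\<close>
lemma tendsto_along_phase_inv:
  fixes g :: "complex \<Rightarrow> 'a::topological_space"
  assumes "(g \<longlongrightarrow> l) at_infinity" "n > 0"
  shows "((\<lambda>Z. g (of_real n * phase_inv Z)) \<longlongrightarrow> l) (inf at_infinity (principal (- phase_segment)))"
proof (rule filterlim_compose[OF assms(1)])
  show "filterlim (\<lambda>Z. of_real n * phase_inv Z) at_infinity (inf at_infinity (principal (- phase_segment)))"
    by (rule tendsto_mult_filterlim_at_infinity[OF tendsto_const _ filterlim_phase_inv]) (use assms(2) in auto)
qed

lemma tendsto_exp_coord:
  "((\<lambda>Z. exp (coord Z)) \<longlongrightarrow> 1) (inf at_infinity (principal (- phase_segment)))"
proof -
  have "((\<lambda>y. root_branch y + 1 / 2 * inverse y) \<longlongrightarrow> 1 + 1 / 2 * 0) at_infinity"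
    using csqrt_branch_at_infinity unfolding root_branch_def
    by (intro tendsto_intros tendsto_inverse_0)
  from tendsto_along_phase_inv[OF this, of 1]
  have "((\<lambda>Z. root_branch (phase_inv Z) + 1 / 2 * inverse (phase_inv Z)) \<longlongrightarrow> 1) (inf at_infinity (principal (- phase_segment)))"
    by simp
  moreover have "\<forall>\<^sub>F Z in inf at_infinity (principal (- phase_segment)).
      root_branch (phase_inv Z) + 1 / 2 * inverse (phase_inv Z) = exp (coord Z)"
    unfolding eventually_inf_principal coord_def
    by (intro always_eventually allI impI) (simp add: exp_arsinh_coord phase_inv_facts(1) inverse_eq_divide)
  ultimately show ?thesis by (simp add: tendsto_cong)
qed

lemma eventually_far:
  assumes "\<forall>\<^sub>F Z in inf at_infinity (principal (- phase_segment)). P Z"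
  shows "\<exists>R. \<forall>Z. R \<le> norm Z \<longrightarrow> Z \<notin> phase_segment \<longrightarrow> P Z"
  using assms unfolding eventually_inf_principal eventually_at_infinity by auto

lemma Ln_near_1:
  fixes w :: complex assumes "norm (w - 1) < 1 / 2" shows "norm (Ln w) \<le> 2 * norm (w - 1)"
  using norm_Ln_le[of "w - 1"] assms by simp

text \<open>
  The propagation from infinity. The constants are chosen so that \<open>perturbed_second_order_bound\<close> applies as soon as
  \<open>F = exp h\<close> satisfies \<open>norm (F - 1) < \<rho>\<close>, and \<open>C / n \<le> \<rho> / 2\<close> makes its conclusion strictly stronger than that
  hypothesis. A value \<open>0\<close> of \<open>u\<close>, and hence, by convention, a pole, violates \<open>norm (F - 1) < \<rho>\<close>, so poles are
  counted among the bad points.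
\<close>
lemma uniform_estimate:
  fixes u :: "complex \<Rightarrow> complex" and m :: complex
  assumes rat: "rational_fun u" and sol: "solves_PIII (of_real n + m) (m - of_real n + 1) u"
    and lim: "(u \<longlongrightarrow> 1) at_infinity"
    and b: "pi < b" and M: "0 \<le> M"
    and T: "1 \<le> T" "\<And>Z. Z \<in> outside_diamond b M \<Longrightarrow> norm (tau Z) \<le> T"
  defines "\<epsilon> \<equiv> 1 / (6 * (1 + M\<^sup>2))"
  defines "\<rho> \<equiv> \<epsilon> / (110 * T\<^sup>2)"
  defines "C \<equiv> 24 * (1 + M\<^sup>2) * (8 * norm m * T\<^sup>2 + T ^ 5)"
  assumes n: "1 \<le> n" "T ^ 3 / n \<le> \<epsilon>" "C / n \<le> \<rho> / 2"
    and Z: "Z \<in> outside_diamond b M"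
  shows "norm (u (of_real n * phase_inv Z) * exp (coord Z) - 1) \<le> C / n"
    and "norm (u (of_real n * phase_inv Z) * exp (coord Z) - 1) < \<rho>"
proof -
  define F where "F = (\<lambda>Z. u (of_real n * phase_inv Z) * exp (coord Z))"
  define q where "q = (\<lambda>x. x * deriv u x / u x)"
  define h where "h = (\<lambda>Z. Ln (F Z))"
  define h1 where "h1 = (\<lambda>Z. - (tau Z / 2) * q (of_real n * phase_inv Z) - (tau Z)\<^sup>2 / 2)"
  have K: "1 + M\<^sup>2 \<ge> 1" "1 + M\<^sup>2 > 0" by (simp_all add: add_pos_nonneg)
  have \<epsilon>: "0 < \<epsilon>" "\<epsilon> \<le> 1 / 6" "3 * (1 + M\<^sup>2) * \<epsilon> = 1 / 2"
  proof -
    show "0 < \<epsilon>" unfolding \<epsilon>_def using K by (intro divide_pos_pos mult_pos_pos) linarith+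
    have "1 / (6 * (1 + M\<^sup>2)) \<le> 1 / (6 * 1)" using K by (intro divide_left_mono mult_left_mono mult_pos_pos) linarith+
    then show "\<epsilon> \<le> 1 / 6" by (simp add: \<epsilon>_def)
    have "3 * k * (1 / (6 * k)) = 1 / 2" if "k > 0" for k :: real using that by simp
    from this[OF K(2)] show "3 * (1 + M\<^sup>2) * \<epsilon> = 1 / 2" unfolding \<epsilon>_def .
  qed
  have T2: "1 \<le> T\<^sup>2" using T(1) by simp
  have \<rho>: "0 < \<rho>" "\<rho> \<le> 1 / 660" "55 * T\<^sup>2 * (2 * \<rho>) = \<epsilon>"
  proof -
    have "0 < T\<^sup>2" using T2 by linarith
    then show "0 < \<rho>" unfolding \<rho>_def using \<epsilon>(1) by (intro divide_pos_pos mult_pos_pos) simp_all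
    show "55 * T\<^sup>2 * (2 * \<rho>) = \<epsilon>" using T(1) by (simp add: \<rho>_def)
    have "\<epsilon> / (110 * T\<^sup>2) \<le> (1 / 6) / (110 * 1)" using \<epsilon> T2 by (intro frac_le) auto
    then show "\<rho> \<le> 1 / 660" by (simp add: \<rho>_def)
  qed
  obtain P Q :: "complex poly" where Q: "Q \<noteq> 0" "coprime P Q" "u = (\<lambda>x. poly P x / poly Q x)"
    using rat by (auto simp: rational_fun_def)
  define S where "S = {x. poly Q x \<noteq> 0}"
  have oS: "open S" unfolding S_def by (intro open_Collect_neq continuous_intros)
  have holu: "u holomorphic_on S" unfolding S_def Q(3) by (intro holomorphic_intros) auto
  have good: "of_real n * phase_inv Z \<in> S" "u (of_real n * phase_inv Z) \<noteq> 0" "F Z \<noteq> 0" if "norm (F Z - 1) < \<rho>" for Z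
  proof -
    show "F Z \<noteq> 0" using that \<rho> by auto
    then show "u (of_real n * phase_inv Z) \<noteq> 0" by (simp add: F_def)
    then show "of_real n * phase_inv Z \<in> S" by (auto simp: S_def Q(3))
  qed
  have pole_form: "F Z * poly Q (of_real n * phase_inv Z) = poly P (of_real n * phase_inv Z) * exp (coord Z)"
    if "norm (F Z - 1) < \<rho>" for Z
    using good(1)[OF that] by (simp add: F_def Q(3) S_def)
  note seg = half_region_notin_segment[OF b]
  have Flim: "((\<lambda>Z. u (of_real n * phase_inv Z) * exp (coord Z)) \<longlongrightarrow> 1 * 1) (inf at_infinity (principal (- phase_segment)))"
    using n by (intro tendsto_mult tendsto_exp_coord tendsto_along_phase_inv[OF lim]) auto
  then have "\<forall>\<^sub>F Z in inf at_infinity (principal (- phase_segment)). dist (F Z) 1 < \<rho>"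
    using \<rho> unfolding F_def by (intro tendstoD) auto
  then obtain R where R: "\<And>Z. R \<le> norm Z \<Longrightarrow> Z \<notin> phase_segment \<Longrightarrow> dist (F Z) 1 < \<rho>"
    using eventually_far by blast
  have "(q \<longlongrightarrow> 0 / 1) at_infinity" unfolding q_def
    by (intro tendsto_divide rational_fun_tendsto_deriv[OF rat lim] lim) auto
  from tendsto_along_phase_inv[OF this, of n] n
  have "((\<lambda>Z. norm (q (of_real n * phase_inv Z))) \<longlongrightarrow> norm (0 / 1 :: complex)) (inf at_infinity (principal (- phase_segment)))"
    by (intro tendsto_norm) auto
  then have "\<forall>\<^sub>F Z in inf at_infinity (principal (- phase_segment)). norm (q (of_real n * phase_inv Z)) < 1"
    by (rule order_tendstoD) simp
  then obtain R' where R': "\<And>Z. R' \<le> norm Z \<Longrightarrow> Z \<notin> phase_segment \<Longrightarrow> norm (q (of_real n * phase_inv Z)) < 1"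
    using eventually_far by blast
  have isContF: "isCont F Z" if "Z \<notin> phase_segment" "of_real n * phase_inv Z \<in> S" for Z
  proof -
    have c1: "isCont u (of_real n * phase_inv Z)" using holu oS that(2)
      by (meson continuous_on_eq_continuous_at holomorphic_on_imp_continuous_on)
    have c2: "isCont (\<lambda>Z. of_real n * phase_inv Z) Z" and c3: "isCont (\<lambda>Z. exp (coord Z)) Z"
      using DERIV_isCont[OF phase_inv_has_derivative[OF that(1)]] DERIV_isCont[OF coord_has_derivative[OF that(1)]]
      by (auto intro!: continuous_intros)
    show ?thesis unfolding F_def by (rule isCont_mult[OF isCont_o2[OF c2 c1] c3])
  qed
  \<comment> \<open>the linear estimate, on a region without bad points\<close>
  have est: "norm (F Z - 1) \<le> C / n"
    if \<sigma>: "\<sigma> = 1 \<or> \<sigma> = - 1" and \<beta>: "0 \<le> \<beta>" and G: "\<And>Z. Z \<in> half_region b M \<sigma> \<beta> \<Longrightarrow> norm (F Z - 1) < \<rho>"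
      and Z: "Z \<in> half_region b M \<sigma> \<beta>" for \<sigma> \<beta> Z
  proof -
    let ?G = "half_region b M \<sigma> \<beta>"
    have D: "(h has_field_derivative h1 Z) (at Z)"
      "(h1 has_field_derivative of_real (n\<^sup>2) * h Z + phase_perturbation n m (tau Z) (h Z) (h1 Z)) (at Z)" if "Z \<in> ?G" for Z
      using rescaled_PIII[of n S u m Z] G[OF that] good(1)[OF G[OF that]] seg[OF that] n oS holu sol \<rho>
      unfolding h_def h1_def F_def q_def by (auto simp: solves_PIII_iff mult.assoc)
    have hb: "norm (h Z) \<le> 2 * \<rho>" if "Z \<in> ?G" for Z
      using Ln_near_1[of "F Z"] G[OF that] \<rho> unfolding h_def by linarith
    have tb: "norm (tau Z) \<le> T" if "Z \<in> ?G" for Z using T(2) that by (simp add: half_region_def)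
    have "continuous_on ?G h1"
      by (intro continuous_at_imp_continuous_on ballI) (use D(2) DERIV_isCont in blast)
    moreover have "norm (h1 Z) \<le> T + T\<^sup>2" if Z: "Z \<in> ?G" "R' \<le> norm Z" for Z
    proof -
      have "norm (h1 Z) \<le> norm (- (tau Z / 2) * q (of_real n * phase_inv Z)) + norm ((tau Z)\<^sup>2 / 2)"
        unfolding h1_def by (rule norm_triangle_ineq4)
      also have "norm (- (tau Z / 2) * q (of_real n * phase_inv Z)) \<le> T * 1"
      proof -
        have "norm (tau Z) / 2 \<le> T" using tb[OF Z(1)] T(1) by linarith
        then show ?thesis using R'[OF Z(2) seg[OF Z(1)]] T(1)
          unfolding norm_mult norm_minus_cancel norm_divide by (intro mult_mono) auto
      qed
      also have "norm ((tau Z)\<^sup>2 / 2) \<le> T\<^sup>2"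
      proof -
        have "(norm (tau Z))\<^sup>2 \<le> T\<^sup>2" using tb[OF Z(1)] by (intro power_mono) auto
        moreover have "norm ((tau Z)\<^sup>2 / 2) = (norm (tau Z))\<^sup>2 / 2" by (simp add: norm_divide norm_power)
        ultimately show ?thesis using zero_le_power2[of "norm (tau Z)"] by linarith
      qed
      finally show ?thesis by simp
    qed
    ultimately obtain B where B: "1 \<le> B" "\<And>Z. Z \<in> ?G \<Longrightarrow> norm (h1 Z) \<le> B"
      using bounded_on_closed_avoiding_segment[OF closed_half_region, of b M \<sigma> \<beta> h1 R' "T + T\<^sup>2"] by metis
    have main: "norm (h Z) + norm (h1 Z) / n \<le> 6 * (1 + (\<sigma> * M)\<^sup>2) * ((8 * norm m * T\<^sup>2 + T ^ 5) / n)"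
    proof (rule perturbed_second_order_bound[where G = ?G and N = "\<lambda>Z. phase_perturbation n m (tau Z) (h Z) (h1 Z)" and \<epsilon> = \<epsilon>
          and B = "2 * \<rho> + B" and h = h and ?h1.0 = h1 and n = n and z = Z])
      fix Z assume Z: "Z \<in> ?G"
      show "(h has_field_derivative h1 Z) (at Z)" by (rule D(1)[OF Z])
      show "(h1 has_field_derivative of_real (n\<^sup>2) * h Z + phase_perturbation n m (tau Z) (h Z) (h1 Z)) (at Z)" by (rule D(2)[OF Z])
      show "Z + of_real s * Complex 1 (\<sigma> * M) \<in> ?G" if "0 \<le> s" for s
        by (rule half_region_rays[OF Z \<sigma> \<beta> M that]) simp
      show "Z + of_real s * Complex (- 1) (\<sigma> * M) \<in> ?G" if "0 \<le> s" for s
        by (rule half_region_rays[OF Z \<sigma> \<beta> M that]) simp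
      show "norm (h Z) + norm (h1 Z) \<le> 2 * \<rho> + B" using hb[OF Z] B(2)[OF Z] by linarith
      have "norm (phase_perturbation n m (tau Z) (h Z) (h1 Z))
          \<le> n\<^sup>2 * (55 * T\<^sup>2 * (2 * \<rho>) * norm (h Z) + T ^ 3 / n * (norm (h1 Z) / n) + (8 * norm m * T\<^sup>2 + T ^ 5) / n)"
        by (rule norm_phase_perturbation[OF hb[OF Z] _ tb[OF Z] T(1) n(1)]) (use \<rho> in linarith)
      also have "\<dots> \<le> n\<^sup>2 * (\<epsilon> * (norm (h Z) + norm (h1 Z) / n) + (8 * norm m * T\<^sup>2 + T ^ 5) / n)"
      proof (rule mult_left_mono)
        have "T ^ 3 / n * (norm (h1 Z) / n) \<le> \<epsilon> * (norm (h1 Z) / n)" using n by (intro mult_right_mono) auto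
        then show "55 * T\<^sup>2 * (2 * \<rho>) * norm (h Z) + T ^ 3 / n * (norm (h1 Z) / n) + (8 * norm m * T\<^sup>2 + T ^ 5) / n
            \<le> \<epsilon> * (norm (h Z) + norm (h1 Z) / n) + (8 * norm m * T\<^sup>2 + T ^ 5) / n"
          unfolding \<rho>(3) distrib_left by linarith
      qed simp
      finally show "norm (phase_perturbation n m (tau Z) (h Z) (h1 Z))
          \<le> n\<^sup>2 * (\<epsilon> * (norm (h Z) + norm (h1 Z) / n) + (8 * norm m * T\<^sup>2 + T ^ 5) / n)" .
    qed (use n \<epsilon> \<sigma> Z in auto)
    have "norm (h1 Z) / n \<ge> 0" using n by simp
    with main have "norm (h Z) \<le> 6 * (1 + (\<sigma> * M)\<^sup>2) * ((8 * norm m * T\<^sup>2 + T ^ 5) / n)" by linarith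
    also have "\<dots> = C / n / 4"
    proof -
      have "(\<sigma> * M)\<^sup>2 = M\<^sup>2" using \<sigma> by (auto simp: power_mult_distrib)
      moreover have "6 * k * (c / n) = 24 * k * c / n / 4" for k c :: real by simp
      ultimately show ?thesis unfolding C_def by (simp only:)
    qed
    finally have hC: "4 * norm (h Z) \<le> C / n" by simp
    have h1': "norm (h Z) \<le> 1" using hb[OF Z] \<rho> by linarith
    have "F Z = exp (h Z)" using good(3)[OF G[OF Z]] by (simp add: h_def)
    then have "norm (F Z - 1) \<le> norm (exp (h Z) - 1 - h Z) + norm (h Z)"
      using norm_triangle_ineq[of "exp (h Z) - 1 - h Z" "h Z"] by simp
    also have "norm (exp (h Z) - 1 - h Z) \<le> 3 * (norm (h Z))\<^sup>2" by (rule cosh_sinh_small(1)[OF h1'])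
    also have "(norm (h Z))\<^sup>2 \<le> norm (h Z)" using h1' by (simp add: power2_eq_square mult_left_le)
    finally show ?thesis using hC by simp
  qed
  have allgood: "norm (F Z - 1) < \<rho>" if \<sigma>: "\<sigma> = 1 \<or> \<sigma> = - 1" and Z: "Z \<in> half_region b M \<sigma> 0" for \<sigma> Z
  proof (rule ccontr)
    assume "\<not> norm (F Z - 1) < \<rho>"
    define Bad where "Bad = half_region b M \<sigma> 0 \<inter> {Z. \<rho> \<le> norm (F Z - 1)}"
    have "Z \<in> Bad" using Z \<open>\<not> norm (F Z - 1) < \<rho>\<close> by (simp add: Bad_def)
    define V where "V = {Z. Z \<notin> phase_segment \<and> norm (F Z - 1) < \<rho>}"
    have "open V"
      unfolding open_contains_ball
    proof
      fix Z assume Z: "Z \<in> V"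
      then have c: "isCont F Z" using isContF good(1) by (simp add: V_def)
      have o: "open (- phase_segment)"
        unfolding phase_segment_def by (intro open_Compl closed_Collect_conj closed_Collect_le closed_Collect_eq continuous_intros)
      have "((\<lambda>Z. norm (F Z - 1)) \<longlongrightarrow> norm (F Z - 1)) (nhds Z)"
        using c by (intro tendsto_intros) (simp add: continuous_within tendsto_at_iff_tendsto_nhds)
      then have "\<forall>\<^sub>F W in nhds Z. norm (F W - 1) < \<rho>" using Z by (intro order_tendstoD) (auto simp: V_def)
      moreover have "\<forall>\<^sub>F W in nhds Z. W \<in> - phase_segment" using o Z by (intro eventually_nhds_in_open) (auto simp: V_def)
      ultimately have "\<forall>\<^sub>F W in nhds Z. W \<in> V" by eventually_elim (simp add: V_def)
      then show "\<exists>e>0. ball Z e \<subseteq> V" unfolding eventually_nhds_metric by (auto simp: subset_iff dist_commute)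
    qed
    have "Bad = half_region b M \<sigma> 0 - V" using seg by (auto simp: Bad_def V_def)
    then have "closed Bad" using closed_Diff[OF closed_half_region \<open>open V\<close>] by simp
    moreover have "bounded Bad"
    proof (rule boundedI)
      fix Z assume "Z \<in> Bad"
      then show "norm Z \<le> R" using R[of Z] seg[of Z] by (force simp: Bad_def dist_norm)
    qed
    ultimately have "compact Bad" by (simp add: compact_eq_bounded_closed)
    moreover have "Bad \<noteq> {}" using \<open>Z \<in> Bad\<close> by blast
    moreover have "continuous_on Bad (\<lambda>W. \<sigma> * Im W)" by (intro continuous_intros)
    ultimately have "\<exists>x\<in>Bad. \<forall>y\<in>Bad. \<sigma> * Im y \<le> \<sigma> * Im x" by (rule continuous_attains_sup)
    then obtain Z1 where Z1: "Z1 \<in> Bad" "\<And>W. W \<in> Bad \<Longrightarrow> \<sigma> * Im W \<le> \<sigma> * Im Z1" by blast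
    have Z1r: "Z1 \<in> half_region b M \<sigma> 0" "\<rho> \<le> norm (F Z1 - 1)" using Z1(1) by (auto simp: Bad_def)
    have Z1s: "Z1 \<notin> phase_segment" using seg Z1r by blast
    \<comment> \<open>approach the bad point \<open>Z1\<close> vertically from the region without bad points; working with \<open>P\<close> and \<open>Q\<close>
    instead of \<open>F\<close> covers the case that it is a pole\<close>
    define W where "W k = Z1 + of_real (inverse (real (Suc k))) * Complex 0 \<sigma>" for k
    have WF: "norm (F (W k) - 1) \<le> \<rho> / 2 \<and> norm (F (W k) - 1) < \<rho>" for k
    proof -
      define t where "t = inverse (real (Suc k))"
      have t: "t > 0" by (simp add: t_def)
      have "W k = Z1 + of_real t * Complex 0 \<sigma>" by (simp only: W_def t_def)
      then have "Im (W k) = Im Z1 + t * \<sigma>" "Re (W k) = Re Z1" by simp_all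
      then have im: "\<sigma> * Im (W k) = \<sigma> * Im Z1 + t" "Re (W k) = Re Z1" using \<sigma> by (auto simp: algebra_simps)
      have z0: "0 \<le> \<sigma> * Im Z1" "b \<le> M * \<bar>Re Z1\<bar> + \<bar>Im Z1\<bar>" using Z1r by (auto simp: half_region_def outside_diamond_def)
      have "\<bar>Im Z1\<bar> \<le> \<bar>Im (W k)\<bar>" using \<sigma> im z0 t by auto
      then have in0: "W k \<in> half_region b M \<sigma> (\<sigma> * Im Z1 + t)" using im z0 by (simp add: half_region_def outside_diamond_def)
      have g: "norm (F X - 1) < \<rho>" if X: "X \<in> half_region b M \<sigma> (\<sigma> * Im Z1 + t)" for X
      proof (rule ccontr)
        assume "\<not> norm (F X - 1) < \<rho>"
        then have "X \<in> Bad" using X z0 t by (simp add: Bad_def half_region_def)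
        then show False using Z1(2)[of X] X t by (simp add: half_region_def)
      qed
      have "norm (F (W k) - 1) \<le> C / n"
        by (rule est[OF \<sigma> _ g in0]) (use z0 t in linarith)
      then show ?thesis using n(3) \<rho> by linarith
    qed
    have Wlim: "W \<longlonglongrightarrow> Z1"
    proof -
      have "(\<lambda>k. Z1 + of_real (inverse (real (Suc k))) * Complex 0 \<sigma>) \<longlonglongrightarrow> Z1 + of_real 0 * Complex 0 \<sigma>"
        by (intro tendsto_intros LIMSEQ_inverse_real_of_nat)
      then show ?thesis by (simp add: W_def[abs_def])
    qed
    define x1 where "x1 = of_real n * phase_inv Z1"
    have xl: "(\<lambda>k. of_real n * phase_inv (W k)) \<longlonglongrightarrow> x1" unfolding x1_def
      by (intro tendsto_intros isCont_tendsto_compose[OF DERIV_isCont[OF phase_inv_has_derivative[OF Z1s]] Wlim])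
    have cl: "(\<lambda>k. exp (coord (W k))) \<longlonglongrightarrow> exp (coord Z1)"
      by (intro tendsto_intros isCont_tendsto_compose[OF DERIV_isCont[OF coord_has_derivative[OF Z1s]] Wlim])
    have "norm (poly P x1 * exp (coord Z1) - poly Q x1) \<le> \<rho> / 2 * norm (poly Q x1)"
    proof (rule tendsto_le)
      show "(\<lambda>k. norm (poly P (of_real n * phase_inv (W k)) * exp (coord (W k)) - poly Q (of_real n * phase_inv (W k))))
          \<longlonglongrightarrow> norm (poly P x1 * exp (coord Z1) - poly Q x1)"
        by (intro tendsto_intros xl cl)
      show "(\<lambda>k. \<rho> / 2 * norm (poly Q (of_real n * phase_inv (W k)))) \<longlonglongrightarrow> \<rho> / 2 * norm (poly Q x1)"
        by (intro tendsto_intros xl)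
      show "\<forall>\<^sub>F k in sequentially. norm (poly P (of_real n * phase_inv (W k)) * exp (coord (W k)) - poly Q (of_real n * phase_inv (W k)))
          \<le> \<rho> / 2 * norm (poly Q (of_real n * phase_inv (W k)))"
      proof (intro always_eventually allI)
        fix k
        let ?x = "of_real n * phase_inv (W k)"
        have e: "poly P ?x * exp (coord (W k)) - poly Q ?x = (F (W k) - 1) * poly Q ?x"
          using pole_form[of "W k"] WF[of k] by (simp add: algebra_simps)
        show "norm (poly P ?x * exp (coord (W k)) - poly Q ?x) \<le> \<rho> / 2 * norm (poly Q ?x)"
          unfolding e norm_mult using WF[of k] by (intro mult_right_mono) auto
      qed
    qed simp
    note PQ = this
    have "poly Q x1 \<noteq> 0"
    proof
      assume "poly Q x1 = 0"
      then have "poly P x1 = 0" using PQ by simp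
      then show False using coprime_poly_0[OF Q(2), of x1] \<open>poly Q x1 = 0\<close> by simp
    qed
    moreover have "F Z1 = poly P x1 / poly Q x1 * exp (coord Z1)" by (simp only: F_def x1_def Q(3))
    ultimately have "F Z1 - 1 = (poly P x1 * exp (coord Z1) - poly Q x1) / poly Q x1"
      by (simp add: field_simps)
    then have "norm (F Z1 - 1) = norm (poly P x1 * exp (coord Z1) - poly Q x1) / norm (poly Q x1)"
      by (simp only: norm_divide)
    also have "\<dots> \<le> \<rho> / 2" using PQ \<open>poly Q x1 \<noteq> 0\<close> by (simp add: divide_le_eq)
    finally show False using Z1r(2) \<rho>(1) by linarith
  qed
  obtain \<sigma> :: real where \<sigma>: "\<sigma> = 1 \<or> \<sigma> = - 1" "Z \<in> half_region b M \<sigma> 0"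
  proof (cases "Im Z \<ge> 0")
    case True then show ?thesis using that[of 1] Z by (simp add: half_region_def)
  next
    case False then show ?thesis using that[of "- 1"] Z by (simp add: half_region_def)
  qed
  show "norm (u (of_real n * phase_inv Z) * exp (coord Z) - 1) \<le> C / n"
    using est[OF \<sigma>(1) order_refl allgood[OF \<sigma>(1)] \<sigma>(2)] by (simp add: F_def)
  show "norm (u (of_real n * phase_inv Z) * exp (coord Z) - 1) < \<rho>"
    using allgood[OF \<sigma>] by (simp add: F_def)
qed

lemma rational_fun_not_pole:
  assumes "rational_fun u" "u x \<noteq> 0" shows "\<not> is_pole u x"
proof -
  obtain S where S: "finite S" "u holomorphic_on - S" "\<And>x. u x \<noteq> 0 \<Longrightarrow> x \<notin> S"
    using rational_fun_regular[OF assms(1)] by metis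
  have "open (- S)" "x \<in> - S" using S(1,3) assms(2) finite_imp_closed by blast+
  then have "isCont u x" using S(2) by (meson continuous_on_eq_continuous_at holomorphic_on_imp_continuous_on)
  then have "(u \<longlongrightarrow> u x) (at x)" by (simp add: isCont_def)
  then show ?thesis unfolding is_pole_def using not_tendsto_and_filterlim_at_infinity at_neq_bot by blast
qed

theorem theorem1:
  fixes m :: complex and K :: "complex set"
  assumes "K \<subseteq> - eye"
    and "setdist K eye > 0"
  shows "\<exists>C::real. \<forall>\<^sub>F n::int in at_top. \<forall>y\<in>K.
           \<not> is_pole (u_PIII n m) (of_int n * y) \<and>
           norm (u_PIII n m (of_int n * y) - \<i> * p_PIII y) \<le> C / real_of_int n"
proof -
  define d where "d = setdist K eye"
  obtain \<eta> where \<eta>: "0 < \<eta>" "\<And>y Z. d \<le> infdist y eye \<Longrightarrow> Z \<in> phase_segment \<Longrightarrow> \<eta> \<le> dist (phase y) Z"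
    using phase_separated_from_segment[of d] assms(2) by (auto simp: d_def)
  define b where "b = pi + \<eta> / 2"
  \<comment> \<open>half-height \<open>pi + \<eta> / 2\<close> and half-width \<open>b / M = \<eta> / 2\<close>: the diamond stays within distance \<open>\<eta>\<close> of the segment\<close>
  define M where "M = 2 * b / \<eta>"
  have b: "pi < b" "0 < b" using \<eta>(1) pi_gt_zero unfolding b_def by linarith+
  have M: "0 < M" using b \<eta>(1) by (simp add: M_def)
  have inD: "phase y \<in> outside_diamond b M" if y: "y \<in> K" for y
  proof (rule ccontr)
    assume "phase y \<notin> outside_diamond b M"
    then have lt: "M * \<bar>Re (phase y)\<bar> + \<bar>Im (phase y)\<bar> < b" by (simp add: outside_diamond_def)
    then have im: "\<bar>Im (phase y)\<bar> < b" using M by (smt (verit) mult_nonneg_nonneg abs_ge_zero)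
    have "M * \<bar>Re (phase y)\<bar> < b" using lt by (smt (verit) abs_ge_zero)
    then have re: "\<bar>Re (phase y)\<bar> < \<eta> / 2" using b \<eta>(1) by (simp add: M_def field_simps)
    have "d \<le> infdist y eye"
      using setdist_subset_left[of "{y}" K eye] y by (simp add: d_def infdist_eq_setdist)
    obtain v where v: "\<bar>v\<bar> \<le> pi" "\<bar>Im (phase y) - v\<bar> < \<eta> / 2"
    proof (cases "\<bar>Im (phase y)\<bar> \<le> pi")
      case True
      then show ?thesis using that[of "Im (phase y)"] \<eta>(1) by simp
    next
      case False
      then show ?thesis using that[of pi] that[of "- pi"] im pi_gt_zero unfolding b_def by (cases "0 \<le> Im (phase y)") auto
    qed
    have "\<eta> \<le> dist (phase y) (Complex 0 v)"
      by (rule \<eta>(2)[OF \<open>d \<le> infdist y eye\<close>]) (use v in \<open>simp add: phase_segment_def\<close>)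
    also have "\<dots> \<le> \<bar>Re (phase y)\<bar> + \<bar>Im (phase y) - v\<bar>"
      using cmod_le[of "phase y - Complex 0 v"] by (simp add: dist_norm)
    finally show False using re v(2) by linarith
  qed
  obtain T where T: "1 \<le> T" "\<And>Z. Z \<in> outside_diamond b M \<Longrightarrow> norm (tau Z) \<le> T"
    using tau_bounded[OF b(1)] by metis
  define \<epsilon> where "\<epsilon> = 1 / (6 * (1 + M\<^sup>2))"
  define \<rho> where "\<rho> = \<epsilon> / (110 * T\<^sup>2)"
  define C where "C = 24 * (1 + M\<^sup>2) * (8 * norm m * T\<^sup>2 + T ^ 5)"
  have \<epsilon>: "0 < \<epsilon>" "\<epsilon> \<le> 1" by (auto simp: \<epsilon>_def add_pos_nonneg divide_le_eq_1)
  have \<rho>: "0 < \<rho>" "\<rho> < 1"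
  proof -
    have "1 \<le> T\<^sup>2" using T(1) by simp
    then have "0 < 110 * T\<^sup>2" "\<epsilon> < 110 * T\<^sup>2" using \<epsilon>(2) by linarith+
    then show "\<rho> < 1" unfolding \<rho>_def by (simp only: divide_less_eq_1_pos)
    show "0 < \<rho>" unfolding \<rho>_def using \<epsilon>(1) \<open>0 < 110 * T\<^sup>2\<close> by (rule divide_pos_pos)
  qed
  have lims: "((\<lambda>n::int. T ^ 3 / real_of_int n) \<longlongrightarrow> 0) at_top" "((\<lambda>n::int. C / real_of_int n) \<longlongrightarrow> 0) at_top"
    by (intro tendsto_divide_0[OF tendsto_const] filterlim_at_top_imp_at_infinity filterlim_real_of_int_at_top)+
  have ev: "\<forall>\<^sub>F n::int in at_top. T ^ 3 / real_of_int n < \<epsilon>" "\<forall>\<^sub>F n::int in at_top. C / real_of_int n < \<rho> / 2"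
    using \<epsilon>(1) \<rho>(1) by (auto intro!: order_tendstoD(2)[OF lims(1)] order_tendstoD(2)[OF lims(2)] simp del: less_divide_eq_numeral1)
  have "\<forall>\<^sub>F n::int in at_top. \<forall>y\<in>K. \<not> is_pole (u_PIII n m) (of_int n * y) \<and>
           norm (u_PIII n m (of_int n * y) - \<i> * p_PIII y) \<le> (exp 2 * C) / real_of_int n"
    using ev eventually_ge_at_top[of "1::int"]
  proof eventually_elim
    case (elim n)
    show ?case
    proof
      fix y assume y: "y \<in> K"
      have X: "y \<in> eye_exterior" using y assms(1) by (auto simp: eye_eq)
      have cut: "y \<notin> branch_cut" by (rule eye_exterior_notin_branch_cut[OF X])
      have n0: "0 \<le> n" using elim by simp
      note u = u_PIII_properties[OF n0, of m]
      have pn: "of_real (real_of_int n) = (of_int n :: complex)" by simp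
      have inv: "phase_inv (phase y) = y" "coord (phase y) = arsinh_coord y"
        using phase_inv_phase[OF X] by (simp_all add: coord_def)
      have B: "norm (u_PIII n m (of_int n * y) * exp (arsinh_coord y) - 1) \<le> C / real_of_int n"
        "norm (u_PIII n m (of_int n * y) * exp (arsinh_coord y) - 1) < \<rho>"
        using uniform_estimate[OF u(1) _ u(3) b(1) less_imp_le[OF M] T, of "real_of_int n" m "phase y"] u(2) elim inD[OF y]
        unfolding inv pn \<epsilon>_def[symmetric] \<rho>_def[symmetric] C_def[symmetric] by auto
      have "u_PIII n m (of_int n * y) \<noteq> 0" using B(2) \<rho> by auto
      then have 1: "\<not> is_pole (u_PIII n m) (of_int n * y)" by (rule rational_fun_not_pole[OF u(1)])
      have "u_PIII n m (of_int n * y) - \<i> * p_PIII y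
          = exp (- arsinh_coord y) * (u_PIII n m (of_int n * y) * exp (arsinh_coord y) - 1)"
        unfolding i_p_PIII[OF cut] by (simp add: algebra_simps exp_minus)
      then have "norm (u_PIII n m (of_int n * y) - \<i> * p_PIII y)
          = exp (- Re (arsinh_coord y)) * norm (u_PIII n m (of_int n * y) * exp (arsinh_coord y) - 1)"
        by (simp add: norm_mult)
      also have "\<dots> \<le> exp 2 * (C / real_of_int n)"
        using abs_Re_arsinh_coord_le[OF X] B(1) by (intro mult_mono) auto
      finally show "\<not> is_pole (u_PIII n m) (of_int n * y) \<and>
           norm (u_PIII n m (of_int n * y) - \<i> * p_PIII y) \<le> (exp 2 * C) / real_of_int n"
        using 1 by simp
    qed
  qed
  then show ?thesis by blast
qed

end
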